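(* Let $D \subset \mathbb{R}^d$ be bounded and open and let $f \in H^1(D)$. Consider the shape optimization problem $$ \text{Minimize } \int_\Omega u \,\mathrm{d}x \quad \text{subject to} \quad \Omega \subset D \text{ quasi-open}, \quad u \in H_0^1(\Omega), \quad -\Delta u = f \text{ in } H^{-1}(\Omega), $$ where the state equation is understood in the weak sense, i.e. $u \in H_0^1(\Omega)$ and $$ \int_D \nabla u \cdot \nabla v \,\mathrm{d}x = \int_D f\, v \,\mathrm{d}x \qquad \text{for all } v \in H_0^1(\Omega). $$ This problem admits a global minimizer $(\hat\Omega, \hat u)$. That is, there exist a quasi-open set $\hat\Omega \subset D$ and a function $\hat u \in H_0^1(\hat\Omega)$ satisfying $\int_D \nabla \hat u \cdot \nabla v \,\mathrm{d}x = \int_D f\, v \,\mathrm{d}x$ for all $v \in H_0^1(\hat\Omega)$ such that $\int_{\hat\Omega} \hat u \,\mathrm{d}x \le \int_\Omega u \,\mathrm{d}x$ for every pair $(\Omega, u)$ consisting of a quasi-open set $\Omega \subset D$ and the corresponding weak solution $u \in H_0^1(\Omega)$ of the state equation on $\Omega$.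
   Context: Capacity, quasi-open sets and "quasi-everywhere" are understood in the usual sense with respect to the $H^1$-capacity on $\mathbb{R}^d$: for $A \subset \mathbb{R}^d$, $\operatorname{cap}(A) = \inf\{\|v\|_{H^1(\mathbb{R}^d)}^2 : v \in H^1(\mathbb{R}^d),\ v \ge 1 \text{ a.e. in a neighborhood of } A\}$. A set $\Omega \subset \mathbb{R}^d$ is quasi-open if for every $\varepsilon > 0$ there is an open set $G_\varepsilon \subset \mathbb{R}^d$ with $\operatorname{cap}(G_\varepsilon) < \varepsilon$ such that $\Omega \cup G_\varepsilon$ is open. A property holds quasi-everywhere (q.e.) on a set if it holds there except on a subset of capacity zero. Every function in $H^1(\mathbb{R}^d)$ has a quasi-continuous representative, unique up to equality q.e., and pointwise q.e. statements refer to this representative. For quasi-open $\Omega$, one sets $H_0^1(\Omega) = \{u \in H_0^1(\mathbb{R}^d) : u = 0 \text{ q.e. in } \mathbb{R}^d \setminus \Omega\}$, where $H_0^1(\mathbb{R}^d) = H^1(\mathbb{R}^d)$, and $H^{-1}(\Omega)$ denotes the dual space of $H_0^1(\Omega)$. In particular functions in $H_0^1(\Omega)$ with $\Omega \subset D$ are regarded as functions on all of $D$ (vanishing outside $\Omega$). The case $\Omega = \emptyset$, $u = 0$ is admissible, and the minimizer may be $(\hat\Omega,\hat u) = (\emptyset, 0)$. *)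

theory Defs
  imports "HOL-Analysis.Analysis"
begin

text \<open>
  Sobolev functions are represented by actual functions on the whole space, not by classes modulo
  null sets; for an open set \<open>U\<close> only the values on \<open>U\<close> matter. Measurability and
  integrals refer to \<^const>\<open>lebesgue\<close> because quasi-open sets need not be Borel.
\<close>

definition L2_on :: "'a::euclidean_space set \<Rightarrow> ('a \<Rightarrow> 'b::euclidean_space) \<Rightarrow> bool" where
  "L2_on U u \<longleftrightarrow>
     set_borel_measurable lebesgue U u \<and> set_integrable lebesgue U (\<lambda>x. (norm (u x))\<^sup>2)"

primrec cont_diff :: "nat \<Rightarrow> ('a::euclidean_space \<Rightarrow> real) \<Rightarrow> bool" where
  "cont_diff 0 \<phi> \<longleftrightarrow> continuous_on UNIV \<phi>"
| "cont_diff (Suc k) \<phi> \<longleftrightarrow>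
     (\<exists>\<psi>. (\<forall>x. GDERIV \<phi> x :> \<psi> x) \<and> (\<forall>b\<in>Basis. cont_diff k (\<lambda>x. \<psi> x \<bullet> b)))"

definition test_functions :: "'a::euclidean_space set \<Rightarrow> ('a \<Rightarrow> real) set" where
  "test_functions U =
     {\<phi>. (\<forall>k. cont_diff k \<phi>) \<and> compact (closure {x. \<phi> x \<noteq> 0}) \<and> closure {x. \<phi> x \<noteq> 0} \<subseteq> U}"

definition is_weak_gradient ::
  "'a::euclidean_space set \<Rightarrow> ('a \<Rightarrow> real) \<Rightarrow> ('a \<Rightarrow> 'a) \<Rightarrow> bool" where
  "is_weak_gradient U u g \<longleftrightarrow> L2_on U g \<and>
     (\<forall>\<phi>\<in>test_functions U. \<forall>\<psi>. (\<forall>x. GDERIV \<phi> x :> \<psi> x) \<longrightarrow>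
        (LINT x:U|lebesgue. u x *\<^sub>R \<psi> x) = - (LINT x:U|lebesgue. \<phi> x *\<^sub>R g x))"

definition H1 :: "'a::euclidean_space set \<Rightarrow> ('a \<Rightarrow> real) set" where
  "H1 U = {u. L2_on U u \<and> (\<exists>g. is_weak_gradient U u g)}"

text \<open>The weak gradient is unique only up to a null set; \<open>weak_grad\<close> picks one version.\<close>

definition weak_grad :: "'a::euclidean_space set \<Rightarrow> ('a \<Rightarrow> real) \<Rightarrow> 'a \<Rightarrow> 'a" where
  "weak_grad U u = (SOME g. is_weak_gradient U u g)"

definition H1_norm :: "'a::euclidean_space set \<Rightarrow> ('a \<Rightarrow> real) \<Rightarrow> real" where
  "H1_norm U u =
     sqrt ((LINT x:U|lebesgue. (u x)\<^sup>2) + (LINT x:U|lebesgue. (norm (weak_grad U u x))\<^sup>2))"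

text \<open>The capacity is \<open>\<infinity>\<close> if there is no competitor.\<close>

definition capacity :: "'a::euclidean_space set \<Rightarrow> ennreal" where
  "capacity A =
     (INF v \<in> {v \<in> H1 UNIV. \<exists>N. open N \<and> A \<subseteq> N \<and> (AE x in lebesgue. x \<in> N \<longrightarrow> 1 \<le> v x)}.
        ennreal ((H1_norm UNIV v)\<^sup>2))"

definition quasi_open :: "'a::euclidean_space set \<Rightarrow> bool" where
  "quasi_open \<Omega> \<longleftrightarrow>
     (\<forall>\<epsilon>>0. \<exists>G. open G \<and> capacity G < ennreal \<epsilon> \<and> open (\<Omega> \<union> G))"

definition quasi_everywhere_on :: "'a::euclidean_space set \<Rightarrow> ('a \<Rightarrow> bool) \<Rightarrow> bool" where
  "quasi_everywhere_on A P \<longleftrightarrow> capacity {x \<in> A. \<not> P x} = 0"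

definition quasi_continuous :: "('a::euclidean_space \<Rightarrow> real) \<Rightarrow> bool" where
  "quasi_continuous w \<longleftrightarrow>
     (\<forall>\<epsilon>>0. \<exists>G. open G \<and> capacity G < ennreal \<epsilon> \<and> continuous_on (- G) w)"

definition qc_representative ::
  "('a::euclidean_space \<Rightarrow> real) \<Rightarrow> ('a \<Rightarrow> real) \<Rightarrow> bool" where
  "qc_representative u w \<longleftrightarrow> quasi_continuous w \<and> (AE x in lebesgue. w x = u x)"

text \<open>
  Quasi-continuous representatives exist and are unique up to equality quasi-everywhere, so
  it does not matter which of them is used.
\<close>

definition H10 :: "'a::euclidean_space set \<Rightarrow> ('a \<Rightarrow> real) set" where
  "H10 \<Omega> =
     {u \<in> H1 UNIV. \<exists>w. qc_representative u w \<and> quasi_everywhere_on (- \<Omega>) (\<lambda>x. w x = 0)}"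

text \<open>
  Elements of \<open>H10 \<Omega>\<close> live on the whole space, so the gradients below are the global ones; on the
  open set \<open>D\<close> they agree almost everywhere with the weak gradients on \<open>D\<close>.
\<close>

definition weak_solution ::
  "'a::euclidean_space set \<Rightarrow> ('a \<Rightarrow> real) \<Rightarrow> 'a set \<Rightarrow> ('a \<Rightarrow> real) \<Rightarrow> bool" where
  "weak_solution D f \<Omega> u \<longleftrightarrow> u \<in> H10 \<Omega> \<and>
     (\<forall>v\<in>H10 \<Omega>. (LINT x:D|lebesgue. weak_grad UNIV u x \<bullet> weak_grad UNIV v x)
                = (LINT x:D|lebesgue. f x * v x))"

end

theory Submission
  imports Defs
begin

text \<open>
  Put \<open>q = - f\<close> on \<open>D\<close> and \<open>E v = (\<integral> |grad v|^2) / 2 - \<integral> q v\<close>. For \<open>y \<ge> 0\<close> the condition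
  \<open>- \<Delta> y \<le> q\<close> on \<open>{y > 0}\<close> can be expressed by \<open>E (max w y) \<le> E w\<close> for all \<open>w \<ge> 0\<close>. Such subsolutions
  are stable under maxima and strong limits, so by the parallelogram identity there is a subsolution \<open>Y\<close> of
  least energy, and strict convexity makes it the largest subsolution. A minimizer of \<open>E\<close>
  among the nonnegative functions in \<open>H10 {Y > 0}\<close> is again a subsolution, hence \<open>Y\<close> itself is such a
  minimizer, and therefore solves \<open>- \<Delta> Y = q\<close> on \<open>{Y > 0}\<close>. If \<open>u\<close> solves the
  state equation on any \<open>\<Omega>\<close>, then \<open>(- u)^+\<close> is a subsolution, whence \<open>- Y \<le> u\<close> almost everywhere: the state
  \<open>- Y\<close> is optimal even pointwise.
\<close>

subsection \<open>Square integrable functions\<close>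

text \<open>Working with the domains of a minimizing sequence runs into an obstacle: states on
  varying quasi-open sets may converge to a function that solves no state equation of this kind,
  because a relaxed problem with an additional zero-order term can appear. The condition on
  subsolutions mentions no domain, so it survives limits; the price is that a domain has to be
  recovered from \<open>Y\<close>, and that optimality of \<open>Y\<close> against nonnegative
  competitors has to be turned into an equation tested with all of \<open>H10\<close>. The second
  point is settled by comparing test functions with multiples of \<open>Y\<close>, not by a density
  argument. The comparison steps rest on the exact identity
  \<open>E (max u v) + E (min u v) = E u + E v\<close>: passing to maximum and minimum only swaps
  values and gradients pointwise. It needs the gradient of a positive part and the vanishing of
  gradients on zero sets. Both are obtained from strong convergence of difference quotients, which
  in turn follows from duality with test functions and continuity of translations; no mollification
  is involved. That \<open>H10\<close> is closed under strong limits is where quasi-continuity and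
  the subadditivity of capacity do the work.\<close>

definition L2 :: "('a::euclidean_space \<Rightarrow> 'b::euclidean_space) \<Rightarrow> bool" where
  "L2 u \<longleftrightarrow> u \<in> borel_measurable lebesgue \<and> integrable lebesgue (\<lambda>x. (norm (u x))\<^sup>2)"

definition ip :: "('a::euclidean_space \<Rightarrow> 'b::euclidean_space) \<Rightarrow> ('a \<Rightarrow> 'b) \<Rightarrow> real" where
  "ip u v = (LINT x|lebesgue. u x \<bullet> v x)"

definition nrm :: "('a::euclidean_space \<Rightarrow> 'b::euclidean_space) \<Rightarrow> real" where
  "nrm u = sqrt (LINT x|lebesgue. (norm (u x))\<^sup>2)"

abbreviation L2_conv :: "(nat \<Rightarrow> 'a::euclidean_space \<Rightarrow> 'b::euclidean_space) \<Rightarrow> ('a \<Rightarrow> 'b) \<Rightarrow> bool" where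
  "L2_conv u v \<equiv> (\<lambda>n. nrm (\<lambda>x. u n x - v x)) \<longlonglongrightarrow> 0"

lemma L2_on_UNIV: "L2_on UNIV u \<longleftrightarrow> L2 u"
  by (simp add: L2_on_def L2_def set_borel_measurable_def set_integrable_def)

lemma L2_on_iff: "L2_on U u \<longleftrightarrow> L2 (\<lambda>x. indicator U x *\<^sub>R u x)"
proof -
  have "(\<lambda>x. indicator U x *\<^sub>R (norm (u x))\<^sup>2) = (\<lambda>x. (norm (indicator U x *\<^sub>R u x))\<^sup>2)"
    by (auto simp: indicator_def)
  then show ?thesis
    by (simp add: L2_on_def L2_def set_borel_measurable_def set_integrable_def)
qed

lemma L2_measurable [measurable_dest]: "L2 u \<Longrightarrow> u \<in> borel_measurable lebesgue"
  by (simp add: L2_def)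

lemma L2_integrable: "L2 u \<Longrightarrow> integrable lebesgue (\<lambda>x. (norm (u x))\<^sup>2)"
  by (simp add: L2_def)

lemma borel_measurable_lebesgue_cong_AE:
  fixes u v :: "'a::euclidean_space \<Rightarrow> 'b::euclidean_space"
  assumes "u \<in> borel_measurable lebesgue" "AE x in lebesgue. u x = v x"
  shows "v \<in> borel_measurable lebesgue"
  using assms by (rule borel_measurable_AE)

text \<open>Lebesgue measure is complete, so measurability passes along equality almost everywhere;
  if neither function is measurable, both integrals have the default value 0. Later rewriting under
  integrals therefore carries no measurability conditions.\<close>

lemma integral_lebesgue_cong_AE:
  fixes u v :: "'a::euclidean_space \<Rightarrow> 'b::euclidean_space"
  assumes "AE x in lebesgue. u x = v x"
  shows "integral\<^sup>L lebesgue u = integral\<^sup>L lebesgue v"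
proof (cases "u \<in> borel_measurable lebesgue")
  case True
  then show ?thesis
    using borel_measurable_lebesgue_cong_AE[OF True assms] assms by (intro integral_cong_AE) auto
next
  case False
  then have "v \<notin> borel_measurable lebesgue"
    using borel_measurable_lebesgue_cong_AE[of v u] assms by (auto simp: eq_commute)
  then have "\<not> integrable lebesgue u" "\<not> integrable lebesgue v"
    using False by auto
  then show ?thesis
    by (simp add: not_integrable_integral_eq)
qed

lemma L2_dominated:
  fixes u :: "'a::euclidean_space \<Rightarrow> 'b::euclidean_space" and w :: "'a \<Rightarrow> 'c::euclidean_space"
  assumes "L2 w" "u \<in> borel_measurable lebesgue" "AE x in lebesgue. norm (u x) \<le> norm (w x)"
  shows "L2 u"
proof -
  have "AE x in lebesgue. norm ((norm (u x))\<^sup>2) \<le> norm ((norm (w x))\<^sup>2)"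
    using assms(3) by eventually_elim (simp add: power_mono)
  moreover have "(\<lambda>x. (norm (u x))\<^sup>2) \<in> borel_measurable lebesgue"
    using assms(2) by measurable
  ultimately show ?thesis
    using assms(2) L2_integrable[OF assms(1)] unfolding L2_def
    by (auto intro: Bochner_Integration.integrable_bound)
qed

lemma L2_cong_AE: "L2 u \<Longrightarrow> AE x in lebesgue. u x = v x \<Longrightarrow> L2 v"
  by (rule L2_dominated[of u]) (auto intro: borel_measurable_lebesgue_cong_AE[OF L2_measurable])

lemma L2_zero [simp]: "L2 (\<lambda>x. 0)"
  by (simp add: L2_def)

lemma L2_scaleR: "L2 u \<Longrightarrow> L2 (\<lambda>x. c *\<^sub>R u x)"
  unfolding L2_def by (auto simp: power_mult_distrib)

lemma L2_add:
  assumes "L2 u" "L2 v"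
  shows "L2 (\<lambda>x. u x + v x)"
proof -
  have [measurable]: "u \<in> borel_measurable lebesgue" "v \<in> borel_measurable lebesgue"
    using assms by (auto simp: L2_def)
  have "(norm (u x + v x))\<^sup>2 \<le> 2 * (norm (u x))\<^sup>2 + 2 * (norm (v x))\<^sup>2" for x
  proof -
    have "(norm (u x + v x))\<^sup>2 \<le> (norm (u x) + norm (v x))\<^sup>2"
      by (simp add: norm_triangle_ineq power_mono)
    also have "\<dots> \<le> 2 * (norm (u x))\<^sup>2 + 2 * (norm (v x))\<^sup>2"
      using sum_squares_bound[of "norm (u x)" "norm (v x)"] by (simp add: power2_sum)
    finally show ?thesis .
  qed
  moreover have "integrable lebesgue (\<lambda>x. 2 * (norm (u x))\<^sup>2 + 2 * (norm (v x))\<^sup>2)"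
    using assms by (auto simp: L2_def)
  ultimately show ?thesis
    unfolding L2_def by (auto intro: Bochner_Integration.integrable_bound)
qed

lemma L2_minus: "L2 u \<Longrightarrow> L2 (\<lambda>x. - u x)"
  using L2_scaleR[of u "-1"] by simp

lemma L2_diff: "L2 u \<Longrightarrow> L2 v \<Longrightarrow> L2 (\<lambda>x. u x - v x)"
  using L2_add[of u "\<lambda>x. - v x"] L2_minus[of v] by simp

lemma L2_cmult: "L2 u \<Longrightarrow> L2 (\<lambda>x. c * u x)" for u :: "'a::euclidean_space \<Rightarrow> real"
  using L2_scaleR[of u c] by simp

lemma L2_inner: "L2 u \<Longrightarrow> L2 v \<Longrightarrow> integrable lebesgue (\<lambda>x. u x \<bullet> v x)"
proof -
  assume uv: "L2 u" "L2 v"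
  then have [measurable]: "u \<in> borel_measurable lebesgue" "v \<in> borel_measurable lebesgue"
    by (auto simp: L2_def)
  have "\<bar>u x \<bullet> v x\<bar> \<le> (norm (u x))\<^sup>2 + (norm (v x))\<^sup>2" for x
    using Cauchy_Schwarz_ineq2[of "u x" "v x"] sum_squares_bound[of "norm (u x)" "norm (v x)"]
      mult_nonneg_nonneg[of "norm (u x)" "norm (v x)"] by (simp del: mult_nonneg_nonneg)
  moreover have "integrable lebesgue (\<lambda>x. (norm (u x))\<^sup>2 + (norm (v x))\<^sup>2)"
    using uv by (auto simp: L2_def)
  ultimately show ?thesis
    by (auto intro: Bochner_Integration.integrable_bound)
qed

section \<open>Inner product and norm of square integrable functions\<close>

lemma ip_commute: "ip u v = ip v u"
  by (simp add: ip_def inner_commute)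

lemma ip_add_left: "L2 u \<Longrightarrow> L2 v \<Longrightarrow> L2 w \<Longrightarrow> ip (\<lambda>x. u x + v x) w = ip u w + ip v w"
  by (simp add: ip_def inner_add_left L2_inner)

lemma ip_add_right: "L2 u \<Longrightarrow> L2 v \<Longrightarrow> L2 w \<Longrightarrow> ip w (\<lambda>x. u x + v x) = ip w u + ip w v"
  by (simp add: ip_def inner_add_right L2_inner)

lemma ip_scale_left: "ip (\<lambda>x. c *\<^sub>R u x) w = c * ip u w"
  by (simp add: ip_def)

lemma ip_scale_right: "ip w (\<lambda>x. c *\<^sub>R u x) = c * ip w u"
  by (simp add: ip_def)

lemma ip_diff_left: "L2 u \<Longrightarrow> L2 v \<Longrightarrow> L2 w \<Longrightarrow> ip (\<lambda>x. u x - v x) w = ip u w - ip v w"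
  by (simp add: ip_def inner_diff_left L2_inner)

lemma ip_diff_right: "L2 u \<Longrightarrow> L2 v \<Longrightarrow> L2 w \<Longrightarrow> ip w (\<lambda>x. u x - v x) = ip w u - ip w v"
  by (simp add: ip_def inner_diff_right L2_inner)

lemma ip_self: "ip u u = (nrm u)\<^sup>2"
  by (simp add: ip_def nrm_def power2_norm_eq_inner)

lemma nrm_nonneg [simp]: "0 \<le> nrm u"
  by (simp add: nrm_def)

lemma nrm_power2: "(nrm u)\<^sup>2 = (LINT x|lebesgue. (norm (u x))\<^sup>2)"
  by (simp add: nrm_def)

lemma nrm_zero [simp]: "nrm (\<lambda>x. 0) = 0"
  by (simp add: nrm_def)

lemma nrm_scaleR: "nrm (\<lambda>x. c *\<^sub>R u x) = \<bar>c\<bar> * nrm u"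
  by (simp add: nrm_def power_mult_distrib real_sqrt_mult)

lemma nrm_cmult: "nrm (\<lambda>x. c * u x) = \<bar>c\<bar> * nrm u"
  using nrm_scaleR[of c u] by simp

lemma nrm_minus_commute: "nrm (\<lambda>x. u x - v x) = nrm (\<lambda>x. v x - u x)"
  by (simp add: nrm_def norm_minus_commute)

lemma nrm_cong_AE: "AE x in lebesgue. norm (u x) = norm (v x) \<Longrightarrow> nrm u = nrm v"
  unfolding nrm_def by (intro arg_cong[where f=sqrt] integral_lebesgue_cong_AE) auto

lemma ip_cong_AE:
  assumes "AE x in lebesgue. u x = u' x" "AE x in lebesgue. v x = v' x"
  shows "ip u v = ip u' v'"
  unfolding ip_def by (intro integral_lebesgue_cong_AE) (use assms in eventually_elim, simp)

lemma nrm_mono: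
  assumes "L2 v" "L2 u" "AE x in lebesgue. norm (u x) \<le> norm (v x)"
  shows "nrm u \<le> nrm v"
proof -
  have "AE x in lebesgue. (norm (u x))\<^sup>2 \<le> (norm (v x))\<^sup>2"
    using assms(3) by eventually_elim (simp add: power_mono)
  then show ?thesis
    unfolding nrm_def using assms by (auto intro!: integral_mono_AE simp: L2_def)
qed

lemma nrm_eq_0_iff: "L2 u \<Longrightarrow> nrm u = 0 \<longleftrightarrow> (AE x in lebesgue. u x = 0)"
  unfolding nrm_def by (subst real_sqrt_eq_0_iff, subst integral_nonneg_eq_0_iff_AE) (auto simp: L2_def)

text \<open>Young's inequality with a free weight \<open>s\<close> is integrated, and
  \<open>s\<close> is then taken as the quotient of the two norms.\<close>

lemma ip_Cauchy_Schwarz: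
  assumes u: "L2 u" and v: "L2 v"
  shows "\<bar>ip u v\<bar> \<le> nrm u * nrm v"
proof -
  have young: "\<bar>ip u v\<bar> \<le> (s * (nrm u)\<^sup>2 + (nrm v)\<^sup>2 / s) / 2" if "s > 0" for s
  proof -
    have *: "\<bar>u x \<bullet> v x\<bar> \<le> (s * (norm (u x))\<^sup>2 + (norm (v x))\<^sup>2 / s) / 2" for x
    proof -
      have "0 \<le> (sqrt s * norm (u x) - norm (v x) / sqrt s)\<^sup>2"
        by simp
      also have "\<dots> = s * (norm (u x))\<^sup>2 + (norm (v x))\<^sup>2 / s - 2 * (norm (u x) * norm (v x))"
        using that by (simp add: power2_diff power_mult_distrib power_divide)
      finally show ?thesis
        using Cauchy_Schwarz_ineq2[of "u x" "v x"] by simp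
    qed
    have "\<bar>ip u v\<bar> \<le> (LINT x|lebesgue. \<bar>u x \<bullet> v x\<bar>)"
      unfolding ip_def by (rule integral_abs_bound)
    also have "\<dots> \<le> (LINT x|lebesgue. (s * (norm (u x))\<^sup>2 + (norm (v x))\<^sup>2 / s) / 2)"
      using u v * by (intro integral_mono) (auto simp: L2_inner L2_integrable)
    also have "\<dots> = (s * (nrm u)\<^sup>2 + (nrm v)\<^sup>2 / s) / 2"
      using u v by (simp add: nrm_power2 L2_integrable)
    finally show ?thesis .
  qed
  have "\<bar>ip u v\<bar> \<le> (nrm u + e) * (nrm v + e)" if "e > 0" for e
  proof -
    \<comment> \<open>The norms are enlarged by \<open>e\<close> so that the optimal weight
      \<open>b / a\<close> exists and is positive even if a norm vanishes; \<open>e\<close> tends to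
      0 at the end.\<close>
    define a b where "a = nrm u + e" and "b = nrm v + e"
    have ab: "a > 0" "b > 0" "nrm u \<le> a" "nrm v \<le> b"
      using that by (auto simp: a_def b_def add_nonneg_pos)
    have "(b / a) * (nrm u)\<^sup>2 \<le> (b / a) * a\<^sup>2" "(nrm v)\<^sup>2 / (b / a) \<le> b\<^sup>2 / (b / a)"
      using ab by (auto intro!: mult_left_mono divide_right_mono power_mono)
    moreover have "(b / a) * a\<^sup>2 = a * b" "b\<^sup>2 / (b / a) = a * b"
      using ab by (simp_all add: power2_eq_square)
    ultimately have "(b / a) * (nrm u)\<^sup>2 + (nrm v)\<^sup>2 / (b / a) \<le> 2 * (a * b)"
      by linarith
    then have "((b / a) * (nrm u)\<^sup>2 + (nrm v)\<^sup>2 / (b / a)) / 2 \<le> a * b"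
      by simp
    then show ?thesis
      using young[OF divide_pos_pos[OF ab(2,1)]] unfolding a_def[symmetric] b_def[symmetric]
      by (rule order_trans[rotated])
  qed
  then have "eventually (\<lambda>e. \<bar>ip u v\<bar> \<le> (nrm u + e) * (nrm v + e)) (at_right 0)"
    using eventually_at_right_less[of "0::real"] by (rule eventually_mono[rotated])
  moreover have "((\<lambda>e. (nrm u + e) * (nrm v + e)) \<longlongrightarrow> (nrm u + 0) * (nrm v + 0)) (at_right 0)"
    by (intro tendsto_intros)
  ultimately have "\<bar>ip u v\<bar> \<le> (nrm u + 0) * (nrm v + 0)"
    by (intro tendsto_lowerbound[OF _ _ trivial_limit_at_right_real])
  then show ?thesis
    by simp
qed

lemma nrm_triangle:
  assumes "L2 u" "L2 v"
  shows "nrm (\<lambda>x. u x + v x) \<le> nrm u + nrm v"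
proof -
  have "(nrm (\<lambda>x. u x + v x))\<^sup>2 = ip u u + 2 * ip u v + ip v v"
    using assms by (simp add: ip_self[symmetric] ip_add_left ip_add_right L2_add ip_commute[of v u])
  also have "\<dots> \<le> (nrm u + nrm v)\<^sup>2"
    using ip_Cauchy_Schwarz[OF assms] by (simp add: power2_sum ip_self)
  finally show ?thesis
    by (rule power2_le_imp_le) simp
qed

lemma nrm_triangle_diff:
  assumes "L2 u" "L2 v" "L2 w"
  shows "nrm (\<lambda>x. u x - w x) \<le> nrm (\<lambda>x. u x - v x) + nrm (\<lambda>x. v x - w x)"
  using nrm_triangle[of "\<lambda>x. u x - v x" "\<lambda>x. v x - w x"] assms by (simp add: L2_diff)

lemma nrm_triangle_le:
  assumes "L2 u" "L2 v"
  shows "nrm u \<le> nrm v + nrm (\<lambda>x. u x - v x)"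
  using nrm_triangle[of v "\<lambda>x. u x - v x"] assms by (simp add: L2_diff)

section \<open>Convergence in norm\<close>

lemma tendsto_null_bound:
  fixes f :: "nat \<Rightarrow> 'b::real_normed_vector"
  assumes "\<And>n. norm (f n - l) \<le> e n" "e \<longlonglongrightarrow> 0"
  shows "f \<longlonglongrightarrow> l"
  by (rule LIM_zero_cancel, rule Lim_null_comparison[OF _ assms(2)]) (simp add: assms(1))

lemma nrm_tendsto:
  assumes "\<And>n. L2 (u n)" "L2 v" "L2_conv u v"
  shows "(\<lambda>n. nrm (u n)) \<longlonglongrightarrow> nrm v"
proof -
  have "norm (nrm (u n) - nrm v) \<le> nrm (\<lambda>x. u n x - v x)" for n
    using nrm_triangle_le[OF assms(1)[of n] assms(2)] nrm_triangle_le[OF assms(2) assms(1)[of n]]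
    by (auto simp: nrm_minus_commute[of v])
  then show ?thesis
    using assms(3) by (rule tendsto_null_bound)
qed

lemma ip_tendsto:
  assumes "\<And>n. L2 (u n)" "L2 v" "L2 w" "L2_conv u v"
  shows "(\<lambda>n. ip (u n) w) \<longlonglongrightarrow> ip v w"
proof -
  have "norm (ip (u n) w - ip v w) \<le> nrm (\<lambda>x. u n x - v x) * nrm w" for n
    using ip_Cauchy_Schwarz[of "\<lambda>x. u n x - v x" w] assms by (simp add: ip_diff_left L2_diff)
  moreover have "(\<lambda>n. nrm (\<lambda>x. u n x - v x) * nrm w) \<longlonglongrightarrow> 0"
    using tendsto_mult_right[OF assms(4), of "nrm w"] by simp
  ultimately show ?thesis
    by (rule tendsto_null_bound)
qed

lemma nrm_null_add:
  assumes "\<And>n. L2 (u n)" "\<And>n. L2 (v n)" "(\<lambda>n. nrm (u n)) \<longlonglongrightarrow> 0" "(\<lambda>n. nrm (v n)) \<longlonglongrightarrow> 0"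
  shows "(\<lambda>n. nrm (\<lambda>x. u n x + v n x)) \<longlonglongrightarrow> 0"
proof -
  have "(\<lambda>n. nrm (u n) + nrm (v n)) \<longlonglongrightarrow> 0"
    using tendsto_add[OF assms(3,4)] by simp
  then show ?thesis
    by (rule Lim_null_comparison[OF always_eventually, rotated]) (use assms nrm_triangle in auto)
qed

lemma nrm_null_mono:
  assumes "\<And>n. L2 (u n)" "\<And>n. L2 (v n)" "(\<lambda>n. nrm (v n)) \<longlonglongrightarrow> 0"
    "\<And>n. AE x in lebesgue. norm (u n x) \<le> norm (v n x)"
  shows "(\<lambda>n. nrm (u n)) \<longlonglongrightarrow> 0"
  by (rule Lim_null_comparison[OF always_eventually assms(3)]) (simp add: nrm_mono[OF assms(2,1,4)])

lemma L2_dominated_convergence: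
  fixes u :: "nat \<Rightarrow> 'a::euclidean_space \<Rightarrow> 'b::euclidean_space" and w :: "'a \<Rightarrow> real"
  assumes w: "L2 w" and m: "\<And>n. u n \<in> borel_measurable lebesgue"
    and "AE x in lebesgue. (\<lambda>n. u n x) \<longlonglongrightarrow> v x" and "\<And>n. AE x in lebesgue. norm (u n x) \<le> w x"
    and mv: "v \<in> borel_measurable lebesgue"
  shows "L2 v" "L2_conv u v"
proof -
  have un: "AE x in lebesgue. \<forall>n. norm (u n x) \<le> w x"
    using assms(4) by (simp add: AE_all_countable)
  have v: "AE x in lebesgue. norm (v x) \<le> w x"
    using un assms(3)
  proof eventually_elim
    case (elim x)
    then show ?case
      by (intro LIMSEQ_le_const2[OF tendsto_norm[OF elim(2)]]) auto
  qed
  show "L2 v"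
    by (rule L2_dominated[OF w mv]) (use v in eventually_elim, auto)
  have "(\<lambda>n. LINT x|lebesgue. (norm (u n x - v x))\<^sup>2) \<longlonglongrightarrow> (LINT x|(lebesgue :: 'a measure). 0)"
  proof (rule integral_dominated_convergence)
    show "integrable lebesgue (\<lambda>x. 4 * (norm (w x))\<^sup>2)"
      using w by (intro integrable_mult_right L2_integrable)
    show "(\<lambda>x. (norm (u n x - v x))\<^sup>2) \<in> borel_measurable lebesgue" for n
      using m[of n] mv by measurable
    show "AE x in lebesgue. (\<lambda>n. (norm (u n x - v x))\<^sup>2) \<longlonglongrightarrow> 0"
      using assms(3)
    proof eventually_elim
      case (elim x)
      then have "(\<lambda>n. norm (u n x - v x)) \<longlonglongrightarrow> 0"
        by (rule tendsto_norm_zero[OF LIM_zero])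
      then show ?case
        using tendsto_power[of _ 0 _ 2] by auto
    qed
    show "AE x in lebesgue. norm ((norm (u n x - v x))\<^sup>2) \<le> 4 * (norm (w x))\<^sup>2" for n
      using un v
    proof eventually_elim
      case (elim x)
      have "norm (u n x - v x) \<le> 2 * \<bar>w x\<bar>"
        using elim norm_triangle_ineq4[of "u n x" "v x"] by (smt (verit))
      then have "(norm (u n x - v x))\<^sup>2 \<le> (2 * \<bar>w x\<bar>)\<^sup>2"
        by (intro power_mono) auto
      then show ?case
        by (simp add: power_mult_distrib)
    qed
  qed auto
  then show "L2_conv u v"
    unfolding nrm_def using tendsto_real_sqrt by fastforce
qed

lemma L2_conv_AE_subseq:
  assumes "\<And>n. L2 (u n)" "L2 v" "L2_conv u v"
  shows "\<exists>r. strict_mono r \<and> (AE x in lebesgue. (\<lambda>n. u (r n) x) \<longlonglongrightarrow> v x)"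
proof -
  have "(\<lambda>n. LINT x|lebesgue. norm ((norm (u n x - v x))\<^sup>2)) \<longlonglongrightarrow> 0"
    using tendsto_power[OF assms(3), of 2] by (simp add: nrm_power2)
  then obtain r where r: "strict_mono r" "AE x in lebesgue. (\<lambda>n. (norm (u (r n) x - v x))\<^sup>2) \<longlonglongrightarrow> 0"
    using tendsto_L1_AE_subseq[of lebesgue "\<lambda>n x. (norm (u n x - v x))\<^sup>2"] assms
    by (auto simp: L2_integrable L2_diff)
  have "AE x in lebesgue. (\<lambda>n. u (r n) x) \<longlonglongrightarrow> v x"
    using r(2)
  proof eventually_elim
    case (elim x)
    then have "(\<lambda>n. norm (u (r n) x - v x)) \<longlonglongrightarrow> 0"
      using tendsto_real_sqrt[OF elim] by simp
    then show ?case
      by (rule LIM_zero_cancel[OF tendsto_norm_zero_cancel])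
  qed
  with r show ?thesis by blast
qed

text \<open>The squared increments have integrals at most \<open>(1/16)^n\<close>; multiplied by
  \<open>4^n\<close> they are still summable. Hence almost everywhere the weighted squares tend to 0
  and are eventually below 1, which is the bound \<open>(1/2)^n\<close>.\<close>

lemma L2_Cauchy_fast_AE:
  fixes u :: "nat \<Rightarrow> 'a::euclidean_space \<Rightarrow> 'b::euclidean_space"
  assumes u: "\<And>n. L2 (u n)" and fast: "\<And>n. nrm (\<lambda>x. u (Suc n) x - u n x) \<le> (1/4)^n"
  shows "AE x in lebesgue. \<forall>\<^sub>F n in sequentially. norm (u (Suc n) x - u n x) \<le> (1/2)^n"
proof -
  define d where "d n x = 4^n * (norm (u (Suc n) x - u n x))\<^sup>2" for n x
  have di: "integrable lebesgue (d n)" for n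
    unfolding d_def using u by (intro integrable_mult_right L2_integrable L2_diff)
  have dm [measurable]: "d n \<in> borel_measurable lebesgue" for n
    using di by auto
  have "(LINT x|lebesgue. d n x) \<le> (1/4)^n" for n
  proof -
    have "(LINT x|lebesgue. d n x) = 4^n * (nrm (\<lambda>x. u (Suc n) x - u n x))\<^sup>2"
      by (simp add: d_def nrm_power2)
    also have "\<dots> \<le> 4^n * ((1/4)^n)\<^sup>2"
      using fast[of n] by (intro mult_left_mono power_mono) auto
    also have "\<dots> = (1/4)^n"
      by (simp add: power2_eq_square power_divide)
    finally show ?thesis .
  qed
  then have "(\<integral>\<^sup>+x. ennreal (d n x) \<partial>lebesgue) \<le> ennreal ((1/4)^n)" for n
    using di[of n] by (subst nn_integral_eq_integral) (auto simp: d_def[abs_def] intro!: ennreal_leI)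
  then have "(\<Sum>n. \<integral>\<^sup>+x. ennreal (d n x) \<partial>lebesgue) \<le> (\<Sum>n. ennreal ((1/4)^n))"
    by (intro suminf_le) auto
  also have "\<dots> = ennreal (\<Sum>n. (1/4)^n)"
    by (intro suminf_ennreal2) (auto intro: summable_geometric)
  finally have "(\<integral>\<^sup>+x. (\<Sum>n. ennreal (d n x)) \<partial>lebesgue) \<noteq> \<infinity>"
    by (subst nn_integral_suminf) (auto simp: top_unique)
  then have "AE x in lebesgue. (\<Sum>n. ennreal (d n x)) \<noteq> \<infinity>"
    by (intro nn_integral_noteq_infinite) measurable
  then show ?thesis
  proof eventually_elim
    case (elim x)
    then have "summable (\<lambda>n. d n x)"
      by (intro summable_suminf_not_top) (auto simp: d_def)
    then have "(\<lambda>n. d n x) \<longlonglongrightarrow> 0"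
      by (rule summable_LIMSEQ_zero)
    then have "\<forall>\<^sub>F n in sequentially. d n x < 1"
      by (rule order_tendstoD) auto
    then show ?case
    proof eventually_elim
      case (elim n)
      moreover have "(2::real)^n * 2^n = 4^n"
        by (subst power_mult_distrib[symmetric]) simp
      then have "(2^n * norm (u (Suc n) x - u n x))\<^sup>2 = d n x"
        unfolding d_def power_mult_distrib by (simp only: power2_eq_square)
      ultimately have "(2^n * norm (u (Suc n) x - u n x))\<^sup>2 \<le> 1\<^sup>2"
        by simp
      then have "2^n * norm (u (Suc n) x - u n x) \<le> 1"
        by (rule power2_le_imp_le) auto
      then show ?case
        by (simp add: field_simps)
    qed
  qed
qed

lemma convergent_fast:
  fixes a :: "nat \<Rightarrow> 'b::banach"
  assumes "\<forall>\<^sub>F n in sequentially. norm (a (Suc n) - a n) \<le> (1/2)^n"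
  shows "convergent a"
proof -
  have "summable (\<lambda>n. a (Suc n) - a n)"
    by (rule summable_comparison_test_ev[OF assms]) (simp add: summable_geometric)
  then have "convergent (\<lambda>n. \<Sum>k<n. a (Suc k) - a k)"
    by (simp add: summable_iff_convergent)
  then have "convergent (\<lambda>n. (a n - a 0) + a 0)"
    by (intro convergent_add convergent_const) (simp add: sum_lessThan_telescope)
  then show ?thesis by simp
qed

lemma Cauchy_fast_subseq:
  fixes d :: "nat \<Rightarrow> nat \<Rightarrow> real"
  assumes "\<And>e. e > 0 \<Longrightarrow> \<exists>N. \<forall>m\<ge>N. \<forall>n\<ge>N. d m n < e"
  shows "\<exists>r. strict_mono r \<and> (\<forall>n. d (r (Suc n)) (r n) \<le> (1/4)^n)"
proof -
  have "\<forall>k. \<exists>N. \<forall>m\<ge>N. \<forall>n\<ge>N. d m n < (1/4)^k"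
    using assms by simp
  then obtain N where N: "\<And>k m n. m \<ge> N k \<Longrightarrow> n \<ge> N k \<Longrightarrow> d m n < (1/4)^k"
    by metis
  \<comment> \<open>Adding all thresholds up to \<open>n\<close> puts \<open>r n\<close> above
    \<open>N n\<close>; the summand \<open>n\<close> makes \<open>r\<close> strictly
    increasing.\<close>
  define r where "r n = n + (\<Sum>k\<le>n. N k)" for n
  have "strict_mono r"
    by (auto simp: strict_mono_Suc_iff r_def)
  moreover have "N n \<le> r n" for n
    unfolding r_def using member_le_sum[of n "{..n}" N] by simp
  ultimately have "d (r (Suc n)) (r n) \<le> (1/4)^n" for n
    using N[of n "r (Suc n)" "r n"] by (meson le_trans less_imp_le lessI strict_monoD)
  with \<open>strict_mono r\<close> show ?thesis by blast
qed

text \<open>Riesz-Fischer: a rapidly converging subsequence has a pointwise limit almost everywhere,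
  and Fatou's lemma makes it the limit in norm.\<close>

lemma L2_complete:
  fixes u :: "nat \<Rightarrow> 'a::euclidean_space \<Rightarrow> 'b::euclidean_space"
  assumes u: "\<And>n. L2 (u n)"
    and Cau: "\<And>e. e > 0 \<Longrightarrow> \<exists>N. \<forall>m\<ge>N. \<forall>n\<ge>N. nrm (\<lambda>x. u m x - u n x) < e"
  shows "\<exists>v. L2 v \<and> L2_conv u v"
proof -
  obtain r where r: "strict_mono r" "\<And>n. nrm (\<lambda>x. u (r (Suc n)) x - u (r n) x) \<le> (1/4)^n"
    using Cauchy_fast_subseq[OF Cau] by blast
  define v where "v x = lim (\<lambda>n. u (r n) x)" for x
  have conv: "AE x in lebesgue. (\<lambda>n. u (r n) x) \<longlonglongrightarrow> v x"
    using L2_Cauchy_fast_AE[of "\<lambda>n. u (r n)", OF u r(2)]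
    by eventually_elim (auto simp: v_def dest: convergent_fast convergent_LIMSEQ_iff[THEN iffD1])
  have um [measurable]: "u n \<in> borel_measurable lebesgue" for n
    using u by auto
  have vm [measurable]: "v \<in> borel_measurable lebesgue"
    unfolding v_def by measurable
  \<comment> \<open>The subsequence occurs only inside the limit inferior, while \<open>m\<close>
    ranges over the original indices; thus the whole sequence converges, not just the
    subsequence.\<close>
  have fatou: "integrable lebesgue (\<lambda>x. (norm (u m x - v x))\<^sup>2) \<and> (nrm (\<lambda>x. u m x - v x)) \<le> e"
    if N: "\<And>n. n \<ge> N \<Longrightarrow> nrm (\<lambda>x. u m x - u n x) \<le> e" and "e \<ge> 0" for m N e
  proof -
    have "(\<integral>\<^sup>+x. ennreal ((norm (u m x - v x))\<^sup>2) \<partial>lebesgue)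
        = (\<integral>\<^sup>+x. liminf (\<lambda>n. ennreal ((norm (u m x - u (r n) x))\<^sup>2)) \<partial>lebesgue)"
    proof (rule nn_integral_cong_AE, use conv in eventually_elim)
      case (elim x)
      have "(\<lambda>n. ennreal ((norm (u m x - u (r n) x))\<^sup>2)) \<longlonglongrightarrow> ennreal ((norm (u m x - v x))\<^sup>2)"
        by (intro tendsto_intros elim)
      then show ?case
        by (intro lim_imp_Liminf[symmetric] trivial_limit_sequentially)
    qed
    also have "\<dots> \<le> liminf (\<lambda>n. \<integral>\<^sup>+x. ennreal ((norm (u m x - u (r n) x))\<^sup>2) \<partial>lebesgue)"
      by (intro nn_integral_liminf) measurable
    also have "\<dots> = liminf (\<lambda>n. ennreal ((nrm (\<lambda>x. u m x - u (r n) x))\<^sup>2))"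
      using u by (subst nn_integral_eq_integral) (auto simp: L2_integrable L2_diff nrm_power2)
    also have "\<dots> \<le> ennreal (e\<^sup>2)"
    proof (rule Liminf_le[OF trivial_limit_sequentially])
      show "\<forall>\<^sub>F n in sequentially. ennreal ((nrm (\<lambda>x. u m x - u (r n) x))\<^sup>2) \<le> ennreal (e\<^sup>2)"
        using eventually_ge_at_top[of N]
      proof eventually_elim
        case (elim n)
        then have "r n \<ge> N"
          using seq_suble[OF r(1), of n] by simp
        then show ?case
          using N by (intro ennreal_leI power_mono) auto
      qed
    qed
    finally have le: "(\<integral>\<^sup>+x. ennreal ((norm (u m x - v x))\<^sup>2) \<partial>lebesgue) \<le> ennreal (e\<^sup>2)" .
    then have "(\<integral>\<^sup>+x. ennreal ((norm (u m x - v x))\<^sup>2) \<partial>lebesgue) < \<infinity>"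
      by (simp add: le_less_trans)
    then have i: "integrable lebesgue (\<lambda>x. (norm (u m x - v x))\<^sup>2)"
      by (intro integrableI_bounded) auto
    then have "(nrm (\<lambda>x. u m x - v x))\<^sup>2 \<le> e\<^sup>2"
      using le by (subst (asm) nn_integral_eq_integral) (auto simp: nrm_power2 ennreal_le_iff)
    then have "nrm (\<lambda>x. u m x - v x) \<le> e"
      using that(2) by (rule power2_le_imp_le)
    with i show ?thesis by simp
  qed
  have small: "\<exists>N. \<forall>m\<ge>N. integrable lebesgue (\<lambda>x. (norm (u m x - v x))\<^sup>2) \<and> nrm (\<lambda>x. u m x - v x) \<le> e"
    if "e > 0" for e
  proof -
    obtain N where "\<forall>m\<ge>N. \<forall>n\<ge>N. nrm (\<lambda>x. u m x - u n x) < e"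
      using Cau[OF \<open>e > 0\<close>] by blast
    then show ?thesis
      using fatou[of N _ e] that by (intro exI[of _ N] allI impI) (simp add: less_imp_le)
  qed
  obtain N where "integrable lebesgue (\<lambda>x. (norm (u N x - v x))\<^sup>2)"
    using small[of 1] by auto
  then have "L2 (\<lambda>x. u N x - v x)"
    by (auto simp: L2_def)
  from L2_diff[OF u[of N] this] have "L2 v"
    by simp
  moreover have "L2_conv u v"
  proof (rule LIMSEQ_I)
    fix e :: real assume "e > 0"
    then obtain N where "\<forall>m\<ge>N. nrm (\<lambda>x. u m x - v x) \<le> e / 2"
      using small[of "e / 2"] by auto
    with \<open>e > 0\<close> show "\<exists>N. \<forall>n\<ge>N. norm (nrm (\<lambda>x. u n x - v x) - 0) < e"
      by (intro exI[of _ N]) (auto intro: le_less_trans)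
  qed
  ultimately show ?thesis by blast
qed

subsection \<open>Smooth functions with compact support\<close>

text \<open>The standard smooth flat function, extended by 0. The index \<open>n\<close> is there
  because differentiation maps the family into linear combinations of its members, so smoothness of
  all of them follows by one induction; the bumps use \<open>n = 0\<close>.\<close>

definition expinv :: "nat \<Rightarrow> real \<Rightarrow> real" where
  "expinv n t = (if t \<le> 0 then 0 else exp (- 1 / t) / t ^ n)"

lemma expinv_tendsto_0: "((\<lambda>t. expinv n t) \<longlongrightarrow> 0) (at 0)"
proof -
  have "(expinv n \<longlongrightarrow> 0) (at_right 0)"
  proof -
    have "((\<lambda>t. (inverse t) ^ n / exp (inverse t)) \<longlongrightarrow> 0) (at_right (0::real))"
      by (rule filterlim_compose[OF tendsto_power_div_exp_0 filterlim_inverse_at_top_right])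
    then show ?thesis
      by (rule filterlim_mono_eventually)
        (auto simp: eventually_at_filter expinv_def field_simps exp_minus intro!: always_eventually)
  qed
  moreover have "(expinv n \<longlongrightarrow> 0) (at_left 0)"
    by (rule tendsto_eventually) (auto simp: expinv_def eventually_at_filter)
  ultimately show ?thesis
    by (simp add: filterlim_split_at)
qed

lemma DERIV_expinv: "DERIV (expinv n) t :> expinv (n + 2) t - real n * expinv (n + 1) t"
proof -
  consider "t < 0" | "t = 0" | "t > 0" by linarith
  then show ?thesis
  proof cases
    case 1
    have "DERIV (\<lambda>t. 0) t :> (0::real)" by simp
    moreover have "\<forall>\<^sub>F s in nhds t. expinv n s = 0"
      using eventually_nhds_in_open[of "{..<0}" t] 1
      by (auto simp: expinv_def elim: eventually_mono)
    ultimately show ?thesis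
      using 1 by (subst DERIV_cong_ev[of t t "expinv n" "\<lambda>t. 0"]) (auto simp: expinv_def)
  next
    case 2
    \<comment> \<open>The difference quotient of \<open>expinv n\<close> at 0 is
      \<open>expinv (n + 1)\<close>.\<close>
    have "((\<lambda>h. (expinv n (0 + h) - expinv n 0) / h) \<longlongrightarrow> 0) (at 0)"
      by (rule Lim_transform_eventually[OF expinv_tendsto_0[of "n + 1"]])
        (auto simp: expinv_def eventually_at_filter field_simps)
    then show ?thesis
      using 2 by (simp add: DERIV_def expinv_def)
  next
    case 3
    have "DERIV (\<lambda>t. exp (- 1 / t) / t ^ n) t :>
        (exp (- 1 / t) * (1 / t\<^sup>2) * t ^ n - exp (- 1 / t) * (real n * t ^ (n - 1))) / (t ^ n * t ^ n)"
      using 3 by (auto intro!: derivative_eq_intros simp: power2_eq_square)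
    moreover have "(exp (- 1 / t) * (1 / t\<^sup>2) * t ^ n - exp (- 1 / t) * (real n * t ^ (n - 1))) / (t ^ n * t ^ n)
        = expinv (n + 2) t - real n * expinv (n + 1) t"
      using 3 by (cases n) (simp_all add: expinv_def divide_simps power2_eq_square algebra_simps)
    moreover have "\<forall>\<^sub>F s in nhds t. expinv n s = exp (- 1 / s) / s ^ n"
      using eventually_nhds_in_open[of "{0<..}" t] 3
      by (auto simp: expinv_def elim: eventually_mono)
    ultimately show ?thesis
      by (subst DERIV_cong_ev[OF refl _ refl]) auto
  qed
qed

section \<open>Closure properties of smooth functions\<close>

lemma GDERIV_continuous: "(\<And>x. GDERIV \<phi> x :> \<psi> x) \<Longrightarrow> continuous_on UNIV \<phi>"
  unfolding gderiv_def by (meson continuous_at_imp_continuous_on has_derivative_continuous)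

lemma cont_diff_SucE:
  assumes "cont_diff (Suc k) \<phi>"
  obtains \<psi> where "\<forall>x. GDERIV \<phi> x :> \<psi> x" "\<forall>b\<in>Basis. cont_diff k (\<lambda>x. \<psi> x \<bullet> b)"
  using assms by auto

lemma cont_diff_Suc_imp: "cont_diff (Suc k) \<phi> \<Longrightarrow> cont_diff k \<phi>"
proof (induction k arbitrary: \<phi>)
  case 0
  then show ?case
    using GDERIV_continuous by auto
next
  case (Suc k)
  obtain \<psi> where \<psi>: "\<forall>x. GDERIV \<phi> x :> \<psi> x" "\<forall>b\<in>Basis. cont_diff (Suc k) (\<lambda>x. \<psi> x \<bullet> b)"
    using Suc.prems by (rule cont_diff_SucE)
  then show ?case
    using Suc.IH by (subst cont_diff.simps(2)) blast
qed

lemma cont_diff_const: "cont_diff k (\<lambda>x. c)"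
proof (induction k arbitrary: c)
  case (Suc k)
  then show ?case
    by (auto intro!: exI[of _ "\<lambda>x. 0"] GDERIV_const)
qed simp

lemma cont_diff_add: "cont_diff k \<phi>1 \<Longrightarrow> cont_diff k \<phi>2 \<Longrightarrow> cont_diff k (\<lambda>x. \<phi>1 x + \<phi>2 x)"
proof (induction k arbitrary: \<phi>1 \<phi>2)
  case (Suc k)
  obtain \<psi>1 where \<psi>1: "\<forall>x. GDERIV \<phi>1 x :> \<psi>1 x" "\<forall>b\<in>Basis. cont_diff k (\<lambda>x. \<psi>1 x \<bullet> b)"
    using Suc.prems(1) by (rule cont_diff_SucE)
  obtain \<psi>2 where \<psi>2: "\<forall>x. GDERIV \<phi>2 x :> \<psi>2 x" "\<forall>b\<in>Basis. cont_diff k (\<lambda>x. \<psi>2 x \<bullet> b)"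
    using Suc.prems(2) by (rule cont_diff_SucE)
  from \<psi>1 \<psi>2 show ?case
    using Suc.IH by (auto intro!: exI[of _ "\<lambda>x. \<psi>1 x + \<psi>2 x"] GDERIV_add simp: inner_add_left)
qed (auto intro: continuous_on_add)

lemma cont_diff_mult: "cont_diff k \<phi>1 \<Longrightarrow> cont_diff k \<phi>2 \<Longrightarrow> cont_diff k (\<lambda>x. \<phi>1 x * \<phi>2 x)"
proof (induction k arbitrary: \<phi>1 \<phi>2)
  case (Suc k)
  obtain \<psi>1 where \<psi>1: "\<forall>x. GDERIV \<phi>1 x :> \<psi>1 x" "\<forall>b\<in>Basis. cont_diff k (\<lambda>x. \<psi>1 x \<bullet> b)"
    using Suc.prems(1) by (rule cont_diff_SucE)
  obtain \<psi>2 where \<psi>2: "\<forall>x. GDERIV \<phi>2 x :> \<psi>2 x" "\<forall>b\<in>Basis. cont_diff k (\<lambda>x. \<psi>2 x \<bullet> b)"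
    using Suc.prems(2) by (rule cont_diff_SucE)
  from \<psi>1 \<psi>2 show ?case
    using Suc.IH Suc.prems[THEN cont_diff_Suc_imp]
    by (auto intro!: exI[of _ "\<lambda>x. \<phi>1 x *\<^sub>R \<psi>2 x + \<phi>2 x *\<^sub>R \<psi>1 x"] GDERIV_mult cont_diff_add simp: inner_add_left)
qed (auto intro: continuous_on_mult)

lemma cont_diff_cmult: "cont_diff k \<phi> \<Longrightarrow> cont_diff k (\<lambda>x. c * \<phi> x)"
  by (intro cont_diff_mult cont_diff_const)

lemma cont_diff_diff:
  assumes "cont_diff k \<phi>1" "cont_diff k \<phi>2"
  shows "cont_diff k (\<lambda>x. \<phi>1 x - \<phi>2 x)"
  using cont_diff_add[OF assms(1) cont_diff_cmult[OF assms(2), of "-1"]] by simp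

lemma cont_diff_prod: "(\<And>i. i \<in> I \<Longrightarrow> cont_diff k (\<phi> i)) \<Longrightarrow> cont_diff k (\<lambda>x. \<Prod>i\<in>I. \<phi> i x)"
  by (induction I rule: infinite_finite_induct) (auto intro: cont_diff_const cont_diff_mult)

lemma cont_diff_power: "cont_diff k \<phi> \<Longrightarrow> cont_diff k (\<lambda>x. \<phi> x ^ n)"
  by (induction n) (auto intro: cont_diff_const cont_diff_mult)

lemma GDERIV_translate:
  assumes "\<And>x. GDERIV \<phi> x :> \<psi> x"
  shows "GDERIV (\<lambda>x. \<phi> (x + c)) x :> \<psi> (x + c)"
proof -
  have "((\<lambda>x. x + c) has_derivative (\<lambda>h. h)) (at x)"
    by (auto intro!: derivative_eq_intros)
  from has_derivative_compose[OF this, of \<phi> "\<lambda>h. h \<bullet> \<psi> (x + c)"] assms[of "x + c"]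
  show ?thesis
    by (simp add: gderiv_def)
qed

lemma cont_diff_translate: "cont_diff k \<phi> \<Longrightarrow> cont_diff k (\<lambda>x. \<phi> (x + c))"
proof (induction k arbitrary: \<phi>)
  case 0
  then show ?case
    by (auto intro!: continuous_on_compose2[of UNIV \<phi>] continuous_intros)
next
  case (Suc k)
  obtain \<psi> where
    "\<forall>x. GDERIV \<phi> x :> \<psi> x" "\<forall>b\<in>Basis. cont_diff k (\<lambda>x. \<psi> x \<bullet> b)"
    using Suc.prems by (rule cont_diff_SucE)
  then show ?case
    using Suc.IH by (auto intro!: exI[of _ "\<lambda>x. \<psi> (x + c)"] GDERIV_translate)
qed

lemma GDERIV_expinv_affine:
  "GDERIV (\<lambda>x. expinv n (x \<bullet> b - a)) x :> (expinv (n + 2) (x \<bullet> b - a) - real n * expinv (n + 1) (x \<bullet> b - a)) *\<^sub>R b"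
proof -
  have "GDERIV (\<lambda>x. x \<bullet> b - a) x :> b"
    unfolding gderiv_def by (auto intro!: derivative_eq_intros)
  from GDERIV_DERIV_compose[OF this DERIV_expinv] show ?thesis .
qed

lemma cont_diff_expinv: "cont_diff k (\<lambda>x. expinv n (x \<bullet> b - a))"
proof (induction k arbitrary: n)
  case 0
  then show ?case
    by simp (rule GDERIV_continuous[OF GDERIV_expinv_affine])
next
  case (Suc k)
  have "cont_diff k (\<lambda>x. (expinv (n + 2) (x \<bullet> b - a) - real n * expinv (n + 1) (x \<bullet> b - a)) * (b \<bullet> b'))" for b'
    by (intro cont_diff_mult cont_diff_diff cont_diff_const Suc)
  then show ?case
    using GDERIV_expinv_affine[of n b a] by (subst cont_diff.simps) (auto intro!: exI)
qed

text \<open>A product of flat profiles, two per coordinate, which is positive exactly on the open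
  box. The upper face is written with \<open>- i\<close> so that both factors have the affine form
  for which smoothness is proved.\<close>

definition bump :: "'a::euclidean_space \<Rightarrow> 'a \<Rightarrow> 'a \<Rightarrow> real" where
  "bump a b x = (\<Prod>i\<in>Basis. expinv 0 (x \<bullet> i - a \<bullet> i) * expinv 0 (x \<bullet> (- i) - (- (b \<bullet> i))))"

lemma bump_smooth: "cont_diff k (bump a b)"
  unfolding bump_def[abs_def] by (intro cont_diff_prod cont_diff_mult cont_diff_expinv)

lemma bump_bounds: "0 \<le> bump a b x" "bump a b x \<le> 1" "bump a b x \<noteq> 0 \<longleftrightarrow> x \<in> box a b"
proof -
  have e: "0 \<le> expinv 0 t" "expinv 0 t \<le> 1" "expinv 0 t \<noteq> 0 \<longleftrightarrow> t > 0" for t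
    by (auto simp: expinv_def)
  show "0 \<le> bump a b x"
    unfolding bump_def by (intro prod_nonneg mult_nonneg_nonneg e)
  show "bump a b x \<le> 1"
    unfolding bump_def by (intro prod_le_1 conjI mult_nonneg_nonneg mult_le_one e)
  show "bump a b x \<noteq> 0 \<longleftrightarrow> x \<in> box a b"
    using e(3) by (auto simp: bump_def mem_box)
qed

section \<open>Test functions on the whole space\<close>

abbreviation tests :: "('a::euclidean_space \<Rightarrow> real) set" where
  "tests \<equiv> test_functions UNIV"

lemma test_functionsI:
  assumes "\<And>k. cont_diff k \<phi>" "bounded {x. \<phi> x \<noteq> 0}"
  shows "\<phi> \<in> tests"
  using assms by (auto simp: test_functions_def)

lemma test_functions_bounded: "\<phi> \<in> tests \<Longrightarrow> bounded {x. \<phi> x \<noteq> 0}"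
  by (auto simp: test_functions_def intro: bounded_subset[OF compact_imp_bounded closure_subset])

lemma test_functions_support:
  assumes "\<phi> \<in> tests"
  obtains R where "R > 0" "\<forall>x. \<phi> x \<noteq> 0 \<longrightarrow> norm x < R"
proof -
  obtain R where "R > 0" "\<forall>x\<in>{x. \<phi> x \<noteq> 0}. norm x < R"
    using test_functions_bounded[OF assms] unfolding bounded_pos_less by auto
  then show thesis
    using that by auto
qed

lemma test_functions_add:
  assumes "\<phi>1 \<in> tests" "\<phi>2 \<in> tests"
  shows "(\<lambda>x. \<phi>1 x + \<phi>2 x) \<in> tests"
proof (rule test_functionsI)
  have "{x. \<phi>1 x + \<phi>2 x \<noteq> 0} \<subseteq> {x. \<phi>1 x \<noteq> 0} \<union> {x. \<phi>2 x \<noteq> 0}"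
    by auto
  then show "bounded {x. \<phi>1 x + \<phi>2 x \<noteq> 0}"
    by (rule bounded_subset[rotated]) (use assms in \<open>simp add: test_functions_bounded\<close>)
qed (use assms in \<open>auto simp: test_functions_def cont_diff_add\<close>)

lemma test_functions_cmult:
  assumes "\<phi> \<in> tests"
  shows "(\<lambda>x. c * \<phi> x) \<in> tests"
proof (rule test_functionsI)
  show "bounded {x. c * \<phi> x \<noteq> 0}"
    by (rule bounded_subset[OF test_functions_bounded[OF assms]]) auto
qed (use assms in \<open>auto simp: test_functions_def cont_diff_cmult\<close>)

lemma test_functions_translate:
  assumes "\<phi> \<in> tests"
  shows "(\<lambda>x. \<phi> (x + c)) \<in> tests"
proof (rule test_functionsI)
  have "{x. \<phi> (x + c) \<noteq> 0} = (\<lambda>x. x - c) ` {x. \<phi> x \<noteq> 0}"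
    by (force simp: image_iff)
  then show "bounded {x. \<phi> (x + c) \<noteq> 0}"
    using bounded_translation_minus[OF test_functions_bounded[OF assms], of c] by simp
qed (use assms in \<open>auto simp: test_functions_def cont_diff_translate\<close>)

lemma test_functions_continuous: "\<phi> \<in> test_functions U \<Longrightarrow> continuous_on UNIV \<phi>"
  using cont_diff.simps(1)[of \<phi>] by (auto simp: test_functions_def)

lemma borel_measurable_lebesgue_continuous:
  fixes f :: "'a::euclidean_space \<Rightarrow> 'b::euclidean_space"
  shows "continuous_on UNIV f \<Longrightarrow> f \<in> borel_measurable lebesgue"
  by (intro measurable_completion) (simp add: borel_measurable_continuous_onI)

lemma L2_indicator:
  fixes A :: "'a::euclidean_space set"
  assumes "A \<in> lmeasurable"
  shows "L2 (indicator A :: 'a \<Rightarrow> real)" and "nrm (indicator A :: 'a \<Rightarrow> real) = sqrt (measure lebesgue A)"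
proof -
  have "(\<lambda>x. (norm (indicator A x :: real))\<^sup>2) = (indicator A :: 'a \<Rightarrow> real)"
    by (auto simp: indicator_def)
  then show "L2 (indicator A :: 'a \<Rightarrow> real)" "nrm (indicator A :: 'a \<Rightarrow> real) = sqrt (measure lebesgue A)"
    using assms by (auto simp: L2_def nrm_def fmeasurable_def less_top)
qed

lemma L2_bounded_support:
  fixes f :: "'a::euclidean_space \<Rightarrow> 'b::euclidean_space"
  assumes "f \<in> borel_measurable lebesgue" "\<And>x. norm (f x) \<le> C" "bounded S" "\<And>x. x \<notin> S \<Longrightarrow> f x = 0"
  shows "L2 f"
proof -
  obtain R where R: "S \<subseteq> cball 0 R"
    using bounded_subset_ballD[OF assms(3), of 0] ball_subset_cball by blast
  have "L2 (\<lambda>x. C * indicator (cball (0::'a) R) x :: real)"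
    by (intro L2_cmult L2_indicator) auto
  moreover have "norm (f x) \<le> norm (C * indicator (cball (0::'a) R) x :: real)" for x
  proof (cases "x \<in> S")
    case True
    then have "x \<in> cball 0 R" using R by auto
    then show ?thesis
      using assms(2)[of x] abs_ge_self[of C] by (simp del: mem_cball)
  qed (use assms(4) in auto)
  ultimately show ?thesis
    by (rule L2_dominated[OF _ assms(1) AE_I2])
qed

lemma continuous_bounded_support:
  fixes f :: "'a::euclidean_space \<Rightarrow> 'b::euclidean_space"
  assumes "continuous_on UNIV f" "\<And>x. norm x > R \<Longrightarrow> f x = 0"
  obtains C where "C \<ge> 0" "\<forall>x. norm (f x) \<le> C"
proof -
  have "bounded (f ` cball 0 R)"
    by (intro compact_imp_bounded compact_continuous_image) (auto intro: continuous_on_subset[OF assms(1)])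
  then obtain C where C: "C > 0" "\<forall>y\<in>f ` cball 0 R. norm y \<le> C"
    unfolding bounded_pos by auto
  have "norm (f x) \<le> C" for x
    using C assms(2)[of x] by (cases "norm x \<le> R") (auto intro: less_imp_le)
  with C show thesis
    using that[of C] by simp
qed

lemma test_functions_L2: "\<phi> \<in> tests \<Longrightarrow> L2 \<phi>"
proof -
  assume \<phi>: "\<phi> \<in> tests"
  obtain R where "R > 0" and R: "\<forall>x. \<phi> x \<noteq> 0 \<longrightarrow> norm x < R"
    by (rule test_functions_support[OF \<phi>])
  obtain C where "C \<ge> 0" and C: "\<forall>x. norm (\<phi> x) \<le> C"
    by (rule continuous_bounded_support[OF test_functions_continuous[OF \<phi>], of R]) (use R in force)
  show ?thesis
    by (rule L2_bounded_support[OF borel_measurable_lebesgue_continuous[OF test_functions_continuous[OF \<phi>]] _ test_functions_bounded[OF \<phi>]])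
      (use C in auto)
qed

subsection \<open>Density of test functions\<close>

definition approximable :: "('a::euclidean_space \<Rightarrow> real) \<Rightarrow> bool" where
  "approximable u \<longleftrightarrow> (\<forall>e>0. \<exists>\<phi>\<in>tests. nrm (\<lambda>x. u x - \<phi> x) < e)"

lemma approximable_closed:
  assumes u: "L2 u" and v: "\<And>e. e > 0 \<Longrightarrow> \<exists>v. L2 v \<and> approximable v \<and> nrm (\<lambda>x. u x - v x) < e"
  shows "approximable u"
  unfolding approximable_def
proof (intro allI impI)
  fix e :: real assume "e > 0"
  then obtain v where v: "L2 v" "approximable v" "nrm (\<lambda>x. u x - v x) < e / 2"
    using v[of "e / 2"] by auto
  then obtain \<phi> where \<phi>: "\<phi> \<in> tests" "nrm (\<lambda>x. v x - \<phi> x) < e / 2"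
    using \<open>e > 0\<close> unfolding approximable_def by (meson half_gt_zero)
  have "nrm (\<lambda>x. u x - \<phi> x) < e"
    using nrm_triangle_diff[OF u v(1) test_functions_L2[OF \<phi>(1)]] v \<phi> by linarith
  with \<phi> show "\<exists>\<phi>\<in>tests. nrm (\<lambda>x. u x - \<phi> x) < e"
    by blast
qed

lemma approximable_limit:
  assumes "L2 u" "\<And>n. L2 (v n)" "\<And>n. approximable (v n)" "L2_conv v u"
  shows "approximable u"
proof (rule approximable_closed[OF assms(1)])
  fix e :: real assume "e > 0"
  then obtain n where "nrm (\<lambda>x. v n x - u x) < e"
    using LIMSEQ_D[OF assms(4), of e] by force
  then show "\<exists>v. L2 v \<and> approximable v \<and> nrm (\<lambda>x. u x - v x) < e"
    using assms(2,3) nrm_minus_commute[of "v n" u] by auto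
qed

lemma approximable_cmult:
  assumes "approximable u"
  shows "approximable (\<lambda>x. c * u x)"
  unfolding approximable_def
proof (intro allI impI)
  fix e :: real assume "e > 0"
  then obtain \<phi> where \<phi>: "\<phi> \<in> tests" "nrm (\<lambda>x. u x - \<phi> x) < e / (\<bar>c\<bar> + 1)"
    using assms unfolding approximable_def by (metis abs_ge_zero add_nonneg_pos divide_pos_pos zero_less_one)
  have "nrm (\<lambda>x. c * u x - c * \<phi> x) = \<bar>c\<bar> * nrm (\<lambda>x. u x - \<phi> x)"
    using nrm_cmult[of c "\<lambda>x. u x - \<phi> x"] by (simp add: right_diff_distrib)
  also have "\<dots> \<le> (\<bar>c\<bar> + 1) * nrm (\<lambda>x. u x - \<phi> x)"
    by (intro mult_right_mono) auto
  also have "\<dots> < e"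
    using \<phi>(2) by (simp add: field_simps)
  finally show "\<exists>\<phi>\<in>tests. nrm (\<lambda>x. c * u x - \<phi> x) < e"
    using test_functions_cmult[OF \<phi>(1), of c] by (intro bexI[of _ "\<lambda>x. c * \<phi> x"])
qed

lemma approximable_add:
  assumes "L2 u" "L2 v" "approximable u" "approximable v"
  shows "approximable (\<lambda>x. u x + v x)"
  unfolding approximable_def
proof (intro allI impI)
  fix e :: real assume "e > 0"
  then have "e / 2 > 0" by simp
  obtain \<phi> where \<phi>: "\<phi> \<in> tests" "nrm (\<lambda>x. u x - \<phi> x) < e / 2"
    using assms(3) \<open>e / 2 > 0\<close> unfolding approximable_def by blast
  obtain \<psi> where \<psi>: "\<psi> \<in> tests" "nrm (\<lambda>x. v x - \<psi> x) < e / 2"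
    using assms(4) \<open>e / 2 > 0\<close> unfolding approximable_def by blast
  have "nrm (\<lambda>x. u x + v x - (\<phi> x + \<psi> x)) \<le> nrm (\<lambda>x. u x - \<phi> x) + nrm (\<lambda>x. v x - \<psi> x)"
    using nrm_triangle[of "\<lambda>x. u x - \<phi> x" "\<lambda>x. v x - \<psi> x"] assms \<phi> \<psi>
    by (simp add: L2_diff test_functions_L2 add_diff_add)
  then show "\<exists>\<phi>\<in>tests. nrm (\<lambda>x. u x + v x - \<phi> x) < e"
    using \<phi> \<psi> test_functions_add[OF \<phi>(1) \<psi>(1)] by (intro bexI[of _ "\<lambda>x. \<phi> x + \<psi> x"]) auto
qed

text \<open>For a finite union \<open>V\<close> of open boxes, \<open>1 - (1 - b)^n\<close> increases to the indicator
  of \<open>V\<close> if \<open>b\<close> is a smooth function with values in \<open>[0, 1]\<close> which is positive exactly on \<open>V\<close>.\<close>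

lemma approximable_boxes:
  fixes F :: "('a::euclidean_space \<times> 'a) set"
  assumes "finite F"
  defines "V \<equiv> \<Union>(a, b)\<in>F. box a b"
  shows "approximable (indicator V)"
proof -
  \<comment> \<open>This is the factor \<open>1 - b\<close> of the remark above: equal to 1 off
    \<open>V\<close> and below 1 on \<open>V\<close>, so its powers tend to the indicator of the
    complement.\<close>
  define c where "c x = (\<Prod>p\<in>F. 1 - bump (fst p) (snd p) x)" for x
  have c: "0 \<le> c x" "c x \<le> 1" "x \<notin> V \<Longrightarrow> c x = 1" "x \<in> V \<Longrightarrow> c x < 1" for x
  proof -
    show "0 \<le> c x"
      unfolding c_def by (intro prod_nonneg) (simp add: bump_bounds)
    show "c x \<le> 1"
      unfolding c_def by (intro prod_le_1) (simp add: bump_bounds)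
    show "c x = 1" if "x \<notin> V"
      unfolding c_def using that by (intro prod.neutral) (use bump_bounds(3) V_def in fastforce)
    show "c x < 1" if "x \<in> V"
    proof -
      from that have "\<exists>p\<in>F. x \<in> box (fst p) (snd p)"
        by (auto simp: V_def split_beta)
      then obtain p where p: "p \<in> F" "x \<in> box (fst p) (snd p)"
        by blast
      have "c x = (1 - bump (fst p) (snd p) x) * (\<Prod>p\<in>F - {p}. 1 - bump (fst p) (snd p) x)"
        unfolding c_def using p assms(1) by (subst prod.remove[of F p]) auto
      also have "\<dots> \<le> (1 - bump (fst p) (snd p) x) * 1"
        by (intro mult_left_mono prod_le_1) (simp_all add: bump_bounds)
      also have "\<dots> < 1"
        using bump_bounds[of "fst p" "snd p" x] p by (simp add: less_le)
      finally show ?thesis .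
    qed
  qed
  have bV: "bounded V"
    using assms(1) unfolding V_def by (intro bounded_UN) auto
  have mV: "V \<in> lmeasurable"
    unfolding V_def using assms(1) by (intro fmeasurable.finite_UN) auto
  define \<phi> where "\<phi> n x = 1 - c x ^ n" for n x
  have test: "\<phi> n \<in> tests" for n
  proof (rule test_functionsI)
    show "cont_diff k (\<phi> n)" for k
      unfolding \<phi>_def[abs_def] c_def[abs_def]
      by (intro cont_diff_diff cont_diff_const cont_diff_power cont_diff_prod bump_smooth)
    show "bounded {x. \<phi> n x \<noteq> 0}"
      by (rule bounded_subset[OF bV]) (use c(3) \<phi>_def in force)
  qed
  have lim: "(\<lambda>n. \<phi> n x) \<longlonglongrightarrow> indicator V x" for x
  proof (cases "x \<in> V")
    case True
    then have "(\<lambda>n. 1 - c x ^ n) \<longlonglongrightarrow> 1 - 0"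
      using c by (intro tendsto_intros LIMSEQ_power_zero) auto
    then show ?thesis
      using True by (simp add: \<phi>_def)
  qed (use c(3) in \<open>simp add: \<phi>_def\<close>)
  have "norm (\<phi> n x) \<le> indicator V x" for n x
    using c(1,2)[of x] c(3)[of x] power_le_one[of "c x" n] zero_le_power[of "c x" n]
    by (cases "x \<in> V") (auto simp: \<phi>_def)
  then have "(\<lambda>n. nrm (\<lambda>x. \<phi> n x - indicator V x)) \<longlonglongrightarrow> 0"
    using mV lim test_functions_L2[OF test]
    by (intro L2_dominated_convergence(2)[OF L2_indicator(1)[OF mV]]) auto
  moreover have "approximable (\<phi> n)" for n
    using test by (auto simp: approximable_def intro: bexI[of _ "\<phi> n"])
  ultimately show ?thesis
    by (intro approximable_limit[OF L2_indicator(1)[OF mV] test_functions_L2[OF test]])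
qed

lemma nrm_indicator_diff:
  fixes A B :: "'a::euclidean_space set"
  assumes "A \<subseteq> B" "B - A \<in> lmeasurable" "emeasure lebesgue (B - A) < ennreal (e\<^sup>2)" "e > 0"
  shows "nrm (\<lambda>x. indicator B x - indicator A x :: real) < e"
proof -
  have "(\<lambda>x. indicator B x - indicator A x :: real) = indicator (B - A)"
    using assms(1) by (intro ext) (auto simp: indicator_def)
  moreover have "measure lebesgue (B - A) < e\<^sup>2"
    using assms(2,3) by (simp add: emeasure_eq_measure2 ennreal_less_iff)
  ultimately show ?thesis
    using assms(2,4) real_sqrt_less_mono[of "measure lebesgue (B - A)" "e\<^sup>2"] by (simp add: L2_indicator)
qed

text \<open>Outer regularity gives an open set slightly larger than \<open>K\<close>, and
  compactness fits a finite union of boxes in between. The measure bound is \<open>e\<^sup>2\<close>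
  because the norm of an indicator is the square root of a measure.\<close>

lemma approximable_compact:
  assumes "compact K"
  shows "approximable (indicator K)"
proof (rule approximable_closed)
  have mK: "K \<in> lmeasurable"
    using assms by (rule lmeasurable_compact)
  show "L2 (indicator K :: _ \<Rightarrow> real)"
    by (rule L2_indicator[OF mK])
  fix e :: real assume "e > 0"
  obtain U where U: "open U" "K \<subseteq> U" "U - K \<in> lmeasurable" "emeasure lebesgue (U - K) < ennreal (e\<^sup>2)"
    using sets_lebesgue_outer_open[of K "e\<^sup>2"] mK \<open>e > 0\<close> by (auto dest: fmeasurableD)
  have "\<exists>p. x \<in> box (fst p) (snd p) \<and> box (fst p) (snd p) \<subseteq> U" if "x \<in> K" for x
  proof -
    have "x \<in> U" using that U by auto
    then obtain a b where "box a b \<subseteq> U" "x \<in> box a b" "\<forall>i\<in>Basis. a \<bullet> i < b \<bullet> i"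
      by (rule open_contains_box[OF U(1)])
    then show ?thesis
      by (intro exI[of _ "(a, b)"]) simp
  qed
  then obtain p where p: "\<And>x. x \<in> K \<Longrightarrow> x \<in> box (fst (p x)) (snd (p x))" "\<And>x. x \<in> K \<Longrightarrow> box (fst (p x)) (snd (p x)) \<subseteq> U"
    by metis
  obtain C where C: "C \<subseteq> K" "finite C" "K \<subseteq> (\<Union>x\<in>C. box (fst (p x)) (snd (p x)))"
    by (rule compactE_image[OF assms, of K "\<lambda>x. box (fst (p x)) (snd (p x))"]) (use p(1) in auto)
  define V where "V = (\<Union>(a, b)\<in>p ` C. box a b)"
  have V: "K \<subseteq> V" "V \<subseteq> U"
    using C p(2) by (auto simp: V_def split_beta)
  have mV: "V \<in> lmeasurable"
    unfolding V_def using C by (intro fmeasurable.finite_UN) auto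
  have "V - K \<in> lmeasurable"
    using mV mK by auto
  moreover have "emeasure lebesgue (V - K) < ennreal (e\<^sup>2)"
    by (rule le_less_trans[OF emeasure_mono U(4)]) (use V U in \<open>auto dest: fmeasurableD\<close>)
  ultimately have "nrm (\<lambda>x. indicator V x - indicator K x :: real) < e"
    using V(1) \<open>e > 0\<close> by (intro nrm_indicator_diff)
  moreover have "approximable (indicator V)"
    unfolding V_def using C by (intro approximable_boxes) auto
  ultimately show "\<exists>v. L2 v \<and> approximable v \<and> nrm (\<lambda>x. indicator K x - v x) < e"
    using L2_indicator(1)[OF mV] nrm_minus_commute[of "indicator V :: _ \<Rightarrow> real" "indicator K"]
    by (intro exI[of _ "indicator V"]) auto
qed

text \<open>Inner regularity gives a closed subset, whose intersections with growing balls are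
  compact and converge to it in norm.\<close>

lemma approximable_lmeasurable:
  fixes A :: "'a::euclidean_space set"
  assumes "A \<in> lmeasurable"
  shows "approximable (indicator A)"
proof (rule approximable_closed[OF L2_indicator(1)[OF assms]])
  fix e :: real assume "e > 0"
  obtain T where T: "closed T" "T \<subseteq> A" "A - T \<in> lmeasurable" "emeasure lebesgue (A - T) < ennreal (e\<^sup>2)"
    using sets_lebesgue_inner_closed[of A "e\<^sup>2"] assms \<open>e > 0\<close> by (auto dest: fmeasurableD)
  have mT: "T \<in> lmeasurable"
    using fmeasurable_Diff[OF assms, of "A - T"] T assms
    by (auto simp: double_diff dest: fmeasurableD)
  have lim: "(\<lambda>n. indicator (T \<inter> cball 0 (real n)) x :: real) \<longlonglongrightarrow> indicator T x" for x :: 'a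
  proof (rule tendsto_eventually)
    obtain N where "norm x \<le> real N"
      using real_arch_simple by blast
    then show "\<forall>\<^sub>F n in sequentially. indicator (T \<inter> cball 0 (real n)) x = (indicator T x :: real)"
      by (intro eventually_sequentiallyI[of N]) (auto simp: indicator_def)
  qed
  have Tn: "T \<inter> cball 0 (real n) \<in> lmeasurable" for n
    using T(1) by (intro lmeasurable_compact closed_Int_compact) auto
  have "(\<lambda>n. nrm (\<lambda>x. indicator (T \<inter> cball 0 (real n)) x - indicator T x :: real)) \<longlonglongrightarrow> 0"
    by (rule L2_dominated_convergence(2)[OF L2_indicator(1)[OF mT] L2_measurable[OF L2_indicator(1)[OF Tn]] AE_I2[OF lim] _
          L2_measurable[OF L2_indicator(1)[OF mT]]]) (auto simp: indicator_def)
  then have "approximable (indicator T)"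
    by (rule approximable_limit[OF L2_indicator(1)[OF mT] L2_indicator(1)[OF Tn], rotated])
      (use T(1) in \<open>simp add: approximable_compact closed_Int_compact\<close>)
  then show "\<exists>v. L2 v \<and> approximable v \<and> nrm (\<lambda>x. indicator A x - v x) < e"
    using L2_indicator(1)[OF mT] nrm_indicator_diff[OF T(2-4) \<open>e > 0\<close>] by blast
qed

text \<open>Integrability is a premise inside the induction formula, since the induction over
  nonnegative measurable functions does not supply it; sums and monotone limits dominate their
  constituents, and a nonzero factor can be divided out.\<close>

lemma approximable_nonneg:
  fixes u :: "'a::euclidean_space \<Rightarrow> real"
  assumes "u \<in> borel_measurable lebesgue" "\<And>x. 0 \<le> u x"
  shows "L2 u \<longrightarrow> approximable u"
  using assms
proof (induction rule: borel_measurable_induct_real)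
  case (set A)
  show ?case
  proof
    assume "L2 (indicator A :: 'a \<Rightarrow> real)"
    then have "integrable lebesgue (\<lambda>x. (norm (indicator A x :: real))\<^sup>2)"
      by (simp add: L2_def)
    moreover have "(\<lambda>x. (norm (indicator A x :: real))\<^sup>2) = (indicator A :: 'a \<Rightarrow> real)"
      by (auto simp: indicator_def)
    ultimately have "integrable lebesgue (indicator A :: 'a \<Rightarrow> real)"
      by (simp only:)
    then have "A \<in> lmeasurable"
      using set by (simp add: integrable_indicator_iff fmeasurable_def Int_absorb2)
    then show "approximable (indicator A :: 'a \<Rightarrow> real)"
      by (rule approximable_lmeasurable)
  qed
next
  case (mult u c)
  show ?case
  proof
    assume cu: "L2 (\<lambda>x. c * u x)"
    show "approximable (\<lambda>x. c * u x)"
    proof (cases "c = 0")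
      case True
      then show ?thesis
        by (auto simp: approximable_def intro!: bexI[of _ "\<lambda>x. 0"] test_functionsI cont_diff_const)
    next
      case False
      then have "L2 u"
        using L2_cmult[OF cu, of "inverse c"] by (simp add: mult.assoc[symmetric])
      with mult show ?thesis
        by (simp add: approximable_cmult)
    qed
  qed
next
  case (add u v)
  show ?case
  proof
    assume uv: "L2 (\<lambda>x. v x + u x)"
    then have "L2 u" "L2 v"
      using add by (auto intro!: L2_dominated[OF uv])
    with add show "approximable (\<lambda>x. v x + u x)"
      by (simp add: approximable_add)
  qed
next
  case (seq U)
  show ?case
  proof
    assume u: "L2 u"
    have le: "U i x \<le> u x" for i x
      using seq by (intro incseq_le) (simp_all add: incseq_def le_fun_def)
    have Ui: "L2 (U i)" for i
      using le seq by (intro L2_dominated[OF u]) (auto intro!: AE_I2 order_trans[OF _ abs_ge_self])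
    have "L2_conv U u"
      using seq le u by (intro L2_dominated_convergence(2)[OF u]) auto
    then show "approximable u"
      using seq Ui by (intro approximable_limit[OF u]) auto
  qed
qed

lemma test_functions_dense:
  assumes u: "L2 u" and e: "e > 0"
  shows "\<exists>\<phi>\<in>tests. nrm (\<lambda>x. u x - \<phi> x) < e"
proof -
  have m [measurable]: "u \<in> borel_measurable lebesgue"
    using u by auto
  have p: "L2 (\<lambda>x. max (u x) 0)" and q: "L2 (\<lambda>x. max (- u x) 0)"
    by (auto intro!: L2_dominated[OF u])
  have "approximable (\<lambda>x. max (u x) 0 + -1 * max (- u x) 0)"
    using approximable_nonneg[of "\<lambda>x. max (u x) 0"] approximable_nonneg[of "\<lambda>x. max (- u x) 0"] p q
    by (intro approximable_add L2_cmult approximable_cmult) auto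
  moreover have "(\<lambda>x. max (u x) 0 + -1 * max (- u x) 0) = u"
    by (auto simp: max_def)
  ultimately have "approximable u"
    by (simp only:)
  then show ?thesis
    using e by (simp add: approximable_def)
qed

text \<open>By density, \<open>r\<close> can almost be tested against itself. This is how bounds on
  pairings with smooth functions become bounds in norm.\<close>

lemma nrm_le_dual:
  assumes r: "L2 r" and M: "\<And>\<phi>. \<phi> \<in> tests \<Longrightarrow> \<bar>ip r \<phi>\<bar> \<le> M * nrm \<phi>" "M \<ge> 0"
  shows "nrm r \<le> M"
proof (rule ccontr)
  assume "\<not> nrm r \<le> M"
  define a where "a = nrm r"
  \<comment> \<open>Chosen so that \<open>a * e + M * (a + e)\<close> equals
    \<open>M * a + a * (a - M) / 2\<close>, which is strictly less than
    \<open>a\<^sup>2\<close>.\<close>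
  define e where "e = a * (a - M) / (2 * (a + M))"
  have a: "a > M" "a > 0"
    using \<open>\<not> nrm r \<le> M\<close> M(2) by (auto simp: a_def)
  then have "e > 0"
    using M(2) by (simp add: e_def)
  then obtain \<phi> where \<phi>: "\<phi> \<in> tests" "nrm (\<lambda>x. r x - \<phi> x) < e"
    using test_functions_dense[OF r] by blast
  have L: "L2 \<phi>" using \<phi> by (simp add: test_functions_L2)
  have "a\<^sup>2 = ip r r"
    by (simp add: a_def ip_self)
  also have "\<dots> = ip r (\<lambda>x. r x - \<phi> x) + ip r \<phi>"
    using r L by (simp add: ip_diff_right)
  also have "\<dots> \<le> a * nrm (\<lambda>x. r x - \<phi> x) + M * nrm \<phi>"
    using ip_Cauchy_Schwarz[OF r L2_diff[OF r L]] M(1)[OF \<phi>(1)] by (simp add: a_def abs_le_iff add_mono)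
  also have "\<dots> \<le> a * e + M * (a + e)"
  proof (intro add_mono mult_left_mono)
    show "nrm \<phi> \<le> a + e"
      using nrm_triangle_le[OF L r] \<phi>(2) nrm_minus_commute[of \<phi> r] by (simp add: a_def)
  qed (use a \<phi> M in auto)
  also have "\<dots> = e * (a + M) + M * a"
    by (simp add: algebra_simps)
  also have "e * (a + M) = a * (a - M) / 2"
    using a M(2) unfolding e_def by (simp add: divide_simps)
  finally have "a\<^sup>2 \<le> a * (a - M) / 2 + M * a" .
  moreover have "a\<^sup>2 = a * (a - M) + M * a"
    by (simp add: power2_eq_square algebra_simps)
  ultimately have "a * (a - M) \<le> 0"
    by linarith
  then show False
    using a by (simp add: mult_le_0_iff)
qed

text \<open>The fundamental lemma of the calculus of variations: duality with the bound 0.\<close>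

lemma L2_eq_AE_of_test:
  assumes "L2 p" "L2 q" "\<And>\<phi>. \<phi> \<in> tests \<Longrightarrow> ip \<phi> p = ip \<phi> q"
  shows "AE x in lebesgue. p x = q x"
proof -
  have "nrm (\<lambda>x. p x - q x) \<le> 0"
    using assms by (intro nrm_le_dual) (simp_all add: L2_diff ip_diff_left test_functions_L2 ip_commute[of p] ip_commute[of q])
  then have "nrm (\<lambda>x. p x - q x) = 0"
    using nrm_nonneg[of "\<lambda>x. p x - q x"] by linarith
  then show ?thesis
    using nrm_eq_0_iff[OF L2_diff[OF assms(1,2)]] by simp
qed

subsection \<open>Translations\<close>

lemma measurable_lebesgue_translate [measurable]: "(\<lambda>x. x + c :: 'a::euclidean_space) \<in> lebesgue \<rightarrow>\<^sub>M lebesgue"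
  using lebesgue_affine_measurable[of "\<lambda>_. 1" c] by (simp add: euclidean_representation add.commute)

lemma distr_lebesgue_translate: "distr lebesgue lebesgue (\<lambda>x. x + c :: 'a::euclidean_space) = lebesgue"
  using lebesgue_affine_euclidean[of "\<lambda>_. 1" c] by (simp add: euclidean_representation add.commute density_1)

lemma borel_measurable_lebesgue_translate:
  fixes u :: "'a::euclidean_space \<Rightarrow> 'b::euclidean_space"
  shows "u \<in> borel_measurable lebesgue \<Longrightarrow> (\<lambda>x. u (x + c)) \<in> borel_measurable lebesgue"
  by (rule measurable_compose[OF measurable_lebesgue_translate])

lemma integral_lebesgue_translate:
  fixes u :: "'a::euclidean_space \<Rightarrow> 'b::euclidean_space"
  assumes "u \<in> borel_measurable lebesgue"
  shows "(LINT x|lebesgue. u (x + c)) = (LINT x|lebesgue. u x)"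
  using integral_distr[OF measurable_lebesgue_translate assms, of c] by (simp add: distr_lebesgue_translate)

lemma L2_translate:
  assumes "L2 u"
  shows "L2 (\<lambda>x. u (x + c))"
proof -
  have "integrable lebesgue (\<lambda>x. (norm (u x))\<^sup>2)"
    using assms by (rule L2_integrable)
  then have "integrable (distr lebesgue lebesgue (\<lambda>x. x + c)) (\<lambda>x. (norm (u x))\<^sup>2)"
    by (simp add: distr_lebesgue_translate)
  then have "integrable lebesgue (\<lambda>x. (norm (u (x + c)))\<^sup>2)"
    by (rule integrable_distr[OF measurable_lebesgue_translate])
  then show ?thesis
    using assms by (auto simp: L2_def borel_measurable_lebesgue_translate)
qed

lemma nrm_translate: "L2 u \<Longrightarrow> nrm (\<lambda>x. u (x + c)) = nrm u"
  unfolding nrm_def using integral_lebesgue_translate[of "\<lambda>x. (norm (u x))\<^sup>2" c] by (auto simp: L2_def)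

lemma ip_translate:
  assumes "L2 u" "L2 v"
  shows "ip (\<lambda>x. u (x + c)) v = ip u (\<lambda>x. v (x - c))"
proof -
  have "(\<lambda>x. u x \<bullet> v (x - c)) \<in> borel_measurable lebesgue"
    using L2_inner[OF assms(1) L2_translate[OF assms(2), of "- c"]] by auto
  from integral_lebesgue_translate[OF this, of c] show ?thesis
    by (simp add: ip_def)
qed

lemma nrm_translate_tendsto_test:
  assumes \<phi>: "\<phi> \<in> tests" and X: "X \<longlonglongrightarrow> 0"
  shows "(\<lambda>n. nrm (\<lambda>x. \<phi> (x + X n) - \<phi> x)) \<longlonglongrightarrow> 0"
proof -
  obtain R where "R > 0" and R: "\<forall>x. \<phi> x \<noteq> 0 \<longrightarrow> norm x < R"
    by (rule test_functions_support[OF \<phi>])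
  obtain C where C: "C \<ge> 0" "\<forall>x. norm (\<phi> x) \<le> C"
    by (rule continuous_bounded_support[OF test_functions_continuous[OF \<phi>], of R]) (use R in force)
  obtain N where N: "\<And>n. n \<ge> N \<Longrightarrow> norm (X n) < 1"
    using LIMSEQ_D[OF X, of 1] by auto
  have "(\<lambda>n. nrm (\<lambda>x. \<phi> (x + X (n + N)) - \<phi> x)) \<longlonglongrightarrow> 0"
  proof (rule L2_dominated_convergence(2))
    show "L2 (\<lambda>x. C * indicator (cball 0 (R + 1)) x)"
      by (intro L2_cmult L2_indicator) auto
    show "(\<lambda>x. \<phi> (x + X (n + N))) \<in> borel_measurable lebesgue" for n
      by (rule L2_measurable[OF L2_translate[OF test_functions_L2[OF \<phi>]]])
    show "AE x in lebesgue. (\<lambda>n. \<phi> (x + X (n + N))) \<longlonglongrightarrow> \<phi> x"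
    proof (rule AE_I2)
      fix x
      have "(\<lambda>n. x + X (n + N)) \<longlonglongrightarrow> x + 0"
        by (intro tendsto_intros LIMSEQ_ignore_initial_segment X)
      then show "(\<lambda>n. \<phi> (x + X (n + N))) \<longlonglongrightarrow> \<phi> x"
        using test_functions_continuous[OF \<phi>] by (auto intro: continuous_on_tendsto_compose)
    qed
    show "AE x in lebesgue. norm (\<phi> (x + X (n + N))) \<le> C * indicator (cball 0 (R + 1)) x" for n
    proof (rule AE_I2)
      fix x
      have "\<phi> (x + X (n + N)) = 0" if "norm x > R + 1"
        using that R[rule_format, of "x + X (n + N)"] N[of "n + N"] norm_triangle_ineq4[of "x + X (n + N)" "X (n + N)"] by force
      then show "norm (\<phi> (x + X (n + N))) \<le> C * indicator (cball 0 (R + 1)) x"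
        using C by (auto simp: indicator_def)
    qed
  qed (rule L2_measurable[OF test_functions_L2[OF \<phi>]])
  then show ?thesis
    by (rule LIMSEQ_offset)
qed

text \<open>Translations are isometries, so approximation by a test function reduces the claim to
  test functions, where dominated convergence applies.\<close>

lemma nrm_translate_tendsto:
  fixes u :: "'a::euclidean_space \<Rightarrow> real"
  assumes u: "L2 u"
  shows "((\<lambda>c. nrm (\<lambda>x. u (x + c) - u x)) \<longlongrightarrow> 0) (at 0)"
  unfolding tendsto_at_iff_sequentially o_def
proof (intro allI impI)
  fix X :: "nat \<Rightarrow> 'a" assume X: "X \<longlonglongrightarrow> 0"
  show "(\<lambda>n. nrm (\<lambda>x. u (x + X n) - u x)) \<longlonglongrightarrow> 0"
  proof (rule LIMSEQ_I)
    fix e :: real assume e: "e > 0"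
    then obtain \<phi> where \<phi>: "\<phi> \<in> tests" "nrm (\<lambda>x. u x - \<phi> x) < e / 3"
      using test_functions_dense[OF u, of "e / 3"] by auto
    have L: "L2 \<phi>" using \<phi> by (simp add: test_functions_L2)
    obtain N where N: "\<And>n. n \<ge> N \<Longrightarrow> nrm (\<lambda>x. \<phi> (x + X n) - \<phi> x) < e / 3"
      using LIMSEQ_D[OF nrm_translate_tendsto_test[OF \<phi>(1) X], of "e / 3"] e by auto
    have "nrm (\<lambda>x. u (x + X n) - u x) < e" if "n \<ge> N" for n
    proof -
      have "nrm (\<lambda>x. u (x + X n) - u x) \<le> nrm (\<lambda>x. u (x + X n) - \<phi> (x + X n)) + nrm (\<lambda>x. \<phi> (x + X n) - u x)"
        using u L by (intro nrm_triangle_diff L2_translate)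
      also have "nrm (\<lambda>x. u (x + X n) - \<phi> (x + X n)) = nrm (\<lambda>x. u x - \<phi> x)"
        using u L by (rule nrm_translate[OF L2_diff])
      also have "nrm (\<lambda>x. \<phi> (x + X n) - u x) \<le> nrm (\<lambda>x. \<phi> (x + X n) - \<phi> x) + nrm (\<lambda>x. \<phi> x - u x)"
        using u L by (intro nrm_triangle_diff L2_translate)
      finally show ?thesis
        using N[OF that] \<phi>(2) nrm_minus_commute[of \<phi> u] by linarith
    qed
    then show "\<exists>N. \<forall>n\<ge>N. norm (nrm (\<lambda>x. u (x + X n) - u x) - 0) < e"
      by (intro exI[of _ N]) simp
  qed
qed

text \<open>The field \<open>\<psi>\<close> is any pointwise gradient. Uniqueness of derivatives
  identifies it with the continuous one provided by smoothness, and it vanishes outside a ball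
  containing the support.\<close>

lemma test_function_gradient:
  assumes \<phi>: "\<phi> \<in> tests" and \<psi>: "\<And>x. GDERIV \<phi> x :> \<psi> x" and e: "e \<in> Basis"
  shows "continuous_on UNIV (\<lambda>x. \<psi> x \<bullet> e)" "L2 (\<lambda>x. \<psi> x \<bullet> e)" "\<exists>C\<ge>0. \<forall>x. \<bar>\<psi> x \<bullet> e\<bar> \<le> C"
proof -
  have "cont_diff 1 \<phi>"
    using \<phi> by (simp add: test_functions_def)
  then obtain \<psi>' where \<psi>': "\<And>x. GDERIV \<phi> x :> \<psi>' x" "\<And>b. b \<in> Basis \<Longrightarrow> continuous_on UNIV (\<lambda>x. \<psi>' x \<bullet> b)"
    by auto
  have "\<psi>' x \<bullet> e = \<psi> x \<bullet> e" for x
    using has_derivative_unique[OF \<psi>'(1)[of x, unfolded gderiv_def] \<psi>[of x, unfolded gderiv_def]]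
    by (metis inner_commute)
  with \<psi>'(2)[OF e] show c: "continuous_on UNIV (\<lambda>x. \<psi> x \<bullet> e)"
    by simp
  obtain R where "R > 0" and R: "\<forall>x. \<phi> x \<noteq> 0 \<longrightarrow> norm x < R"
    by (rule test_functions_support[OF \<phi>])
  have z: "\<psi> x \<bullet> e = 0" if "norm x > R" for x
  proof -
    have "\<forall>\<^sub>F y in nhds x. y \<in> - cball 0 R"
      using that by (intro eventually_nhds_in_open) auto
    then have "\<forall>\<^sub>F y in at x. \<phi> y = 0"
      unfolding eventually_at_filter by eventually_elim (use R in \<open>auto simp: not_le dest: less_asym\<close>)
    then have "\<forall>\<^sub>F y in at x. 0 = \<phi> y"
      by eventually_elim simp
    moreover have "\<phi> x = 0"
      using that R[rule_format, of x] by linarith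
    ultimately have "GDERIV \<phi> x :> 0"
      unfolding gderiv_def inner_zero_right
      by (intro has_derivative_transform_eventually[OF has_derivative_const]) simp_all
    then show ?thesis
      using has_derivative_unique[OF \<psi>[of x, unfolded gderiv_def], of "\<lambda>h. h \<bullet> 0"] unfolding gderiv_def
      by (simp add: fun_eq_iff inner_commute)
  qed
  obtain C where C: "C \<ge> 0" "\<forall>x. norm (\<psi> x \<bullet> e) \<le> C"
    by (rule continuous_bounded_support[OF c, of R]) (use z in auto)
  then show "\<exists>C\<ge>0. \<forall>x. \<bar>\<psi> x \<bullet> e\<bar> \<le> C"
    by auto
  show "L2 (\<lambda>x. \<psi> x \<bullet> e)"
    using z by (intro L2_bounded_support[OF borel_measurable_lebesgue_continuous[OF c] C(2)[rule_format], of "cball 0 R"]) auto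
qed

lemma GDERIV_directional:
  assumes "\<And>x. GDERIV \<phi> x :> \<psi> x"
  shows "DERIV (\<lambda>t. \<phi> (x + t *\<^sub>R e)) s :> \<psi> (x + s *\<^sub>R e) \<bullet> e"
proof -
  have "((\<lambda>t. x + t *\<^sub>R e) has_derivative (\<lambda>h. h *\<^sub>R e)) (at s)"
    by (auto intro!: derivative_eq_intros)
  from has_derivative_compose[OF this, of \<phi> "\<lambda>h. h \<bullet> \<psi> (x + s *\<^sub>R e)"] assms[of "x + s *\<^sub>R e"]
  show ?thesis
    by (simp add: gderiv_def has_field_derivative_def inner_commute mult.commute)
      (simp add: mult_commute_abs)
qed

text \<open>Dominated convergence: the mean value bound \<open>C\<close> controls the quotients, and
  once the steps are shorter than 1 all of them live in the ball of radius
  \<open>R + 1\<close>.\<close>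

lemma difference_quotient_test_tendsto:
  assumes \<phi>: "\<phi> \<in> tests" and \<psi>: "\<And>x. GDERIV \<phi> x :> \<psi> x" and e: "e \<in> Basis"
    and X: "X \<longlonglongrightarrow> 0" "\<And>n. X n \<noteq> 0"
  shows "(\<lambda>n. nrm (\<lambda>x. (\<phi> (x + X n *\<^sub>R e) - \<phi> x) / X n - \<psi> x \<bullet> e)) \<longlonglongrightarrow> 0"
proof -
  obtain R where "R > 0" and R: "\<forall>x. \<phi> x \<noteq> 0 \<longrightarrow> norm x < R"
    by (rule test_functions_support[OF \<phi>])
  obtain C where C: "C \<ge> 0" "\<And>x. \<bar>\<psi> x \<bullet> e\<bar> \<le> C"
    using test_function_gradient(3)[OF \<phi> \<psi> e] by auto
  obtain N where N: "\<And>n. n \<ge> N \<Longrightarrow> norm (X n) < 1"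
    using LIMSEQ_D[OF X(1), of 1] by auto
  have bound: "\<bar>\<phi> (x + h *\<^sub>R e) - \<phi> x\<bar> \<le> C * \<bar>h\<bar>" for x h
  proof -
    have "norm (\<phi> (x + h *\<^sub>R e) - \<phi> (x + 0 *\<^sub>R e)) \<le> C * norm (h - 0)"
    proof (rule field_differentiable_bound[where S=UNIV])
      show "((\<lambda>t. \<phi> (x + t *\<^sub>R e)) has_field_derivative \<psi> (x + s *\<^sub>R e) \<bullet> e) (at s within UNIV)" for s
        using GDERIV_directional[OF \<psi>] by simp
    qed (use C in auto)
    then show ?thesis by simp
  qed
  have "(\<lambda>n. nrm (\<lambda>x. (\<phi> (x + X (n + N) *\<^sub>R e) - \<phi> x) / X (n + N) - \<psi> x \<bullet> e)) \<longlonglongrightarrow> 0"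
  proof (rule L2_dominated_convergence(2))
    show "L2 (\<lambda>x. C * indicator (cball 0 (R + 1)) x)"
      by (intro L2_cmult L2_indicator) auto
    have "L2 (\<lambda>x. inverse (X (n + N)) * (\<phi> (x + X (n + N) *\<^sub>R e) - \<phi> x))" for n
      using test_functions_L2[OF \<phi>] by (intro L2_cmult L2_diff L2_translate)
    then show "(\<lambda>x. (\<phi> (x + X (n + N) *\<^sub>R e) - \<phi> x) / X (n + N)) \<in> borel_measurable lebesgue" for n
      by (intro L2_measurable) (simp add: divide_inverse mult.commute)
    show "AE x in lebesgue. (\<lambda>n. (\<phi> (x + X (n + N) *\<^sub>R e) - \<phi> x) / X (n + N)) \<longlonglongrightarrow> \<psi> x \<bullet> e"
    proof (rule AE_I2)
      fix x
      have "((\<lambda>h. (\<phi> (x + (0 + h) *\<^sub>R e) - \<phi> (x + 0 *\<^sub>R e)) / h) \<longlongrightarrow> \<psi> (x + 0 *\<^sub>R e) \<bullet> e) (at 0)"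
        using GDERIV_directional[OF \<psi>, of x e 0] unfolding DERIV_def .
      moreover have "filterlim (\<lambda>n. X (n + N)) (at 0) sequentially"
        using LIMSEQ_ignore_initial_segment[OF X(1), of N] X(2) by (simp add: filterlim_at)
      ultimately show "(\<lambda>n. (\<phi> (x + X (n + N) *\<^sub>R e) - \<phi> x) / X (n + N)) \<longlonglongrightarrow> \<psi> x \<bullet> e"
        using filterlim_compose by fastforce
    qed
    show "AE x in lebesgue. norm ((\<phi> (x + X (n + N) *\<^sub>R e) - \<phi> x) / X (n + N)) \<le> C * indicator (cball 0 (R + 1)) x" for n
    proof (rule AE_I2)
      fix x
      show "norm ((\<phi> (x + X (n + N) *\<^sub>R e) - \<phi> x) / X (n + N)) \<le> C * indicator (cball 0 (R + 1)) x"
      proof (cases "norm x \<le> R + 1")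
        case True
        then show ?thesis
          using bound[of x "X (n + N)"] X(2)[of "n + N"] by (simp add: indicator_def field_simps)
      next
        case False
        then have "R \<le> norm (x + X (n + N) *\<^sub>R e)" "R \<le> norm x"
          using N[of "n + N"] norm_triangle_ineq4[of "x + X (n + N) *\<^sub>R e" "X (n + N) *\<^sub>R e"] e by auto
        then have "\<phi> (x + X (n + N) *\<^sub>R e) = 0" "\<phi> x = 0"
          using R by (meson not_le)+
        then show ?thesis
          using C(1) by simp
      qed
    qed
  qed (rule L2_measurable[OF test_function_gradient(2)[OF \<phi> \<psi> e]])
  then show ?thesis
    by (rule LIMSEQ_offset)
qed

subsection \<open>Weak derivatives\<close>

text \<open>A scalar version of the weak gradient, so that duality with scalar test functions
  applies to it. Square integrability is kept as a separate hypothesis.\<close>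

definition wpd :: "'a::euclidean_space \<Rightarrow> ('a \<Rightarrow> real) \<Rightarrow> ('a \<Rightarrow> real) \<Rightarrow> bool" where
  "wpd e u p \<longleftrightarrow> (\<forall>\<phi>\<in>tests. \<forall>\<psi>. (\<forall>x. GDERIV \<phi> x :> \<psi> x) \<longrightarrow>
     ip u (\<lambda>x. \<psi> x \<bullet> e) = - ip \<phi> p)"

text \<open>A relation instead of the chosen \<open>weak_grad\<close>: it admits every version of
  the gradient, so explicit formulas for gradients can be used directly.\<close>

definition W :: "('a::euclidean_space \<Rightarrow> real) \<Rightarrow> ('a \<Rightarrow> 'a) \<Rightarrow> bool" where
  "W u g \<longleftrightarrow> L2 u \<and> is_weak_gradient UNIV u g"

lemma test_functions_GDERIV:
  assumes "\<phi> \<in> tests"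
  obtains \<psi> where "\<forall>x. GDERIV \<phi> x :> \<psi> x"
proof -
  have "cont_diff 1 \<phi>"
    using assms by (simp add: test_functions_def)
  then show thesis
    using that by auto
qed

lemma L2_component: "L2 g \<Longrightarrow> e \<in> Basis \<Longrightarrow> L2 (\<lambda>x. g x \<bullet> e)"
  by (rule L2_dominated[of g]) (auto simp: Basis_le_norm)

lemma nrm_component: "L2 g \<Longrightarrow> e \<in> Basis \<Longrightarrow> nrm (\<lambda>x. g x \<bullet> e) \<le> nrm g"
  by (rule nrm_mono) (auto simp: L2_component Basis_le_norm)

lemma L2_sum: "(\<And>i. i \<in> I \<Longrightarrow> L2 (f i)) \<Longrightarrow> L2 (\<lambda>x. \<Sum>i\<in>I. f i x)"
  by (induction I rule: infinite_finite_induct) (auto intro: L2_add)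

lemma L2_of_components:
  fixes g :: "'a::euclidean_space \<Rightarrow> 'b::euclidean_space"
  assumes "\<And>e. e \<in> Basis \<Longrightarrow> L2 (\<lambda>x. g x \<bullet> e)"
  shows "L2 g"
proof -
  have "L2 (\<lambda>x. (g x \<bullet> e) *\<^sub>R e)" if "e \<in> Basis" for e
  proof (rule L2_dominated[OF assms[OF that]])
    show "(\<lambda>x. (g x \<bullet> e) *\<^sub>R e) \<in> borel_measurable lebesgue"
      using L2_measurable[OF assms[OF that]] by measurable
  qed (use that in auto)
  then have "L2 (\<lambda>x. \<Sum>e\<in>Basis. (g x \<bullet> e) *\<^sub>R e)"
    by (rule L2_sum)
  then show ?thesis
    by (simp add: euclidean_representation)
qed

lemma L2_scaleR_integrable:
  fixes u :: "'a::euclidean_space \<Rightarrow> real" and g :: "'a \<Rightarrow> 'b::euclidean_space"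
  assumes "L2 u" "L2 g"
  shows "integrable lebesgue (\<lambda>x. u x *\<^sub>R g x)"
proof -
  have [measurable]: "u \<in> borel_measurable lebesgue" "g \<in> borel_measurable lebesgue"
    using assms by auto
  have "norm (u x *\<^sub>R g x) \<le> (norm (u x))\<^sup>2 + (norm (g x))\<^sup>2" for x
    using sum_squares_bound[of "norm (u x)" "norm (g x)"] mult_nonneg_nonneg[of "norm (u x)" "norm (g x)"]
    by (simp del: mult_nonneg_nonneg)
  moreover have "integrable lebesgue (\<lambda>x. (norm (u x))\<^sup>2 + (norm (g x))\<^sup>2)"
    using assms by (intro Bochner_Integration.integrable_add L2_integrable)
  ultimately show ?thesis
    by (auto intro: Bochner_Integration.integrable_bound)
qed

text \<open>Vector-valued integrals may be compared by components only if the integrands are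
  integrable, which square integrability guarantees; without it both sides are false.\<close>

lemma W_iff: "W u g \<longleftrightarrow> L2 u \<and> L2 g \<and> (\<forall>e\<in>Basis. wpd e u (\<lambda>x. g x \<bullet> e))"
proof (cases "L2 u \<and> L2 g")
  case True
  have "(LINT x|lebesgue. u x *\<^sub>R \<psi> x) = - (LINT x|lebesgue. \<phi> x *\<^sub>R g x) \<longleftrightarrow>
      (\<forall>e\<in>Basis. ip u (\<lambda>x. \<psi> x \<bullet> e) = - ip \<phi> (\<lambda>x. g x \<bullet> e))"
    if \<phi>: "\<phi> \<in> tests" and \<psi>: "\<forall>x. GDERIV \<phi> x :> \<psi> x" for \<phi> \<psi>
  proof -
    have "L2 \<psi>"
      by (rule L2_of_components) (rule test_function_gradient(2)[OF \<phi> \<psi>[rule_format]])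
    then have i: "integrable lebesgue (\<lambda>x. u x *\<^sub>R \<psi> x)" "integrable lebesgue (\<lambda>x. \<phi> x *\<^sub>R g x)"
      using True test_functions_L2[OF \<phi>] by (simp_all add: L2_scaleR_integrable)
    have "(LINT x|lebesgue. u x *\<^sub>R \<psi> x) \<bullet> e = ip u (\<lambda>x. \<psi> x \<bullet> e)"
      "(LINT x|lebesgue. \<phi> x *\<^sub>R g x) \<bullet> e = ip \<phi> (\<lambda>x. g x \<bullet> e)" for e
      using integral_inner_left[of e, OF i(1)] integral_inner_left[of e, OF i(2)] by (simp_all add: ip_def)
    then show ?thesis
      by (subst euclidean_eq_iff) (simp add: inner_minus_left)
  qed
  then show ?thesis
    using True by (auto simp: W_def is_weak_gradient_def L2_on_UNIV set_lebesgue_integral_def wpd_def)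
next
  case False
  then show ?thesis
    by (auto simp: W_def is_weak_gradient_def L2_on_UNIV)
qed

lemma H1_UNIV_iff: "u \<in> H1 UNIV \<longleftrightarrow> (\<exists>g. W u g)"
  by (auto simp: H1_def W_def L2_on_UNIV)

lemma W_L2: "W u g \<Longrightarrow> L2 u" "W u g \<Longrightarrow> L2 g"
  by (auto simp: W_iff)

lemma wpd_add:
  assumes "L2 u" "L2 v" "L2 p" "L2 q" "wpd e u p" "wpd e v q" "e \<in> Basis"
  shows "wpd e (\<lambda>x. u x + v x) (\<lambda>x. p x + q x)"
  unfolding wpd_def
proof (intro ballI allI impI)
  fix \<phi> :: "'a \<Rightarrow> real" and \<psi> assume \<phi>: "\<phi> \<in> tests" and \<psi>: "\<forall>x. GDERIV \<phi> x :> \<psi> x"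
  have "L2 (\<lambda>x. \<psi> x \<bullet> e)" "L2 \<phi>"
    using test_function_gradient(2)[OF \<phi>, of \<psi>] \<psi> assms(7) test_functions_L2[OF \<phi>] by auto
  then show "ip (\<lambda>x. u x + v x) (\<lambda>x. \<psi> x \<bullet> e) = - ip \<phi> (\<lambda>x. p x + q x)"
    using assms \<phi> \<psi> by (simp add: ip_add_left ip_add_right wpd_def)
qed

lemma wpd_cmult: "wpd e u p \<Longrightarrow> wpd e (\<lambda>x. c * u x) (\<lambda>x. c * p x)"
  using ip_scale_left[of c u] ip_scale_right[of _ c p] by (simp add: wpd_def)

lemma wpd_cong_AE:
  assumes "wpd e u p" "AE x in lebesgue. u x = u' x" "AE x in lebesgue. p x = p' x"
  shows "wpd e u' p'"
proof -
  have "ip u \<psi> = ip u' \<psi>" "ip \<phi> p = ip \<phi> p'" for \<phi> \<psi>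
    using assms by (auto intro: ip_cong_AE)
  then show ?thesis
    using assms(1) by (simp add: wpd_def)
qed

lemma W_add: "W u g \<Longrightarrow> W v k \<Longrightarrow> W (\<lambda>x. u x + v x) (\<lambda>x. g x + k x)"
  by (simp add: W_iff L2_add wpd_add inner_add_left L2_component)

lemma W_scaleR: "W u g \<Longrightarrow> W (\<lambda>x. c * u x) (\<lambda>x. c *\<^sub>R g x)"
  by (simp add: W_iff L2_cmult L2_scaleR wpd_cmult)

lemma W_minus: "W u g \<Longrightarrow> W (\<lambda>x. - u x) (\<lambda>x. - g x)"
  using W_scaleR[of u g "-1"] by simp

lemma W_diff: "W u g \<Longrightarrow> W v k \<Longrightarrow> W (\<lambda>x. u x - v x) (\<lambda>x. g x - k x)"
  using W_add[of u g "\<lambda>x. - v x" "\<lambda>x. - k x"] W_minus[of v k] by simp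

lemma W_zero: "W (\<lambda>x. 0) (\<lambda>x. 0)"
  by (simp add: W_iff wpd_def ip_def)

lemma W_cong_AE:
  assumes "W u g" "AE x in lebesgue. u x = u' x" "AE x in lebesgue. g x = g' x"
  shows "W u' g'"
  unfolding W_iff
proof (intro conjI ballI)
  show "L2 u'" "L2 g'"
    using assms L2_cong_AE W_L2 by blast+
  fix e :: 'a assume "e \<in> Basis"
  then have "wpd e u (\<lambda>x. g x \<bullet> e)"
    using assms(1) by (simp add: W_iff)
  then show "wpd e u' (\<lambda>x. g' x \<bullet> e)"
    by (rule wpd_cong_AE) (use assms in auto)
qed

lemma wpd_unique:
  assumes "wpd e u p" "wpd e u q" "L2 p" "L2 q"
  shows "AE x in lebesgue. p x = q x"
proof (rule L2_eq_AE_of_test[OF assms(3,4)])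
  fix \<phi> :: "'a \<Rightarrow> real" assume \<phi>: "\<phi> \<in> tests"
  then obtain \<psi> where "\<forall>x. GDERIV \<phi> x :> \<psi> x"
    by (rule test_functions_GDERIV)
  with \<phi> assms(1,2) show "ip \<phi> p = ip \<phi> q"
    unfolding wpd_def by (metis neg_equal_iff_equal)
qed

lemma W_unique:
  assumes "W u g" "W u k"
  shows "AE x in lebesgue. g x = k x"
proof -
  have "\<forall>e\<in>Basis. AE x in lebesgue. g x \<bullet> e = k x \<bullet> e"
    using assms by (auto simp: W_iff L2_component intro: wpd_unique)
  then have "AE x in lebesgue. \<forall>e\<in>Basis. g x \<bullet> e = k x \<bullet> e"
    by (subst AE_ball_countable) (auto intro: countable_finite)
  then show ?thesis
    by eventually_elim (auto intro: euclidean_eqI)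
qed

text \<open>The weak identity consists of pairings with fixed square integrable functions, which are
  continuous in norm.\<close>

lemma W_limit:
  assumes W: "\<And>n. W (u n) (g n)" and L: "L2 v" "L2 k"
    and conv: "L2_conv u v" "L2_conv g k"
  shows "W v k"
  unfolding W_iff
proof (intro conjI ballI L)
  fix e :: 'a assume e: "e \<in> Basis"
  have L': "L2 (u n)" "L2 (g n)" for n
    using W W_L2 by blast+
  have comp: "(\<lambda>n. nrm (\<lambda>x. g n x \<bullet> e - k x \<bullet> e)) \<longlonglongrightarrow> 0"
    using nrm_component[OF L2_diff[OF L'(2) L(2)] e]
    by (intro tendsto_null_bound[OF _ conv(2)]) (simp add: inner_diff_left)
  show "wpd e v (\<lambda>x. k x \<bullet> e)"
    unfolding wpd_def
  proof (intro ballI allI impI)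
    fix \<phi> :: "'a \<Rightarrow> real" and \<psi> assume \<phi>: "\<phi> \<in> tests" and \<psi>: "\<forall>x. GDERIV \<phi> x :> \<psi> x"
    have "L2 (\<lambda>x. \<psi> x \<bullet> e)"
      using test_function_gradient(2)[OF \<phi>, of \<psi>] \<psi> e by auto
    then have 1: "(\<lambda>n. ip (u n) (\<lambda>x. \<psi> x \<bullet> e)) \<longlonglongrightarrow> ip v (\<lambda>x. \<psi> x \<bullet> e)"
      using L L' conv by (intro ip_tendsto)
    have 2: "(\<lambda>n. - ip (\<lambda>x. g n x \<bullet> e) \<phi>) \<longlonglongrightarrow> - ip (\<lambda>x. k x \<bullet> e) \<phi>"
      using L L' test_functions_L2[OF \<phi>] e by (intro tendsto_minus ip_tendsto comp L2_component)
    have "ip (u n) (\<lambda>x. \<psi> x \<bullet> e) = - ip (\<lambda>x. g n x \<bullet> e) \<phi>" for n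
      using W[of n] e \<phi> \<psi> by (simp add: W_iff wpd_def ip_commute[of _ \<phi>])
    with 1 2 show "ip v (\<lambda>x. \<psi> x \<bullet> e) = - ip \<phi> (\<lambda>x. k x \<bullet> e)"
      using LIMSEQ_unique by (fastforce simp: ip_commute[of _ \<phi>])
  qed
qed

subsection \<open>Difference quotients\<close>

text \<open>Discrete integration by parts moves the translation, with reversed sign, onto the test
  function, where the quotients converge. No derivative of \<open>u\<close> is presupposed.\<close>

lemma difference_quotient_dual_tendsto:
  assumes u: "L2 u" and \<phi>: "\<phi> \<in> tests" and \<psi>: "\<forall>x. GDERIV \<phi> x :> \<psi> x"
    and e: "e \<in> Basis" and X: "X \<longlonglongrightarrow> 0" "\<And>n. X n \<noteq> 0"
  shows "(\<lambda>n. (ip (\<lambda>x. u (x + X n *\<^sub>R e)) \<phi> - ip u \<phi>) / X n) \<longlonglongrightarrow> - ip u (\<lambda>x. \<psi> x \<bullet> e)"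
proof -
  have L: "L2 \<phi>" "L2 (\<lambda>x. \<psi> x \<bullet> e)"
    using test_function_gradient(2)[OF \<phi>, of \<psi>] test_functions_L2[OF \<phi>] \<psi> e by auto
  define q where "q n x = (\<phi> (x + (- X n) *\<^sub>R e) - \<phi> x) / (- X n)" for n x
  have Lq: "L2 (q n)" for n
  proof -
    have "L2 (\<lambda>x. (1 / - X n) * (\<phi> (x + (- X n) *\<^sub>R e) - \<phi> x))"
      by (intro L2_cmult L2_diff L2_translate L)
    then show ?thesis
      by (simp add: q_def[abs_def])
  qed
  have "(\<lambda>n. - X n) \<longlonglongrightarrow> 0" "- X n \<noteq> 0" for n
    using tendsto_minus[OF X(1)] X(2) by auto
  from difference_quotient_test_tendsto[OF \<phi> _ e this] \<psi>
  have "(\<lambda>n. nrm (\<lambda>x. q n x - \<psi> x \<bullet> e)) \<longlonglongrightarrow> 0"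
    by (simp add: q_def)
  then have "(\<lambda>n. - ip (q n) u) \<longlonglongrightarrow> - ip (\<lambda>x. \<psi> x \<bullet> e) u"
    by (intro tendsto_minus ip_tendsto Lq L u)
  moreover have "- ip (q n) u = (ip (\<lambda>x. u (x + X n *\<^sub>R e)) \<phi> - ip u \<phi>) / X n" for n
  proof -
    have "ip u (\<lambda>x. \<phi> (x + (- X n) *\<^sub>R e) - \<phi> x) = ip u (\<lambda>x. (- X n) *\<^sub>R q n x)"
      using X(2)[of n] by (simp add: q_def)
    also have "\<dots> = - X n * ip (q n) u"
      using ip_scale_right[of u "- X n" "q n"] by (simp add: ip_commute)
    finally have "- X n * ip (q n) u = ip (\<lambda>x. u (x + X n *\<^sub>R e)) \<phi> - ip u \<phi>"
      using u L by (simp add: ip_diff_right L2_translate[of \<phi> "- (X n *\<^sub>R e)", simplified] ip_translate)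
    then show ?thesis
      using X(2)[of n] by (simp add: field_simps)
  qed
  ultimately show ?thesis
    by (simp add: ip_commute)
qed

text \<open>One null sequence of steps suffices. This freedom is used below to take all steps
  positive or all steps negative.\<close>

lemma wpd_if_difference_quotients:
  assumes L: "L2 u" "L2 p" and e: "e \<in> Basis" and X: "X \<longlonglongrightarrow> 0" "\<And>n. X n \<noteq> 0"
    and conv: "(\<lambda>n. nrm (\<lambda>x. (u (x + X n *\<^sub>R e) - u x) / X n - p x)) \<longlonglongrightarrow> 0"
  shows "wpd e u p"
  unfolding wpd_def
proof (intro ballI allI impI)
  fix \<phi> :: "'a \<Rightarrow> real" and \<psi> assume \<phi>: "\<phi> \<in> tests" and \<psi>: "\<forall>x. GDERIV \<phi> x :> \<psi> x"
  have "L2 (\<lambda>x. inverse (X n) * (u (x + X n *\<^sub>R e) - u x))" for n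
    by (intro L2_cmult L2_diff L2_translate L)
  then have D: "L2 (\<lambda>x. (u (x + X n *\<^sub>R e) - u x) / X n)" for n
    by (simp add: divide_inverse mult.commute)
  have "(\<lambda>n. ip (\<lambda>x. (u (x + X n *\<^sub>R e) - u x) / X n) \<phi>) \<longlonglongrightarrow> ip p \<phi>"
    by (rule ip_tendsto[OF D L(2) test_functions_L2[OF \<phi>] conv])
  moreover have "ip (\<lambda>x. (u (x + X n *\<^sub>R e) - u x) / X n) \<phi> = (ip (\<lambda>x. u (x + X n *\<^sub>R e)) \<phi> - ip u \<phi>) / X n" for n
    using ip_scale_left[of "inverse (X n)" "\<lambda>x. u (x + X n *\<^sub>R e) - u x" \<phi>] L test_functions_L2[OF \<phi>]
    by (simp add: ip_diff_left L2_translate divide_inverse mult.commute)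
  ultimately show "ip u (\<lambda>x. \<psi> x \<bullet> e) = - ip \<phi> p"
    using LIMSEQ_unique[OF _ difference_quotient_dual_tendsto[OF L(1) \<phi> \<psi> e X], of "ip p \<phi>"]
    by (simp add: ip_commute)
qed

lemma DERIV_ip_translate:
  assumes L: "L2 u" "L2 p" and e: "e \<in> Basis" and w: "wpd e u p" and \<phi>: "\<phi> \<in> tests"
  shows "DERIV (\<lambda>t. ip (\<lambda>x. u (x + t *\<^sub>R e)) \<phi>) t :> ip (\<lambda>x. p (x + t *\<^sub>R e)) \<phi>"
  unfolding DERIV_def tendsto_at_iff_sequentially o_def
proof (intro allI impI)
  fix X :: "nat \<Rightarrow> real" assume "\<forall>i. X i \<in> UNIV - {0}" and X0: "X \<longlonglongrightarrow> 0"
  then have X: "\<And>n. X n \<noteq> 0" by auto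
  obtain \<psi> where \<psi>: "\<forall>x. GDERIV \<phi> x :> \<psi> x"
    using \<phi> by (rule test_functions_GDERIV)
  \<comment> \<open>Shifting the test function by \<open>- t\<close> along \<open>e\<close> reduces
    the derivative at \<open>t\<close> to the derivative at 0.\<close>
  define c where "c = - (t *\<^sub>R e)"
  have \<phi>c: "(\<lambda>x. \<phi> (x + c)) \<in> tests"
    by (rule test_functions_translate[OF \<phi>])
  have \<psi>c: "\<forall>x. GDERIV (\<lambda>x. \<phi> (x + c)) x :> \<psi> (x + c)"
    using \<psi> by (auto intro: GDERIV_translate)
  have tr: "ip (\<lambda>x. u (x + s *\<^sub>R e)) \<phi> = ip (\<lambda>x. u (x + (s - t) *\<^sub>R e)) (\<lambda>x. \<phi> (x + c))" for s
  proof -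
    have "(\<lambda>x. u (x + t *\<^sub>R e + (s - t) *\<^sub>R e)) = (\<lambda>x. u (x + s *\<^sub>R e))"
      by (simp add: algebra_simps)
    then show ?thesis
      using ip_translate[OF L2_translate[OF L(1), of "(s - t) *\<^sub>R e"] test_functions_L2[OF \<phi>], of "t *\<^sub>R e"]
      by (simp add: c_def)
  qed
  have "(\<lambda>n. (ip (\<lambda>x. u (x + X n *\<^sub>R e)) (\<lambda>x. \<phi> (x + c)) - ip u (\<lambda>x. \<phi> (x + c))) / X n)
      \<longlonglongrightarrow> - ip u (\<lambda>x. \<psi> (x + c) \<bullet> e)"
    by (rule difference_quotient_dual_tendsto[OF L(1) \<phi>c \<psi>c e X0 X])
  also have "- ip u (\<lambda>x. \<psi> (x + c) \<bullet> e) = ip (\<lambda>x. \<phi> (x + c)) p"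
    using w \<phi>c \<psi>c by (simp add: wpd_def)
  also have "\<dots> = ip (\<lambda>x. p (x + t *\<^sub>R e)) \<phi>"
    using ip_translate[OF L(2) test_functions_L2[OF \<phi>], of "t *\<^sub>R e"] by (simp add: c_def ip_commute)
  finally show "(\<lambda>n. (ip (\<lambda>x. u (x + (t + X n) *\<^sub>R e)) \<phi> - ip (\<lambda>x. u (x + t *\<^sub>R e)) \<phi>) / X n)
      \<longlonglongrightarrow> ip (\<lambda>x. p (x + t *\<^sub>R e)) \<phi>"
    using tr[of "t + X _"] tr[of t] by simp
qed

text \<open>The scalar mean value theorem for the pairing replaces an integral of translates over
  the step. The intermediate point \<open>s\<close> depends on \<open>\<phi>\<close>, so it may only
  enter later bounds through estimates uniform in \<open>s\<close>.\<close>

lemma ip_translate_mean_value: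
  assumes L: "L2 u" "L2 p" and e: "e \<in> Basis" and w: "wpd e u p" and \<phi>: "\<phi> \<in> tests"
    and h: "h \<noteq> 0"
  obtains s where "\<bar>s\<bar> \<le> \<bar>h\<bar>" "ip (\<lambda>x. u (x + h *\<^sub>R e)) \<phi> - ip u \<phi> = h * ip (\<lambda>x. p (x + s *\<^sub>R e)) \<phi>"
proof -
  define F where "F t = ip (\<lambda>x. u (x + t *\<^sub>R e)) \<phi>" for t
  define F' where "F' t = ip (\<lambda>x. p (x + t *\<^sub>R e)) \<phi>" for t
  have D: "DERIV F t :> F' t" for t
    unfolding F_def F'_def by (rule DERIV_ip_translate[OF L e w \<phi>])
  have "\<exists>s. \<bar>s\<bar> \<le> \<bar>h\<bar> \<and> F h - F 0 = h * F' s"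
  proof (cases "h > 0")
    case True
    then obtain z where "z > 0" "z < h" "F h - F 0 = (h - 0) * F' z"
      using MVT2[of 0 h F F'] D by auto
    then show ?thesis
      by (intro exI[of _ z]) auto
  next
    case False
    then have "h < 0" using h by simp
    then obtain z where "z > h" "z < 0" "F 0 - F h = (0 - h) * F' z"
      using MVT2[of h 0 F F'] D by auto
    then show ?thesis
      by (intro exI[of _ z]) (auto simp: algebra_simps)
  qed
  then show thesis
    using that by (auto simp: F_def F'_def)
qed

text \<open>All translates of \<open>p\<close> have the same norm, so the unknown mean value point
  is harmless and duality yields the bound.\<close>

lemma nrm_translate_diff_le:
  assumes L: "L2 u" "L2 p" and e: "e \<in> Basis" and w: "wpd e u p"
  shows "nrm (\<lambda>x. u (x + h *\<^sub>R e) - u x) \<le> \<bar>h\<bar> * nrm p"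
proof (cases "h = 0")
  case False
  show ?thesis
  proof (rule nrm_le_dual)
    show "L2 (\<lambda>x. u (x + h *\<^sub>R e) - u x)"
      by (intro L2_diff L2_translate L)
    fix \<phi> :: "'a \<Rightarrow> real" assume \<phi>: "\<phi> \<in> tests"
    obtain s where s: "ip (\<lambda>x. u (x + h *\<^sub>R e)) \<phi> - ip u \<phi> = h * ip (\<lambda>x. p (x + s *\<^sub>R e)) \<phi>"
      by (rule ip_translate_mean_value[OF L e w \<phi> False])
    have "\<bar>ip (\<lambda>x. p (x + s *\<^sub>R e)) \<phi>\<bar> \<le> nrm p * nrm \<phi>"
      using ip_Cauchy_Schwarz[OF L2_translate[OF L(2)] test_functions_L2[OF \<phi>]] nrm_translate[OF L(2)] by metis
    then have "\<bar>h\<bar> * \<bar>ip (\<lambda>x. p (x + s *\<^sub>R e)) \<phi>\<bar> \<le> \<bar>h\<bar> * (nrm p * nrm \<phi>)"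
      by (intro mult_left_mono) auto
    then show "\<bar>ip (\<lambda>x. u (x + h *\<^sub>R e) - u x) \<phi>\<bar> \<le> \<bar>h\<bar> * nrm p * nrm \<phi>"
      using s L test_functions_L2[OF \<phi>] by (simp add: ip_diff_left L2_translate abs_mult mult.assoc)
  qed auto
qed simp

text \<open>The mean value point varies with the test function, which is why \<open>M\<close> has to
  bound the translation error for every admissible \<open>s\<close>.\<close>

lemma nrm_difference_quotient_le:
  assumes L: "L2 u" "L2 p" and e: "e \<in> Basis" and w: "wpd e u p" and h: "h \<noteq> 0"
    and M: "\<And>s. \<bar>s\<bar> \<le> \<bar>h\<bar> \<Longrightarrow> nrm (\<lambda>x. p (x + s *\<^sub>R e) - p x) \<le> M"
  shows "nrm (\<lambda>x. (u (x + h *\<^sub>R e) - u x) / h - p x) \<le> M"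
proof -
  have D: "L2 (\<lambda>x. (u (x + h *\<^sub>R e) - u x) / h)"
    using L2_cmult[OF L2_diff[OF L2_translate[OF L(1)] L(1)], of "inverse h" "h *\<^sub>R e"]
    by (simp add: divide_inverse mult.commute)
  show ?thesis
  proof (rule nrm_le_dual)
    show "L2 (\<lambda>x. (u (x + h *\<^sub>R e) - u x) / h - p x)"
      by (intro L2_diff D L)
    show "M \<ge> 0"
      using M[of 0] nrm_nonneg[of "\<lambda>x. p (x + 0 *\<^sub>R e) - p x"] by simp
    fix \<phi> :: "'a \<Rightarrow> real" assume \<phi>: "\<phi> \<in> tests"
    have L\<phi>: "L2 \<phi>" by (rule test_functions_L2[OF \<phi>])
    obtain s where s: "\<bar>s\<bar> \<le> \<bar>h\<bar>" "ip (\<lambda>x. u (x + h *\<^sub>R e)) \<phi> - ip u \<phi> = h * ip (\<lambda>x. p (x + s *\<^sub>R e)) \<phi>"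
      by (rule ip_translate_mean_value[OF L e w \<phi> h])
    have "ip (\<lambda>x. (u (x + h *\<^sub>R e) - u x) / h) \<phi> = (ip (\<lambda>x. u (x + h *\<^sub>R e)) \<phi> - ip u \<phi>) / h"
      using ip_scale_left[of "inverse h" "\<lambda>x. u (x + h *\<^sub>R e) - u x" \<phi>] L L\<phi>
      by (simp add: ip_diff_left L2_translate divide_inverse mult.commute)
    also have "\<dots> = ip (\<lambda>x. p (x + s *\<^sub>R e)) \<phi>"
      using s h by simp
    finally have "ip (\<lambda>x. (u (x + h *\<^sub>R e) - u x) / h - p x) \<phi> = ip (\<lambda>x. p (x + s *\<^sub>R e) - p x) \<phi>"
      using D L L\<phi> by (simp add: ip_diff_left L2_translate)
    also have "\<bar>\<dots>\<bar> \<le> nrm (\<lambda>x. p (x + s *\<^sub>R e) - p x) * nrm \<phi>"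
      by (intro ip_Cauchy_Schwarz L2_diff L2_translate L L\<phi>)
    also have "\<dots> \<le> M * nrm \<phi>"
      using M[OF s(1)] by (intro mult_right_mono) auto
    finally show "\<bar>ip (\<lambda>x. (u (x + h *\<^sub>R e) - u x) / h - p x) \<phi>\<bar> \<le> M * nrm \<phi>" .
  qed
qed

text \<open>Continuity of translations at \<open>p\<close> makes the bound of the preceding lemma
  small. The convergence is strong, as the nonlinear operations below require.\<close>

lemma difference_quotients_tendsto:
  assumes L: "L2 u" "L2 p" and e: "e \<in> Basis" and w: "wpd e u p"
    and X: "X \<longlonglongrightarrow> 0" "\<And>n. X n \<noteq> 0"
  shows "(\<lambda>n. nrm (\<lambda>x. (u (x + X n *\<^sub>R e) - u x) / X n - p x)) \<longlonglongrightarrow> 0"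
proof (rule LIMSEQ_I)
  fix r :: real assume "r > 0"
  then have "r / 2 > 0" by simp
  then obtain d where d: "d > 0" "\<And>c. c \<noteq> 0 \<Longrightarrow> norm c < d \<Longrightarrow> nrm (\<lambda>x. p (x + c) - p x) < r / 2"
    using LIM_D[OF nrm_translate_tendsto[OF L(2)] \<open>r / 2 > 0\<close>] by auto
  obtain N where N: "\<And>n. n \<ge> N \<Longrightarrow> norm (X n) < d"
    using LIMSEQ_D[OF X(1) d(1)] by auto
  have "nrm (\<lambda>x. (u (x + X n *\<^sub>R e) - u x) / X n - p x) \<le> r / 2" if "n \<ge> N" for n
  proof (rule nrm_difference_quotient_le[OF L e w X(2)])
    fix s assume "\<bar>s\<bar> \<le> \<bar>X n\<bar>"
    then show "nrm (\<lambda>x. p (x + s *\<^sub>R e) - p x) \<le> r / 2"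
      using N[OF that] d(2)[of "s *\<^sub>R e"] e \<open>r > 0\<close> nonzero_Basis[OF e] by (cases "s = 0") auto
  qed
  then show "\<exists>N. \<forall>n\<ge>N. norm (nrm (\<lambda>x. (u (x + X n *\<^sub>R e) - u x) / X n - p x) - 0) < r"
    using \<open>r > 0\<close> by (intro exI[of _ N]) force
qed

subsection \<open>Lattice operations\<close>

text \<open>For \<open>t\<close> different from 0 the quotient is constant as soon as the step
  cannot change the sign. At \<open>t = 0\<close> it is a one-sided derivative, the only case in
  which \<open>s\<close> enters.\<close>

lemma pos_part_quotient_tendsto:
  fixes t p s :: real
  assumes s: "s = 1 \<or> s = -1"
  shows "(\<lambda>n. (max (t + s / Suc n * p) 0 - max t 0) / (s / Suc n))
    \<longlonglongrightarrow> (if t > 0 then p else if t < 0 then 0 else s * max (s * p) 0)"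
proof (rule tendsto_eventually)
  have "(\<lambda>n. \<bar>s * p\<bar> * (1 / Suc n)) \<longlonglongrightarrow> \<bar>s * p\<bar> * 0"
    by (intro tendsto_mult tendsto_const) (use LIMSEQ_inverse_real_of_nat in \<open>simp add: divide_inverse\<close>)
  then have lim: "\<forall>\<^sub>F n in sequentially. t \<noteq> 0 \<longrightarrow> \<bar>s / Suc n * p\<bar> < \<bar>t\<bar>"
    using order_tendstoD(2)[of _ 0 sequentially "\<bar>t\<bar>"] by (cases "t = 0") (simp_all add: abs_mult)
  have s2: "s \<noteq> 0" "s * s = 1" using s by auto
  show "\<forall>\<^sub>F n in sequentially. (max (t + s / Suc n * p) 0 - max t 0) / (s / Suc n)
      = (if t > 0 then p else if t < 0 then 0 else s * max (s * p) 0)"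
    using lim
  proof eventually_elim
    case (elim n)
    consider "t > 0" | "t < 0" | "t = 0" by linarith
    then show ?case
    proof cases
      case 1
      then have "t + s / Suc n * p > 0"
        using elim by linarith
      then show ?thesis
        using 1 s2 by (simp add: max_def)
    next
      case 2
      then have "t + s / Suc n * p < 0"
        using elim by linarith
      then show ?thesis
        using 2 by (simp add: max_def)
    next
      case 3
      have "max (s / Suc n * p) 0 = max (s * p) 0 / Suc n"
        by (simp add: max_def zero_le_divide_iff divide_le_0_iff)
      then show ?thesis
        using 3 s by auto
    qed
  qed
qed

text \<open>The quotient \<open>a n\<close> of the positive part is compared with
  \<open>b n\<close>, in which the shifted value is replaced by its linearization. The positive part
  is 1-Lipschitz, so the error is at most that of the quotient \<open>d n\<close> of
  \<open>u\<close>; the \<open>b n\<close> converge by domination.\<close>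

lemma wpd_pos_part_signed:
  fixes u :: "'a::euclidean_space \<Rightarrow> real"
  assumes L: "L2 u" "L2 p" and e: "e \<in> Basis" and w: "wpd e u p" and s: "s = 1 \<or> s = -1"
  defines "q \<equiv> \<lambda>x. if u x > 0 then p x else if u x < 0 then 0 else s * max (s * p x) 0"
  shows "wpd e (\<lambda>x. max (u x) 0) q" "L2 q"
proof -
  define X where "X n = s / Suc n" for n
  have "(\<lambda>n. s * inverse (real (Suc n))) \<longlonglongrightarrow> s * 0"
    by (intro tendsto_mult tendsto_const LIMSEQ_inverse_real_of_nat)
  then have X: "X \<longlonglongrightarrow> 0" "X n \<noteq> 0" for n
    using s by (auto simp: X_def[abs_def] divide_inverse)
  have [measurable]: "u \<in> borel_measurable lebesgue" "p \<in> borel_measurable lebesgue"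
    using L by auto
  have qm [measurable]: "q \<in> borel_measurable lebesgue"
    unfolding q_def by measurable
  show Lq: "L2 q"
    by (rule L2_dominated[OF L(2) qm]) (use s in \<open>auto simp: q_def\<close>)
  have Lu: "L2 (\<lambda>x. max (u x) 0)"
    by (rule L2_dominated[OF L(1)]) auto
  define d where "d n x = (u (x + X n *\<^sub>R e) - u x) / X n" for n x
  define a where "a n x = (max (u (x + X n *\<^sub>R e)) 0 - max (u x) 0) / X n" for n x
  define b where "b n x = (max (u x + X n * p x) 0 - max (u x) 0) / X n" for n x
  have Ld: "L2 (d n)" and La: "L2 (a n)" for n
    using L2_cmult[OF L2_diff[OF L2_translate[OF L(1), of "X n *\<^sub>R e"] L(1)], of "inverse (X n)"]
      L2_cmult[OF L2_diff[OF L2_translate[OF Lu, of "X n *\<^sub>R e"] Lu], of "inverse (X n)"]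
    by (simp_all add: d_def[abs_def] a_def[abs_def] divide_inverse mult.commute)
  have lip: "\<bar>max y 0 - max z 0\<bar> \<le> \<bar>y - z\<bar>" for y z :: real
    by (auto simp: max_def)
  have bp: "\<bar>b n x\<bar> \<le> \<bar>p x\<bar>" for n x
    using lip[of "u x + X n * p x" "u x"] X(2)[of n] by (simp add: b_def abs_mult divide_simps mult.commute)
  have bm: "b n \<in> borel_measurable lebesgue" for n
    unfolding b_def[abs_def] by measurable
  have bq: "(\<lambda>n. b n x) \<longlonglongrightarrow> q x" for x
    using pos_part_quotient_tendsto[OF s, of "u x" "p x"] by (simp add: b_def X_def q_def)
  have Lb: "L2 (b n)" for n
    by (rule L2_dominated[OF L(2) bm]) (simp add: bp)
  have "L2 (\<lambda>x. \<bar>p x\<bar>)"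
    by (rule L2_dominated[OF L(2)]) auto
  then have b: "L2_conv b q"
    by (rule L2_dominated_convergence(2)[OF _ bm AE_I2[OF bq] _ qm]) (simp add: bp)
  have "(\<lambda>n. nrm (\<lambda>x. a n x - b n x)) \<longlonglongrightarrow> 0"
  proof (rule nrm_null_mono)
    show "L2_conv d p"
      unfolding d_def by (rule difference_quotients_tendsto[OF L e w X])
    show "AE x in lebesgue. norm (a n x - b n x) \<le> norm (d n x - p x)" for n
    proof (rule AE_I2)
      fix x
      have "\<bar>max (u (x + X n *\<^sub>R e)) 0 - max (u x + X n * p x) 0\<bar> / \<bar>X n\<bar> \<le> \<bar>u (x + X n *\<^sub>R e) - (u x + X n * p x)\<bar> / \<bar>X n\<bar>"
        by (intro divide_right_mono lip) auto
      then show "norm (a n x - b n x) \<le> norm (d n x - p x)"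
        using X(2)[of n] by (simp add: a_def b_def d_def diff_divide_distrib add_divide_distrib flip: abs_divide)
    qed
  qed (intro L2_diff La Lb Ld L)+
  from nrm_null_add[OF _ _ this b] have "L2_conv a q"
    by (simp add: L2_diff La Lb Lq)
  then show "wpd e (\<lambda>x. max (u x) 0) q"
    unfolding a_def by (intro wpd_if_difference_quotients[OF Lu Lq e X])
qed

text \<open>Difference quotients with positive and with negative step give two weak derivatives of the
  positive part, which differ only on the zero set; by uniqueness the derivative vanishes there.\<close>

lemma W_zero_set:
  assumes "W u g"
  shows "AE x in lebesgue. u x = 0 \<longrightarrow> g x = 0"
proof -
  have "\<forall>e\<in>Basis. AE x in lebesgue. u x = 0 \<longrightarrow> g x \<bullet> e = 0"
  proof
    fix e :: 'a assume e: "e \<in> Basis"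
    have L: "L2 u" "L2 (\<lambda>x. g x \<bullet> e)" and w: "wpd e u (\<lambda>x. g x \<bullet> e)"
      using assms e by (auto simp: W_iff L2_component)
    have s: "(1::real) = 1 \<or> (1::real) = -1" "(-1::real) = 1 \<or> (-1::real) = -1" by auto
    show "AE x in lebesgue. u x = 0 \<longrightarrow> g x \<bullet> e = 0"
      using wpd_unique[OF wpd_pos_part_signed(1)[OF L e w s(1)] wpd_pos_part_signed(1)[OF L e w s(2)]
          wpd_pos_part_signed(2)[OF L e w s(1)] wpd_pos_part_signed(2)[OF L e w s(2)]]
      by eventually_elim (auto simp: max_def split: if_splits)
  qed
  then have "AE x in lebesgue. \<forall>e\<in>Basis. u x = 0 \<longrightarrow> g x \<bullet> e = 0"
    by (subst AE_ball_countable) (auto intro: countable_finite)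
  then show ?thesis
    by eventually_elim (auto intro: euclidean_eqI)
qed

lemma W_pos_part:
  assumes "W u g"
  shows "W (\<lambda>x. max (u x) 0) (\<lambda>x. if u x > 0 then g x else 0)"
  unfolding W_iff
proof (intro conjI ballI)
  have L: "L2 u" "L2 g" using assms W_L2 by auto
  have [measurable]: "u \<in> borel_measurable lebesgue" "g \<in> borel_measurable lebesgue"
    using L by auto
  show "L2 (\<lambda>x. max (u x) 0)"
    by (rule L2_dominated[OF L(1)]) auto
  show "L2 (\<lambda>x. if u x > 0 then g x else 0)"
    by (rule L2_dominated[OF L(2)]) auto
  fix e :: 'a assume e: "e \<in> Basis"
  have L': "L2 (\<lambda>x. g x \<bullet> e)" and w: "wpd e u (\<lambda>x. g x \<bullet> e)"
    using assms e by (auto simp: W_iff L2_component)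
  \<comment> \<open>The formulas differ only on the zero set of \<open>u\<close>, where the gradient
    vanishes.\<close>
  have "AE x in lebesgue. (if u x > 0 then g x \<bullet> e else if u x < 0 then 0 else 1 * max (1 * (g x \<bullet> e)) 0) =
      (if u x > 0 then g x else 0) \<bullet> e"
    using W_zero_set[OF assms] by eventually_elim auto
  then show "wpd e (\<lambda>x. max (u x) 0) (\<lambda>x. (if u x > 0 then g x else 0) \<bullet> e)"
    by (rule wpd_cong_AE[OF wpd_pos_part_signed(1)[OF L(1) L' e w], of 1, rotated 2]) auto
qed

lemma W_max:
  assumes "W u g" "W v k"
  shows "W (\<lambda>x. max (u x) (v x)) (\<lambda>x. if v x > u x then k x else g x)"
proof -
  have "W (\<lambda>x. u x + max (v x - u x) 0) (\<lambda>x. g x + (if v x - u x > 0 then k x - g x else 0))"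
    by (intro W_add assms W_pos_part W_diff)
  moreover have "(\<lambda>x. u x + max (v x - u x) 0) = (\<lambda>x. max (u x) (v x))"
    by (auto simp: max_def)
  moreover have "(\<lambda>x. g x + (if v x - u x > 0 then k x - g x else 0)) = (\<lambda>x. if v x > u x then k x else g x)"
    by auto
  ultimately show ?thesis by simp
qed

lemma W_min:
  assumes "W u g" "W v k"
  shows "W (\<lambda>x. min (u x) (v x)) (\<lambda>x. if v x > u x then g x else k x)"
proof -
  have "W (\<lambda>x. v x - max (v x - u x) 0) (\<lambda>x. k x - (if v x - u x > 0 then k x - g x else 0))"
    by (intro W_diff assms W_pos_part)
  moreover have "(\<lambda>x. v x - max (v x - u x) 0) = (\<lambda>x. min (u x) (v x))"
    by (auto simp: max_def min_def)
  moreover have "(\<lambda>x. k x - (if v x - u x > 0 then k x - g x else 0)) = (\<lambda>x. if v x > u x then g x else k x)"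
    by auto
  ultimately show ?thesis by simp
qed

lemma W_abs:
  assumes "W u g"
  shows "W (\<lambda>x. \<bar>u x\<bar>) (\<lambda>x. if - u x > u x then - g x else g x)"
proof -
  have "(\<lambda>x. max (u x) (- u x)) = (\<lambda>x. \<bar>u x\<bar>)"
    by (auto simp: max_def)
  with W_max[OF assms W_minus[OF assms]] show ?thesis by simp
qed

text \<open>The gradient error splits into \<open>g (r n) - k\<close> on the set where
  \<open>u (r n)\<close> is positive, and \<open>k\<close> times the change of that set. The latter
  is treated by convergence almost everywhere, hence the subsequence; where \<open>v\<close>
  vanishes the sets need not converge, but \<open>k\<close> is 0 there.\<close>

lemma W_pos_part_tendsto:
  assumes W: "\<And>n. W (u n) (g n)" "W v k"
    and conv: "L2_conv u v" "L2_conv g k"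
  shows "\<exists>r. strict_mono r \<and> (\<lambda>n. nrm (\<lambda>x. max (u (r n) x) 0 - max (v x) 0)) \<longlonglongrightarrow> 0 \<and>
    (\<lambda>n. nrm (\<lambda>x. (if u (r n) x > 0 then g (r n) x else 0) - (if v x > 0 then k x else 0))) \<longlonglongrightarrow> 0"
proof -
  have L: "L2 (u n)" "L2 (g n)" "L2 v" "L2 k" for n
    using W W_L2 by blast+
  have [measurable]: "u n \<in> borel_measurable lebesgue" "g n \<in> borel_measurable lebesgue"
    "v \<in> borel_measurable lebesgue" "k \<in> borel_measurable lebesgue" for n
    using L by auto
  obtain r where r: "strict_mono r" "AE x in lebesgue. (\<lambda>n. u (r n) x) \<longlonglongrightarrow> v x"
    using L2_conv_AE_subseq[OF L(1,3) conv(1)] by auto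
  have conv': "(\<lambda>n. nrm (\<lambda>x. u (r n) x - v x)) \<longlonglongrightarrow> 0" "(\<lambda>n. nrm (\<lambda>x. g (r n) x - k x)) \<longlonglongrightarrow> 0"
    using conv[THEN LIMSEQ_subseq_LIMSEQ[OF _ r(1)]] by (simp_all add: o_def)
  have Lp: "L2 (\<lambda>x. max (u (r n) x) 0)" "L2 (\<lambda>x. max (v x) 0)" for n
    using W_L2(1)[OF W_pos_part[OF W(1)]] W_L2(1)[OF W_pos_part[OF W(2)]] by auto
  have Lk: "L2 (\<lambda>x. if u (r n) x > 0 then k x else 0)" for n
    by (rule L2_dominated[OF L(4)]) auto
  have Lg: "L2 (\<lambda>x. if u (r n) x > 0 then g (r n) x else 0)" for n
    by (rule L2_dominated[OF L(2)]) auto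
  have Lv: "L2 (\<lambda>x. if v x > 0 then k x else 0)"
    by (rule L2_dominated[OF L(4)]) auto
  have 1: "(\<lambda>n. nrm (\<lambda>x. max (u (r n) x) 0 - max (v x) 0)) \<longlonglongrightarrow> 0"
    by (rule nrm_null_mono[OF L2_diff[OF Lp] L2_diff[OF L(1,3)] conv'(1)]) (auto simp: max_def)
  have 2: "(\<lambda>n. nrm (\<lambda>x. (if u (r n) x > 0 then k x else 0) - (if v x > 0 then k x else 0))) \<longlonglongrightarrow> 0"
  proof (rule L2_dominated_convergence(2))
    show "L2 (\<lambda>x. norm (k x))"
      by (rule L2_dominated[OF L(4)]) auto
    show "AE x in lebesgue. (\<lambda>n. if u (r n) x > 0 then k x else 0) \<longlonglongrightarrow> (if v x > 0 then k x else 0)"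
      using r(2) W_zero_set[OF W(2)]
    proof eventually_elim
      case (elim x)
      consider "v x > 0" | "v x < 0" | "v x = 0" by linarith
      then show ?case
      proof cases
        case 1
        then have "\<forall>\<^sub>F n in sequentially. u (r n) x > 0"
          using elim(1) by (rule order_tendstoD(1)[rotated])
        then have "\<forall>\<^sub>F n in sequentially. (if u (r n) x > 0 then k x else 0) = (if v x > 0 then k x else 0)"
          by eventually_elim (use 1 in simp)
        then show ?thesis
          by (rule tendsto_eventually)
      next
        case 2
        then have "\<forall>\<^sub>F n in sequentially. u (r n) x < 0"
          using elim(1) by (rule order_tendstoD(2)[rotated])
        then have "\<forall>\<^sub>F n in sequentially. (if u (r n) x > 0 then k x else 0) = (if v x > 0 then k x else 0)"
          by eventually_elim (use 2 in simp)
        then show ?thesis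
          by (rule tendsto_eventually)
      next
        case 3
        then show ?thesis
          using elim(2) by (simp cong: if_cong)
      qed
    qed
  qed auto
  have 3: "(\<lambda>n. nrm (\<lambda>x. (if u (r n) x > 0 then g (r n) x else 0) - (if u (r n) x > 0 then k x else 0))) \<longlonglongrightarrow> 0"
    by (rule nrm_null_mono[OF _ _ conv'(2)]) (auto intro!: L2_diff L Lk Lg)
  have "(\<lambda>n. nrm (\<lambda>x. (if u (r n) x > 0 then g (r n) x else 0) - (if v x > 0 then k x else 0))) \<longlonglongrightarrow> 0"
    using nrm_null_add[OF L2_diff[OF Lg Lk] L2_diff[OF Lk Lv] 3 2] by simp
  with r 1 show ?thesis by blast
qed

text \<open>Translating by more than the diameter of the support makes \<open>u\<close> orthogonal to its translate.\<close>

lemma Poincare: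
  fixes u :: "'a::euclidean_space \<Rightarrow> real"
  assumes W: "W u g" and u: "AE x in lebesgue. x \<notin> ball 0 R \<longrightarrow> u x = 0" and R: "R \<ge> 0"
  shows "nrm u \<le> (2 * R + 1) * nrm g"
proof -
  obtain e :: 'a where e: "e \<in> Basis"
    using nonempty_Basis by blast
  define v where "v x = (if x \<in> ball 0 R then u x else 0)" for x
  \<comment> \<open>Larger than the diameter of the ball, so a point and its shift by
    \<open>h\<close> along a unit vector never both lie inside.\<close>
  define h where "h = 2 * R + 1"
  have uv: "AE x in lebesgue. u x = v x"
    using u by eventually_elim (auto simp: v_def)
  have Wv: "W v g"
    by (rule W_cong_AE[OF W uv]) auto
  then have L: "L2 v" "L2 (\<lambda>x. g x \<bullet> e)" and w: "wpd e v (\<lambda>x. g x \<bullet> e)" and Lg: "L2 g"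
    using e by (auto simp: W_iff L2_component)
  have "v (x + h *\<^sub>R e) = 0 \<or> v x = 0" for x
    using norm_triangle_ineq4[of "x + h *\<^sub>R e" x] e R by (auto simp: v_def h_def)
  then have "(\<lambda>x. v (x + h *\<^sub>R e) \<bullet> v x) = (\<lambda>x. 0)"
    by (intro ext) (metis inner_zero_left inner_zero_right)
  then have z: "ip (\<lambda>x. v (x + h *\<^sub>R e)) v = 0"
    by (simp add: ip_def)
  have Lh: "L2 (\<lambda>x. v (x + h *\<^sub>R e))"
    by (rule L2_translate[OF L(1)])
  have "(nrm (\<lambda>x. v (x + h *\<^sub>R e) - v x))\<^sup>2 = 2 * (nrm v)\<^sup>2"
    unfolding ip_self[symmetric] using L Lh z
    by (simp add: ip_diff_left ip_diff_right L2_diff ip_commute[of v "\<lambda>x. v (x + h *\<^sub>R e)"])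
      (simp add: ip_self nrm_translate)
  then have "(nrm v)\<^sup>2 \<le> (nrm (\<lambda>x. v (x + h *\<^sub>R e) - v x))\<^sup>2"
    by simp
  then have "nrm v \<le> nrm (\<lambda>x. v (x + h *\<^sub>R e) - v x)"
    by (rule power2_le_imp_le) simp
  also have "\<dots> \<le> \<bar>h\<bar> * nrm (\<lambda>x. g x \<bullet> e)"
    by (rule nrm_translate_diff_le[OF L e w])
  also have "\<dots> \<le> h * nrm g"
    using R nrm_component[OF Lg e] by (auto simp: h_def intro!: mult_left_mono)
  also have "nrm v = nrm u"
    using uv by (intro nrm_cong_AE) auto
  finally show ?thesis by (simp add: h_def)
qed

subsection \<open>Capacity\<close>

text \<open>For a weak gradient \<open>g\<close> of \<open>u\<close>, the norm of the pair is the
  norm of \<open>u\<close> in \<open>H1\<close>. Triangle inequality and completeness are thus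
  inherited from square integrable functions with values in a product space.\<close>

abbreviation pr :: "('a \<Rightarrow> 'b) \<Rightarrow> ('a \<Rightarrow> 'c) \<Rightarrow> 'a \<Rightarrow> 'b \<times> 'c" where
  "pr u g \<equiv> \<lambda>x. (u x, g x)"

lemma L2_Pair:
  assumes "L2 u" "L2 g"
  shows "L2 (pr u g)"
proof -
  have [measurable]: "u \<in> borel_measurable lebesgue" "g \<in> borel_measurable lebesgue"
    using assms by auto
  have "(pr u g) \<in> borel_measurable lebesgue"
    by (simp add: borel_measurable_Pair)
  moreover have "integrable lebesgue (\<lambda>x. (norm (u x))\<^sup>2 + (norm (g x))\<^sup>2)"
    using assms by (intro Bochner_Integration.integrable_add L2_integrable)
  ultimately show ?thesis
    by (simp add: L2_def norm_Pair)
qed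

lemma nrm_Pair_power2:
  assumes "L2 u" "L2 g"
  shows "(nrm (pr u g))\<^sup>2 = (nrm u)\<^sup>2 + (nrm g)\<^sup>2"
  using assms by (simp add: nrm_power2 norm_Pair L2_integrable)

lemma nrm_le_nrm_Pair:
  assumes "L2 u" "L2 g"
  shows "nrm u \<le> nrm (pr u g)" "nrm g \<le> nrm (pr u g)"
  by (rule power2_le_imp_le; simp add: nrm_Pair_power2[OF assms])+

lemma nrm_Pair_le:
  assumes "L2 u" "L2 g"
  shows "nrm (pr u g) \<le> nrm u + nrm g"
  by (rule power2_le_imp_le) (simp_all add: nrm_Pair_power2[OF assms] power2_sum)

lemma nrm_Pair_diff_tendsto:
  assumes "\<And>n. L2 (u n)" "\<And>n. L2 (g n)" "L2 v" "L2 k"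
    "L2_conv u v" "L2_conv g k"
  shows "(\<lambda>n. nrm (\<lambda>x. (u n x, g n x) - (v x, k x))) \<longlonglongrightarrow> 0"
proof (rule tendsto_null_bound)
  show "norm (nrm (\<lambda>x. (u n x, g n x) - (v x, k x)) - 0) \<le> nrm (\<lambda>x. u n x - v x) + nrm (\<lambda>x. g n x - k x)" for n
    using nrm_Pair_le[OF L2_diff[OF assms(1,3)] L2_diff[OF assms(2,4)]] by simp
  show "(\<lambda>n. nrm (\<lambda>x. u n x - v x) + nrm (\<lambda>x. g n x - k x)) \<longlonglongrightarrow> 0"
    using tendsto_add[OF assms(5,6)] by simp
qed

lemma W_complete:
  assumes W: "\<And>n. W (u n) (g n)"
    and Cau: "\<And>e. e > 0 \<Longrightarrow> \<exists>N. \<forall>m\<ge>N. \<forall>n\<ge>N. nrm (\<lambda>x. pr (u m) (g m) x - pr (u n) (g n) x) < e"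
  shows "\<exists>v k. W v k \<and> L2_conv u v \<and> L2_conv g k"
proof -
  have L: "L2 (u n)" "L2 (g n)" for n
    using W W_L2 by blast+
  obtain z where z: "L2 z" "(\<lambda>n. nrm (\<lambda>x. (u n x, g n x) - z x)) \<longlonglongrightarrow> 0"
    using L2_complete[of "\<lambda>n x. (u n x, g n x)", OF L2_Pair[OF L] Cau] by blast
  define v k where "v x = fst (z x)" and "k x = snd (z x)" for x
  have "v \<in> borel_measurable lebesgue" "k \<in> borel_measurable lebesgue"
    unfolding v_def[abs_def] k_def[abs_def]
    by (auto intro!: measurable_compose[OF L2_measurable[OF z(1)]] borel_measurable_continuous_onI continuous_intros)
  moreover have "norm (v x) \<le> norm (z x)" "norm (k x) \<le> norm (z x)" for x
    using norm_fst_le[of "v x" "k x"] norm_snd_le[of "k x" "v x"] by (simp_all add: v_def k_def)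
  ultimately have Lv: "L2 v" "L2 k"
    by (auto intro!: L2_dominated[OF z(1)] AE_I2)
  have zvk: "z x = (v x, k x)" for x
    by (simp add: v_def k_def)
  have D: "L2 (\<lambda>x. u n x - v x)" "L2 (\<lambda>x. g n x - k x)" for n
    using L Lv by (auto intro: L2_diff)
  have 1: "L2_conv u v"
    by (rule tendsto_null_bound[OF _ z(2)]) (use nrm_le_nrm_Pair(1)[OF D] zvk in simp)
  have 2: "L2_conv g k"
    by (rule tendsto_null_bound[OF _ z(2)]) (use nrm_le_nrm_Pair(2)[OF D] zvk in simp)
  show ?thesis
    using W_limit[OF W Lv 1 2] 1 2 by blast
qed

lemma weak_grad_W: "u \<in> H1 UNIV \<Longrightarrow> W u (weak_grad UNIV u)"
  unfolding H1_def W_def weak_grad_def L2_on_UNIV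
  using someI_ex[of "is_weak_gradient UNIV u"] by auto

lemma H1_norm_W:
  assumes "W u g"
  shows "H1_norm UNIV u = nrm (pr u g)"
proof -
  have "W u (weak_grad UNIV u)"
    using assms by (intro weak_grad_W) (auto simp: H1_UNIV_iff)
  from W_unique[OF this assms] have "AE x in lebesgue. norm (weak_grad UNIV u x) = norm (g x)"
    by eventually_elim simp
  then have eq: "nrm (weak_grad UNIV u) = nrm g"
    by (rule nrm_cong_AE)
  have "H1_norm UNIV u = sqrt ((nrm u)\<^sup>2 + (nrm (weak_grad UNIV u))\<^sup>2)"
    by (simp add: H1_norm_def set_lebesgue_integral_def nrm_power2)
  also have "\<dots> = nrm (pr u g)"
    using nrm_Pair_power2[OF W_L2[OF assms]] eq by (metis nrm_nonneg real_sqrt_abs abs_of_nonneg)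
  finally show ?thesis .
qed

lemma capacity_le:
  assumes "W v g" "open N" "A \<subseteq> N" "AE x in lebesgue. x \<in> N \<longrightarrow> 1 \<le> v x"
  shows "capacity A \<le> ennreal ((nrm (pr v g))\<^sup>2)"
  unfolding capacity_def
  by (rule INF_lower2[of v]) (use assms in \<open>auto simp: H1_UNIV_iff H1_norm_W\<close>)

text \<open>Passing to the absolute value keeps the \<open>H1\<close> norm and makes the competitor
  nonnegative everywhere, so that competitors can be added without losing the lower bound 1.
  Thresholds are written as squares in order to compare norms.\<close>

lemma capacity_lessE:
  assumes "capacity A < ennreal (c\<^sup>2)" "c > 0"
  obtains v g N where "W v g" "open N" "A \<subseteq> N" "AE x in lebesgue. x \<in> N \<longrightarrow> 1 \<le> v x"
    "\<forall>x. 0 \<le> v x" "nrm (pr v g) < c"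
proof -
  from assms(1) obtain u N where u: "u \<in> H1 UNIV" "open N" "A \<subseteq> N" "AE x in lebesgue. x \<in> N \<longrightarrow> 1 \<le> u x"
    "ennreal ((H1_norm UNIV u)\<^sup>2) < ennreal (c\<^sup>2)"
    unfolding capacity_def INF_less_iff by blast
  obtain g where g: "W u g"
    using u(1) by (auto simp: H1_UNIV_iff)
  define k where "k x = (if - u x > u x then - g x else g x)" for x
  have W: "W (\<lambda>x. \<bar>u x\<bar>) k"
    unfolding k_def by (rule W_abs[OF g])
  have "(nrm (pr u g))\<^sup>2 < c\<^sup>2"
    using u(5) g by (simp add: H1_norm_W ennreal_less_iff)
  then have "nrm (pr u g) < c"
    using assms(2) by (simp add: power_less_imp_less_base)
  moreover have "nrm (\<lambda>x. (\<bar>u x\<bar>, k x)) = nrm (pr u g)"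
    by (rule nrm_cong_AE) (simp add: k_def norm_Pair)
  moreover have "AE x in lebesgue. x \<in> N \<longrightarrow> 1 \<le> \<bar>u x\<bar>"
    using u(4) by eventually_elim auto
  ultimately show thesis
    using that[OF W u(2,3)] by simp
qed

lemma capacity_mono: "A \<subseteq> B \<Longrightarrow> capacity A \<le> capacity B"
  unfolding capacity_def by (rule INF_superset_mono) auto

text \<open>The sum of competitors is a competitor, and the triangle inequality bounds its norm.
  This gives countable subadditivity of the square root of capacity, a weaker estimate than
  subadditivity of capacity, but one that suits geometric series.\<close>

lemma capacity_UN:
  assumes A: "\<And>n. capacity (A n) < ennreal ((c n)\<^sup>2)" and c: "\<And>n. c n > 0" "summable c"
  shows "capacity (\<Union>n. A n) \<le> ennreal ((suminf c)\<^sup>2)"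
proof -
  define Q where "Q n v g N \<longleftrightarrow> W v g \<and> open N \<and> A n \<subseteq> N \<and> (AE x in lebesgue. x \<in> N \<longrightarrow> 1 \<le> v x) \<and>
      (\<forall>x. 0 \<le> v x) \<and> nrm (pr v g) < c n" for n v g N
  have "\<exists>v g N. Q n v g N" for n
    unfolding Q_def by (rule capacity_lessE[OF A[of n] c(1)]) blast
  then obtain v g N where "\<And>n. Q n (v n) (g n) (N n)"
    by metis
  then have W: "\<And>n. W (v n) (g n)" and N: "\<And>n. open (N n)" "\<And>n. A n \<subseteq> N n"
    and v1: "\<And>n. AE x in lebesgue. x \<in> N n \<longrightarrow> 1 \<le> v n x"
    and v0: "\<And>n x. 0 \<le> v n x" and vc: "\<And>n. nrm (pr (v n) (g n)) < c n"
    unfolding Q_def by auto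
  have L: "L2 (pr (v n) (g n))" for n
    using W_L2[OF W[of n]] by (rule L2_Pair)
  define s t where "s m x = (\<Sum>n<m. v n x)" and "t m x = (\<Sum>n<m. g n x)" for m x
  have Ws: "W (s m) (t m)" for m
  proof (induction m)
    case 0
    then show ?case by (simp add: s_def[abs_def] t_def[abs_def] W_zero)
  next
    case (Suc m)
    then show ?case
      using W_add[OF Suc W[of m]] by (simp add: s_def[abs_def] t_def[abs_def])
  qed
  \<comment> \<open>General finite index sets cover both the blocks in the Cauchy criterion and the
    partial sums in the final norm bound.\<close>
  have sum_le: "L2 (\<lambda>x. (\<Sum>n\<in>I. v n x, \<Sum>n\<in>I. g n x)) \<and> nrm (\<lambda>x. (\<Sum>n\<in>I. v n x, \<Sum>n\<in>I. g n x)) \<le> sum c I"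
    if "finite I" for I :: "nat set"
    using that
  proof induction
    case empty
    then show ?case by (simp add: zero_prod_def[symmetric])
  next
    case (insert i I)
    have eq: "(\<lambda>x. (\<Sum>n\<in>insert i I. v n x, \<Sum>n\<in>insert i I. g n x))
        = (\<lambda>x. (v i x, g i x) + (\<Sum>n\<in>I. v n x, \<Sum>n\<in>I. g n x))"
      using insert by simp
    show ?case
      unfolding eq using L2_add[OF L[of i] conjunct1[OF insert.IH]]
        nrm_triangle[OF L[of i] conjunct1[OF insert.IH]] insert vc[of i] by simp
  qed
  have "\<exists>M. \<forall>m\<ge>M. \<forall>n\<ge>M. nrm (\<lambda>x. pr (s m) (t m) x - pr (s n) (t n) x) < e" if "e > 0" for e
  proof -
    obtain M where M: "\<And>m n. m \<ge> M \<Longrightarrow> norm (sum c {m..<n}) < e"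
      using c(2) \<open>e > 0\<close> unfolding summable_Cauchy by blast
    have *: "nrm (\<lambda>x. pr (s m) (t m) x - pr (s n) (t n) x) < e" if "n \<ge> M" "n \<le> m" for m n
    proof -
      have "{..<m} - {..<n} = {n..<m}"
        by auto
      then have "s m x - s n x = (\<Sum>i\<in>{n..<m}. v i x)" "t m x - t n x = (\<Sum>i\<in>{n..<m}. g i x)" for x
        using that by (simp_all add: s_def t_def flip: sum_diff)
      then have "nrm (\<lambda>x. pr (s m) (t m) x - pr (s n) (t n) x) \<le> sum c {n..<m}"
        using sum_le[of "{n..<m}"] by simp
      then show ?thesis
        using M[OF that(1), of m] by simp
    qed
    show ?thesis
    proof (intro exI[of _ M] allI impI)
      fix m n assume "m \<ge> M" "n \<ge> M"
      then show "nrm (\<lambda>x. pr (s m) (t m) x - pr (s n) (t n) x) < e"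
        using *[of n m] *[of m n] nrm_minus_commute[of "\<lambda>x. (s m x, t m x)" "\<lambda>x. (s n x, t n x)"]
        by (cases "n \<le> m") auto
    qed
  qed
  from W_complete[OF Ws this] obtain w k where w: "W w k"
    "L2_conv s w" "L2_conv t k"
    by blast
  have Ls: "L2 (s n)" "L2 (t n)" for n
    using W_L2[OF Ws[of n]] by auto
  note Lw = W_L2[OF w(1)]
  have lim: "(\<lambda>n. nrm (pr (s n) (t n))) \<longlonglongrightarrow> nrm (pr w k)"
    by (rule nrm_tendsto[OF L2_Pair[OF Ls] L2_Pair[OF Lw] nrm_Pair_diff_tendsto[OF Ls Lw w(2,3)]])
  have "nrm (pr (s n) (t n)) \<le> suminf c" for n
    using sum_le[of "{..<n}"] sum_le_suminf[OF c(2), of "{..<n}"] c(1)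
    by (force simp: s_def t_def less_imp_le intro: order_trans)
  then have le: "nrm (pr w k) \<le> suminf c"
    by (intro LIMSEQ_le_const2[OF lim]) auto
  obtain r where r: "strict_mono r" "AE x in lebesgue. (\<lambda>n. s (r n) x) \<longlonglongrightarrow> w x"
    using L2_conv_AE_subseq[OF Ls(1) Lw(1) w(2)] by blast
  have "AE x in lebesgue. \<forall>n. x \<in> N n \<longrightarrow> 1 \<le> v n x"
    using v1 by (simp add: AE_all_countable)
  with r(2) have "AE x in lebesgue. x \<in> (\<Union>n. N n) \<longrightarrow> 1 \<le> w x"
  proof eventually_elim
    case (elim x)
    show ?case
    proof
      assume "x \<in> (\<Union>n. N n)"
      then obtain n where n: "x \<in> N n" by auto
      have "1 \<le> s (r m) x" if "m \<ge> Suc n" for m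
      proof -
        have "n < r m"
          using seq_suble[OF r(1), of m] that by simp
        then have "v n x \<le> s (r m) x"
          unfolding s_def by (intro member_le_sum) (auto simp: v0)
        then show ?thesis
          using elim(2) n by force
      qed
      then show "1 \<le> w x"
        by (intro LIMSEQ_le_const[OF elim(1)]) auto
    qed
  qed
  then have "capacity (\<Union>n. A n) \<le> ennreal ((nrm (pr w k))\<^sup>2)"
    using N by (intro capacity_le[OF w(1), of "\<Union>n. N n"]) (auto intro: open_UN)
  also have "\<dots> \<le> ennreal ((suminf c)\<^sup>2)"
    using le by (intro ennreal_leI power_mono) auto
  finally show ?thesis .
qed

lemma capacity_Un:
  assumes "capacity A < ennreal (a\<^sup>2)" "a > 0" "capacity B < ennreal (b\<^sup>2)" "b > 0"
  shows "capacity (A \<union> B) < ennreal ((a + b)\<^sup>2)"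
proof -
  obtain u g M where u: "W u g" "open M" "A \<subseteq> M" "AE x in lebesgue. x \<in> M \<longrightarrow> 1 \<le> u x"
    "\<forall>x. 0 \<le> u x" "nrm (pr u g) < a"
    by (rule capacity_lessE[OF assms(1,2)])
  obtain v k N where v: "W v k" "open N" "B \<subseteq> N" "AE x in lebesgue. x \<in> N \<longrightarrow> 1 \<le> v x"
    "\<forall>x. 0 \<le> v x" "nrm (pr v k) < b"
    by (rule capacity_lessE[OF assms(3,4)])
  have "AE x in lebesgue. x \<in> M \<union> N \<longrightarrow> 1 \<le> u x + v x"
    using u(4) v(4)
  proof eventually_elim
    case (elim x)
    then show ?case
      using u(5)[rule_format, of x] v(5)[rule_format, of x] by auto
  qed
  then have "capacity (A \<union> B) \<le> ennreal ((nrm (\<lambda>x. (u x + v x, g x + k x)))\<^sup>2)"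
    using u v by (intro capacity_le[OF W_add[OF u(1) v(1)], of "M \<union> N"]) auto
  also have "\<dots> < ennreal ((a + b)\<^sup>2)"
  proof -
    have "nrm (\<lambda>x. (u x + v x, g x + k x)) < a + b"
      using nrm_triangle[OF L2_Pair[OF W_L2[OF u(1)]] L2_Pair[OF W_L2[OF v(1)]]] u(6) v(6) by simp
    then show ?thesis
      by (intro ennreal_lessI power_strict_mono) (use assms in auto)
  qed
  finally show ?thesis .
qed

lemma capacity_eq_0I:
  assumes "\<And>c. c > 0 \<Longrightarrow> capacity A \<le> ennreal (c\<^sup>2)"
  shows "capacity A = 0"
proof -
  have "capacity A \<le> 0"
  proof (rule ennreal_le_epsilon)
    show "capacity A \<le> 0 + ennreal e" if "e > 0" for e
      using assms[of "sqrt e"] that by simp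
  qed
  then show ?thesis by simp
qed

lemma capacity_0_less: "capacity A = 0 \<Longrightarrow> c > 0 \<Longrightarrow> capacity A < ennreal (c\<^sup>2)"
  by simp

lemma capacity_UN_0:
  assumes "\<And>n::nat. capacity (A n) = 0"
  shows "capacity (\<Union>n. A n) = 0"
proof (rule capacity_eq_0I)
  fix c :: real assume "c > 0"
  have s: "(\<lambda>n. c / 2 * (1 / 2) ^ n) sums (c / 2 * (1 / (1 - 1 / 2)))"
    by (intro sums_mult geometric_sums) auto
  then have "suminf (\<lambda>n. c / 2 * (1 / 2) ^ n) = c"
    by (simp add: sums_iff)
  then show "capacity (\<Union>n. A n) \<le> ennreal (c\<^sup>2)"
    using capacity_UN[of A "\<lambda>n. c / 2 * (1 / 2) ^ n"] assms \<open>c > 0\<close> s by (simp add: sums_iff)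
qed

lemma capacity_Un_0:
  assumes "capacity A = 0" "capacity B = 0"
  shows "capacity (A \<union> B) = 0"
proof (rule capacity_eq_0I)
  fix c :: real assume "c > 0"
  then show "capacity (A \<union> B) \<le> ennreal (c\<^sup>2)"
    using capacity_Un[of A "c / 2" B "c / 2"] assms by simp
qed

text \<open>Competitors of arbitrarily small norm dominate the indicator of a set containing
  \<open>A\<close>, which is therefore null.\<close>

lemma capacity_0_AE:
  fixes A :: "'a::euclidean_space set"
  assumes "capacity A = 0"
  shows "AE x in lebesgue. x \<notin> A"
proof -
  define Q where "Q n v g N \<longleftrightarrow> W v g \<and> open N \<and> A \<subseteq> N \<and> (AE x in lebesgue. x \<in> N \<longrightarrow> 1 \<le> v x) \<and>
      nrm (pr v g) < 1 / Suc n" for n v g N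
  have "\<exists>v g N. Q n v g N" for n
  proof -
    have p: "0 < 1 / real (Suc n)" by simp
    show ?thesis
      unfolding Q_def by (rule capacity_lessE[OF capacity_0_less[OF assms p] p]) blast
  qed
  then obtain v g N where "\<And>n. Q n (v n) (g n) (N n)"
    by metis
  then have W: "\<And>n. W (v n) (g n)" and N: "\<And>n. open (N n)" "\<And>n. A \<subseteq> N n"
    and v1: "\<And>n. AE x in lebesgue. x \<in> N n \<longrightarrow> 1 \<le> v n x"
    and vc: "\<And>n. nrm (pr (v n) (g n)) < 1 / Suc n"
    unfolding Q_def by auto
  \<comment> \<open>The set \<open>A\<close> need not be measurable; the intersection of its open
    neighbourhoods is a Borel set that contains it.\<close>
  define f :: "'a \<Rightarrow> real" where "f = indicator (\<Inter>n. N n)"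
  have "(\<Inter>n. N n) \<in> sets borel"
    using N(1) by (intro sets.countable_INT) auto
  then have fm: "f \<in> borel_measurable lebesgue"
    unfolding f_def by (intro borel_measurable_indicator) auto
  have dom: "AE x in lebesgue. norm (f x) \<le> norm (v n x)" for n
    using v1[of n] by eventually_elim (auto simp: f_def indicator_def)
  have Lf: "L2 f"
    by (rule L2_dominated[OF W_L2(1)[OF W[of 0]] fm dom])
  have "nrm f \<le> 1 / Suc n" for n
    using nrm_mono[OF W_L2(1)[OF W[of n]] Lf dom] nrm_le_nrm_Pair(1)[OF W_L2[OF W[of n]]] vc[of n] by linarith
  then have "nrm f \<le> 0"
    by (intro LIMSEQ_le_const[OF LIMSEQ_inverse_real_of_nat]) (auto simp: inverse_eq_divide)
  then have "AE x in lebesgue. f x = 0"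
    using nrm_eq_0_iff[OF Lf] nrm_nonneg[of f] by linarith
  then show ?thesis
    by eventually_elim (use N(2) in \<open>auto simp: f_def indicator_def split: if_splits\<close>)
qed

subsection \<open>Quasi-continuous functions\<close>

lemma quasi_continuousI:
  assumes "\<And>c. c > 0 \<Longrightarrow> \<exists>G. open G \<and> capacity G < ennreal (c\<^sup>2) \<and> continuous_on (- G) w"
  shows "quasi_continuous w"
  unfolding quasi_continuous_def
proof (intro allI impI)
  fix e :: real assume "e > 0"
  then show "\<exists>G. open G \<and> capacity G < ennreal e \<and> continuous_on (- G) w"
    using assms[of "sqrt e"] by simp
qed

lemma quasi_continuousE:
  assumes "quasi_continuous w" "c > 0"
  obtains G where "open G" "capacity G < ennreal (c\<^sup>2)" "continuous_on (- G) w"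
  using assms unfolding quasi_continuous_def by (metis zero_less_power)

lemma quasi_continuous_compose2:
  assumes "quasi_continuous w1" "quasi_continuous w2" and F: "continuous_on UNIV (\<lambda>(a, b). F a b)"
  shows "quasi_continuous (\<lambda>x. F (w1 x) (w2 x))"
proof (rule quasi_continuousI)
  fix c :: real assume "c > 0"
  then have c2: "c / 2 > 0" by simp
  obtain G1 where G1: "open G1" "capacity G1 < ennreal ((c / 2)\<^sup>2)" "continuous_on (- G1) w1"
    by (rule quasi_continuousE[OF assms(1) c2])
  obtain G2 where G2: "open G2" "capacity G2 < ennreal ((c / 2)\<^sup>2)" "continuous_on (- G2) w2"
    by (rule quasi_continuousE[OF assms(2) c2])
  have "continuous_on (- (G1 \<union> G2)) (\<lambda>x. (\<lambda>(a, b). F a b) (w1 x, w2 x))"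
    by (rule continuous_on_compose2[OF F])
      (auto intro!: continuous_on_Pair continuous_on_subset[OF G1(3)] continuous_on_subset[OF G2(3)])
  moreover have "capacity (G1 \<union> G2) < ennreal (c\<^sup>2)"
    using capacity_Un[OF G1(2) c2 G2(2) c2] by simp
  ultimately show "\<exists>G. open G \<and> capacity G < ennreal (c\<^sup>2) \<and> continuous_on (- G) (\<lambda>x. F (w1 x) (w2 x))"
    using G1(1) G2(1) by (intro exI[of _ "G1 \<union> G2"]) auto
qed

text \<open>The complement is a sublevel set of a function continuous on a closed set. With small
  \<open>G\<close>, this is the source of openness for superlevel sets of quasi-continuous
  functions.\<close>

lemma open_superlevel_Un:
  fixes f :: "'a::topological_space \<Rightarrow> real"
  assumes "open G" "continuous_on (- G) f"
  shows "open ({x. f x > a} \<union> G)"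
proof -
  have "closed (f -` {..a} \<inter> - G)"
    using continuous_closed_preimage[OF assms(2), of "{..a}"] assms(1) by (simp add: closed_Compl Int_commute)
  moreover have "- (f -` {..a} \<inter> - G) = {x. f x > a} \<union> G"
    by auto
  ultimately show ?thesis
    by (metis open_Compl)
qed

section \<open>The space \<open>H10\<close> and its lattice operations\<close>

lemma H10E:
  assumes "u \<in> H10 \<Omega>"
  obtains g w where "W u g" "quasi_continuous w" "AE x in lebesgue. w x = u x"
    "capacity {x \<in> - \<Omega>. w x \<noteq> 0} = 0"
  using assms by (auto simp: H10_def H1_UNIV_iff qc_representative_def quasi_everywhere_on_def)

lemma H10I:
  assumes "W u g" "quasi_continuous w" "AE x in lebesgue. w x = u x" "capacity {x \<in> - \<Omega>. w x \<noteq> 0} = 0"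
  shows "u \<in> H10 \<Omega>"
  using assms by (auto simp: H10_def H1_UNIV_iff qc_representative_def quasi_everywhere_on_def)

lemma H10_W: "u \<in> H10 \<Omega> \<Longrightarrow> W u (weak_grad UNIV u)"
  by (rule weak_grad_W) (simp add: H10_def)

lemma H10_L2: "u \<in> H10 \<Omega> \<Longrightarrow> L2 u"
  using H10_W W_L2 by blast

lemma H10_AE_zero:
  assumes "u \<in> H10 \<Omega>"
  shows "AE x in lebesgue. x \<notin> \<Omega> \<longrightarrow> u x = 0"
proof -
  obtain g w where w: "AE x in lebesgue. w x = u x" "capacity {x \<in> - \<Omega>. w x \<noteq> 0} = 0"
    by (rule H10E[OF assms])
  show ?thesis
    using w(1) capacity_0_AE[OF w(2)] by eventually_elim auto
qed

lemma H10_mono: "\<Omega> \<subseteq> \<Omega>' \<Longrightarrow> u \<in> H10 \<Omega> \<Longrightarrow> u \<in> H10 \<Omega>'"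
proof -
  assume sub: "\<Omega> \<subseteq> \<Omega>'" and u: "u \<in> H10 \<Omega>"
  obtain g w where w: "W u g" "quasi_continuous w" "AE x in lebesgue. w x = u x"
    "capacity {x \<in> - \<Omega>. w x \<noteq> 0} = 0"
    by (rule H10E[OF u])
  have "capacity {x \<in> - \<Omega>'. w x \<noteq> 0} \<le> capacity {x \<in> - \<Omega>. w x \<noteq> 0}"
    using sub by (intro capacity_mono) auto
  then show ?thesis
    using w by (intro H10I[OF w(1-3)]) simp
qed

lemma H10_cong_AE:
  assumes "u \<in> H10 \<Omega>" "AE x in lebesgue. u x = v x"
  shows "v \<in> H10 \<Omega>"
proof -
  obtain g w where w: "W u g" "quasi_continuous w" "AE x in lebesgue. w x = u x"
    "capacity {x \<in> - \<Omega>. w x \<noteq> 0} = 0"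
    by (rule H10E[OF assms(1)])
  have "W v g"
    by (rule W_cong_AE[OF w(1) assms(2)]) auto
  moreover have "AE x in lebesgue. w x = v x"
    using w(3) assms(2) by eventually_elim simp
  ultimately show ?thesis
    using w by (intro H10I)
qed

text \<open>The condition \<open>zero\<close> concerns possible values of the two representatives
  off their exceptional sets. Two different domains are allowed, so that a function on a large set
  can be cut down by one on a small set.\<close>

lemma H10_compose2:
  assumes u: "u \<in> H10 \<Omega>1" and v: "v \<in> H10 \<Omega>2" and F: "continuous_on UNIV (\<lambda>(a, b). F a b)"
    and W: "W (\<lambda>x. F (u x) (v x)) k"
    and zero: "\<And>x a b. x \<notin> \<Omega> \<Longrightarrow> (x \<notin> \<Omega>1 \<Longrightarrow> a = 0) \<Longrightarrow> (x \<notin> \<Omega>2 \<Longrightarrow> b = 0) \<Longrightarrow> F a b = 0"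
  shows "(\<lambda>x. F (u x) (v x)) \<in> H10 \<Omega>"
proof -
  obtain g1 w1 where w1: "W u g1" "quasi_continuous w1" "AE x in lebesgue. w1 x = u x"
    "capacity {x \<in> - \<Omega>1. w1 x \<noteq> 0} = 0"
    by (rule H10E[OF u])
  obtain g2 w2 where w2: "W v g2" "quasi_continuous w2" "AE x in lebesgue. w2 x = v x"
    "capacity {x \<in> - \<Omega>2. w2 x \<noteq> 0} = 0"
    by (rule H10E[OF v])
  have "{x \<in> - \<Omega>. F (w1 x) (w2 x) \<noteq> 0} \<subseteq> {x \<in> - \<Omega>1. w1 x \<noteq> 0} \<union> {x \<in> - \<Omega>2. w2 x \<noteq> 0}"
    using zero by auto
  from capacity_mono[OF this] have "capacity {x \<in> - \<Omega>. F (w1 x) (w2 x) \<noteq> 0} \<le> 0"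
    unfolding capacity_Un_0[OF w1(4) w2(4)] .
  then have z: "capacity {x \<in> - \<Omega>. F (w1 x) (w2 x) \<noteq> 0} = 0"
    by simp
  have "AE x in lebesgue. F (w1 x) (w2 x) = F (u x) (v x)"
    using w1(3) w2(3) by eventually_elim simp
  then show ?thesis
    by (rule H10I[OF W quasi_continuous_compose2[OF w1(2) w2(2) F] _ z])
qed

lemma H10_add: "u \<in> H10 \<Omega> \<Longrightarrow> v \<in> H10 \<Omega> \<Longrightarrow> (\<lambda>x. u x + v x) \<in> H10 \<Omega>"
  by (rule H10_compose2[of u \<Omega> v \<Omega> "\<lambda>a b. a + b"])
    (auto intro!: continuous_intros W_add H10_W simp: split_beta)

lemma H10_cmult: "u \<in> H10 \<Omega> \<Longrightarrow> (\<lambda>x. c * u x) \<in> H10 \<Omega>"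
  by (rule H10_compose2[of u \<Omega> u \<Omega> "\<lambda>a b. c * a"])
    (auto intro!: continuous_intros W_scaleR H10_W simp: split_beta)

lemma capacity_empty [simp]: "capacity {} = 0"
  using capacity_le[OF W_zero, of "{}" "{}"] by (simp flip: zero_prod_def)

lemma H10_zero: "(\<lambda>x. 0) \<in> H10 \<Omega>"
proof (rule H10I[OF W_zero])
  show "quasi_continuous (\<lambda>x. 0)"
    by (rule quasi_continuousI) (auto intro!: exI[of _ "{}"])
  show "capacity {x \<in> - \<Omega>. (0::real) \<noteq> 0} = 0"
    by simp
qed auto

lemma H10_diff: "u \<in> H10 \<Omega> \<Longrightarrow> v \<in> H10 \<Omega> \<Longrightarrow> (\<lambda>x. u x - v x) \<in> H10 \<Omega>"
  using H10_add[of u \<Omega> "\<lambda>x. -1 * v x"] H10_cmult[of v \<Omega> "-1"] by simp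

lemma H10_max: "u \<in> H10 \<Omega> \<Longrightarrow> v \<in> H10 \<Omega> \<Longrightarrow> (\<lambda>x. max (u x) (v x)) \<in> H10 \<Omega>"
  by (rule H10_compose2[of u \<Omega> v \<Omega> max])
    (auto intro!: continuous_intros W_max H10_W simp: split_beta)

lemma H10_pos_part: "u \<in> H10 \<Omega> \<Longrightarrow> (\<lambda>x. max (u x) 0) \<in> H10 \<Omega>"
  by (rule H10_max[OF _ H10_zero])

text \<open>Outside \<open>\<Omega>\<close> a representative of \<open>v\<close> vanishes
  quasi-everywhere, and the minimum of 0 and a nonnegative number is 0. As \<open>u\<close> is
  nonnegative only almost everywhere, it is first replaced by \<open>max u 0\<close>, which also
  makes the composed representative vanish.\<close>

lemma H10_min_nonneg:
  assumes "u \<in> H10 D" "AE x in lebesgue. 0 \<le> u x" "v \<in> H10 \<Omega>"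
  shows "(\<lambda>x. min (u x) (v x)) \<in> H10 \<Omega>"
proof -
  have "W (\<lambda>x. min (max (u x) 0) (v x)) (\<lambda>x. if v x > max (u x) 0 then if u x > 0 then weak_grad UNIV u x else 0 else weak_grad UNIV v x)"
    using assms by (intro W_min W_pos_part H10_W)
  then have "(\<lambda>x. min (max (u x) 0) (v x)) \<in> H10 \<Omega>"
    by (rule H10_compose2[OF assms(1,3), of "\<lambda>a b. min (max a 0) b", rotated])
      (auto intro!: continuous_intros simp: split_beta)
  moreover have "AE x in lebesgue. min (max (u x) 0) (v x) = min (u x) (v x)"
    using assms(2) by eventually_elim auto
  ultimately show ?thesis
    by (rule H10_cong_AE)
qed

text \<open>A fast converging sequence converges uniformly outside open sets of small capacity.\<close>

lemma H10_limit_fast: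
  fixes u :: "nat \<Rightarrow> 'a::euclidean_space \<Rightarrow> real"
  assumes u: "\<And>n. u n \<in> H10 \<Omega>" and W: "\<And>n. W (u n) (g n)" and v: "W v k"
    and fast: "\<And>n. nrm (\<lambda>x. (u (Suc n) x, g (Suc n) x) - (u n x, g n x)) \<le> (1/4)^n"
    and conv: "AE x in lebesgue. (\<lambda>n. u n x) \<longlonglongrightarrow> v x"
  shows "v \<in> H10 \<Omega>"
proof -
  have "\<forall>n. \<exists>w. quasi_continuous w \<and> (AE x in lebesgue. w x = u n x) \<and> capacity {x \<in> - \<Omega>. w x \<noteq> 0} = 0"
  proof
    fix n
    show "\<exists>w. quasi_continuous w \<and> (AE x in lebesgue. w x = u n x) \<and> capacity {x \<in> - \<Omega>. w x \<noteq> 0} = 0"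
      by (rule H10E[OF u[of n]]) blast
  qed
  from choice[OF this] obtain w where "\<forall>n. quasi_continuous (w n) \<and> (AE x in lebesgue. w n x = u n x) \<and>
      capacity {x \<in> - \<Omega>. w n x \<noteq> 0} = 0"
    by blast
  then have w: "\<And>n. quasi_continuous (w n)" "\<And>n. AE x in lebesgue. w n x = u n x"
    "\<And>n. capacity {x \<in> - \<Omega>. w n x \<noteq> 0} = 0"
    by simp_all
  have "\<forall>n. \<exists>G. open G \<and> capacity G < ennreal (((1/4)^n)\<^sup>2) \<and> continuous_on (- G) (w n)"
  proof
    fix n
    have "(1/4::real)^n > 0" by simp
    then show "\<exists>G. open G \<and> capacity G < ennreal (((1/4)^n)\<^sup>2) \<and> continuous_on (- G) (w n)"
      by (rule quasi_continuousE[OF w(1)[of n]]) blast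
  qed
  then obtain G where G: "\<And>n. open (G n)" "\<And>n. capacity (G n) < ennreal (((1/4)^n)\<^sup>2)"
    "\<And>n. continuous_on (- G n) (w n)"
    by metis
  \<comment> \<open>The difference of representatives is continuous only off \<open>G n\<close> and
    \<open>G (Suc n)\<close>; adjoining them makes the superlevel set open. Off \<open>B n\<close>
    consecutive representatives differ by at most \<open>(1/2)^n\<close>.\<close>
  define E where "E n = {x. \<bar>w (Suc n) x - w n x\<bar> > (1/2)^n} \<union> (G n \<union> G (Suc n))" for n
  define B where "B n = E n \<union> (G n \<union> G (Suc n))" for n
  have oB: "open (B n)" for n
  proof -
    have "continuous_on (- (G n \<union> G (Suc n))) (\<lambda>x. \<bar>w (Suc n) x - w n x\<bar>)"
      by (intro continuous_intros continuous_on_subset[OF G(3)]) auto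
    then have "open (E n)"
      unfolding E_def using G(1) by (intro open_superlevel_Un) auto
    then show ?thesis
      unfolding B_def using G(1) by auto
  qed
  have capB: "capacity (B n) < ennreal ((4 * (1/2)^n)\<^sup>2)" for n
  proof -
    have p: "(1/4::real)^n > 0" "(1/4::real)^Suc n > 0" by simp_all
    obtain N z q where z: "W z q" "open N" "G n \<union> G (Suc n) \<subseteq> N" "AE x in lebesgue. x \<in> N \<longrightarrow> 1 \<le> z x"
      "\<forall>x. 0 \<le> z x" "nrm (pr z q) < (1/4)^n + (1/4)^Suc n"
      by (rule capacity_lessE[OF capacity_Un[OF G(2) p(1) G(2) p(2)]]) (use p in auto)
    define d where "d x = \<bar>u (Suc n) x - u n x\<bar>" for x
    define e where "e x = (if - (u (Suc n) x - u n x) > u (Suc n) x - u n x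
        then - (g (Suc n) x - g n x) else g (Suc n) x - g n x)" for x
    have Wd: "W d e"
      unfolding d_def e_def by (intro W_abs W_diff W)
    have nd: "nrm (pr d e) \<le> (1/4)^n"
    proof -
      have "nrm (pr d e) = nrm (\<lambda>x. (u (Suc n) x, g (Suc n) x) - (u n x, g n x))"
        by (rule nrm_cong_AE) (auto simp: d_def e_def norm_Pair norm_minus_commute)
      then show ?thesis using fast[of n] by simp
    qed
    have nd': "nrm (\<lambda>x. (2^n * d x, 2^n *\<^sub>R e x)) \<le> (1/2)^n"
    proof -
      have "nrm (\<lambda>x. (2^n * d x, 2^n *\<^sub>R e x)) = 2^n * nrm (pr d e)"
        using nrm_scaleR[of "2^n" "\<lambda>x. (d x, e x)"] by simp
      also have "\<dots> \<le> 2^n * (1/4)^n"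
        using nd by (intro mult_left_mono) auto
      also have "\<dots> = (1/2)^n"
        by (simp add: power_mult_distrib[symmetric])
      finally show ?thesis .
    qed
    \<comment> \<open>A competitor for \<open>B n\<close>: the scaled difference is at least 1 where
      the representatives differ by more than \<open>(1/2)^n\<close>, and \<open>z\<close> handles
      the two exceptional sets. The rate \<open>(1/4)^n\<close> absorbs the factor
      \<open>2^n\<close>. Since \<open>B n\<close> is its own open neighbourhood, equality of
      representatives and functions almost everywhere is enough.\<close>
    define z' q' where "z' x = 2^n * d x + z x" and "q' x = 2^n *\<^sub>R e x + q x" for x
    have Wd': "W (\<lambda>x. 2^n * d x) (\<lambda>x. 2^n *\<^sub>R e x)"
      by (rule W_scaleR[OF Wd])
    have Wz': "W z' q'"
      unfolding z'_def q'_def by (rule W_add[OF Wd' z(1)])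
    have "AE x in lebesgue. x \<in> B n \<longrightarrow> 1 \<le> z' x"
      using w(2)[of n] w(2)[of "Suc n"] z(4)
    proof eventually_elim
      case (elim x)
      show ?case
      proof
        assume "x \<in> B n"
        then consider "\<bar>w (Suc n) x - w n x\<bar> > (1/2)^n" | "x \<in> N"
          using z(3) by (auto simp: B_def E_def)
        then show "1 \<le> z' x"
        proof cases
          case 1
          then have "2^n * d x \<ge> 2^n * (1/2)^n"
            using elim by (intro mult_left_mono) (auto simp: d_def)
          then show ?thesis
            using z(5)[rule_format, of x] by (simp add: z'_def power_mult_distrib[symmetric])
        next
          case 2
          then show ?thesis
            using elim(3) by (simp add: z'_def d_def add_nonneg_nonneg add_increasing)
        qed
      qed
    qed
    then have "capacity (B n) \<le> ennreal ((nrm (pr z' q'))\<^sup>2)"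
      using oB by (intro capacity_le[OF Wz']) auto
    also have "\<dots> < ennreal ((4 * (1/2)^n)\<^sup>2)"
    proof -
      have "nrm (pr z' q') \<le> nrm (\<lambda>x. (2^n * d x, 2^n *\<^sub>R e x)) + nrm (pr z q)"
        using nrm_triangle[OF L2_Pair[OF W_L2[OF Wd']] L2_Pair[OF W_L2[OF z(1)]]] by (simp add: z'_def q'_def)
      also have "\<dots> < (1/2)^n + ((1/4)^n + (1/4)^Suc n)"
        using nd' z(6) by linarith
      also have "\<dots> \<le> (1/2)^n + ((1/2)^n + (1/2)^n)"
      proof -
        have "(1/4::real)^n \<le> (1/2)^n"
          by (intro power_mono) auto
        moreover have "(1/4::real)^Suc n \<le> (1/4)^n"
          by simp
        ultimately show ?thesis by linarith
      qed
      also have "\<dots> < 4 * (1/2)^n" by simp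
      finally show ?thesis
        by (intro ennreal_lessI power_strict_mono) auto
    qed
    finally show ?thesis .
  qed
  define T where "T m = (\<Union>n. B (n + m))" for m
  have capT: "capacity (T m) \<le> ennreal ((8 * (1/2)^m)\<^sup>2)" for m
  proof -
    have "(\<lambda>n. (4 * (1/2)^m) * (1/2)^n) sums ((4 * (1/2)^m) * (1 / (1 - 1/2 :: real)))"
      by (intro sums_mult geometric_sums) auto
    then have s: "(\<lambda>n. 4 * (1/2)^(n + m)) sums (8 * (1/2)^m :: real)"
      by (simp add: power_add mult_ac)
    from capacity_UN[of "\<lambda>n. B (n + m)", OF capB] s show ?thesis
      by (simp add: T_def sums_iff)
  qed
  define l where "l x = (if convergent (\<lambda>n. w n x) then lim (\<lambda>n. w n x) else 0)" for x
  have lI: "l x = a" if "(\<lambda>n. w n x) \<longlonglongrightarrow> a" for x a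
    using that by (auto simp: l_def convergent_def limI)
  have cont: "continuous_on (- T m) l" for m
  proof -
    \<comment> \<open>This bound is uniform off \<open>T m\<close>, so the telescoping series
      converges uniformly there and its sum is continuous.\<close>
    have bd: "norm (w (Suc (n + m)) x - w (n + m) x) \<le> (1/2)^(n + m)" if "x \<in> - T m" for n x
    proof -
      have "x \<notin> B (n + m)" using that by (auto simp: T_def)
      then show ?thesis by (auto simp: B_def E_def)
    qed
    have "summable (\<lambda>n. (1/2)^(n + m) :: real)"
      by (simp add: summable_iff_shift[of "\<lambda>n. (1/2)^n"] summable_geometric)
    then have "uniform_limit (- T m) (\<lambda>n x. \<Sum>i<n. w (Suc (i + m)) x - w (i + m) x)
        (\<lambda>x. \<Sum>i. w (Suc (i + m)) x - w (i + m) x) sequentially"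
      by (rule Weierstrass_m_test[rotated]) (rule bd)
    moreover have "(\<Sum>i<n. w (Suc (i + m)) x - w (i + m) x) = w (n + m) x - w m x" for n x
      using sum_lessThan_telescope[of "\<lambda>i. w (i + m) x" n] by simp
    ultimately have "uniform_limit (- T m) (\<lambda>n x. (w (n + m) x - w m x) + w m x)
        (\<lambda>x. (\<Sum>i. w (Suc (i + m)) x - w (i + m) x) + w m x) sequentially"
      by (intro uniform_limit_add uniform_limit_const) simp
    then have ul: "uniform_limit (- T m) (\<lambda>n x. w (n + m) x)
        (\<lambda>x. (\<Sum>i. w (Suc (i + m)) x - w (i + m) x) + w m x) sequentially"
      by simp
    have "continuous_on (- T m) (\<lambda>x. (\<Sum>i. w (Suc (i + m)) x - w (i + m) x) + w m x)"
    proof (rule uniform_limit_theorem[OF _ ul])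
      show "\<forall>\<^sub>F n in sequentially. continuous_on (- T m) (w (n + m))"
        by (intro always_eventually allI continuous_on_subset[OF G(3)]) (auto simp: T_def B_def)
    qed simp
    moreover have "(\<Sum>i. w (Suc (i + m)) x - w (i + m) x) + w m x = l x" if "x \<in> - T m" for x
      by (rule lI[symmetric], rule LIMSEQ_offset[of "\<lambda>n. w n x" m]) (rule tendsto_uniform_limitI[OF ul that])
    ultimately show ?thesis
      by (simp cong: continuous_on_cong_simp)
  qed
  show ?thesis
  proof (rule H10I[OF v])
    show "quasi_continuous l"
    proof (rule quasi_continuousI)
      fix c :: real assume "c > 0"
      then obtain m where m: "(1/2::real)^m < c / 8"
        using real_arch_pow_inv[of "c / 8" "1/2"] by auto
      have "capacity (T m) \<le> ennreal ((8 * (1/2)^m)\<^sup>2)"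
        by (rule capT)
      also have "\<dots> < ennreal (c\<^sup>2)"
        using m \<open>c > 0\<close> by (intro ennreal_lessI power_strict_mono) auto
      finally show "\<exists>G. open G \<and> capacity G < ennreal (c\<^sup>2) \<and> continuous_on (- G) l"
        using cont[of m] oB by (intro exI[of _ "T m"]) (auto simp: T_def)
    qed
    have "AE x in lebesgue. \<forall>n. w n x = u n x"
      using w(2) by (simp add: AE_all_countable)
    with conv show "AE x in lebesgue. l x = v x"
      by eventually_elim (auto intro: lI)
    \<comment> \<open>If all \<open>w n\<close> vanish at a point, the limit exists there and is 0;
      so the exceptional set of \<open>l\<close> lies in a countable union of sets of capacity
      zero.\<close>
    have "{x \<in> - \<Omega>. l x \<noteq> 0} \<subseteq> (\<Union>n. {x \<in> - \<Omega>. w n x \<noteq> 0})"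
    proof
      fix x assume x: "x \<in> {x \<in> - \<Omega>. l x \<noteq> 0}"
      have "\<exists>n. w n x \<noteq> 0"
      proof (rule ccontr)
        assume "\<not> (\<exists>n. w n x \<noteq> 0)"
        then have "l x = 0"
          by (intro lI) simp
        with x show False by simp
      qed
      with x show "x \<in> (\<Union>n. {x \<in> - \<Omega>. w n x \<noteq> 0})" by auto
    qed
    from capacity_mono[OF this] show "capacity {x \<in> - \<Omega>. l x \<noteq> 0} = 0"
      using capacity_UN_0[of "\<lambda>n. {x \<in> - \<Omega>. w n x \<noteq> 0}", OF w(3)] by simp
  qed
qed

text \<open>Two extractions reduce to the fast case: the first gives convergence almost everywhere,
  the second a geometric rate for the pairs of function and gradient.\<close>

lemma H10_limit:
  assumes u: "\<And>n. u n \<in> H10 \<Omega>" and W: "\<And>n. W (u n) (g n)" and v: "W v k"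
    and conv: "L2_conv u v" "L2_conv g k"
  shows "v \<in> H10 \<Omega>"
proof -
  have L: "L2 (u n)" "L2 (g n)" for n
    using W W_L2 by blast+
  note Lv = W_L2[OF v]
  define z where "z n x = (u n x, g n x)" for n x
  have Lz: "L2 (z n)" "L2 (pr v k)" for n
    using L Lv by (auto simp: z_def[abs_def] intro: L2_Pair)
  obtain r where r: "strict_mono r" "AE x in lebesgue. (\<lambda>n. u (r n) x) \<longlonglongrightarrow> v x"
    using L2_conv_AE_subseq[OF L(1) Lv(1) conv(1)] by auto
  have "(\<lambda>n. nrm (\<lambda>x. z n x - (v x, k x))) \<longlonglongrightarrow> 0"
    unfolding z_def by (rule nrm_Pair_diff_tendsto[OF L Lv conv])
  from LIMSEQ_subseq_LIMSEQ[OF this r(1)] have c: "(\<lambda>n. nrm (\<lambda>x. z (r n) x - (v x, k x))) \<longlonglongrightarrow> 0"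
    by (simp add: o_def)
  have "\<exists>N. \<forall>m\<ge>N. \<forall>n\<ge>N. nrm (\<lambda>x. z (r m) x - z (r n) x) < e" if e: "e > 0" for e
  proof -
    obtain N where N: "\<And>n. n \<ge> N \<Longrightarrow> nrm (\<lambda>x. z (r n) x - (v x, k x)) < e / 2"
      using LIMSEQ_D[OF c, of "e / 2"] e by auto
    have "nrm (\<lambda>x. z (r m) x - z (r n) x) < e" if "m \<ge> N" "n \<ge> N" for m n
      using nrm_triangle_diff[OF Lz(1)[of "r m"] Lz(2) Lz(1)[of "r n"]] N[OF that(1)] N[OF that(2)]
        nrm_minus_commute[of "z (r n)" "\<lambda>x. (v x, k x)"] by linarith
    then show ?thesis by blast
  qed
  from Cauchy_fast_subseq[OF this] obtain q where q: "strict_mono q"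
    "\<And>n. nrm (\<lambda>x. z (r (q (Suc n))) x - z (r (q n)) x) \<le> (1/4)^n"
    by blast
  have "AE x in lebesgue. (\<lambda>n. u (r (q n)) x) \<longlonglongrightarrow> v x"
    using r(2)
  proof eventually_elim
    case (elim x)
    from LIMSEQ_subseq_LIMSEQ[OF this q(1)] show ?case by (simp add: o_def)
  qed
  then show ?thesis
    using q(2) unfolding z_def
    by (intro H10_limit_fast[of "\<lambda>n. u (r (q n))" \<Omega> "\<lambda>n. g (r (q n))", OF u W v]) auto
qed

subsection \<open>The energy functional\<close>

abbreviation grad :: "('a::euclidean_space \<Rightarrow> real) \<Rightarrow> 'a \<Rightarrow> 'a" where
  "grad u \<equiv> weak_grad UNIV u"

definition energy :: "('a::euclidean_space \<Rightarrow> real) \<Rightarrow> ('a \<Rightarrow> real) \<Rightarrow> real" where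
  "energy q u = (nrm (grad u))\<^sup>2 / 2 - ip q u"

lemma grad_AE:
  assumes "W u g"
  shows "AE x in lebesgue. grad u x = g x"
  using assms by (intro W_unique[OF weak_grad_W assms]) (auto simp: H1_UNIV_iff)

lemma ip_grad: "W u g \<Longrightarrow> W v k \<Longrightarrow> ip (grad u) (grad v) = ip g k"
  by (intro ip_cong_AE grad_AE)

lemma energy_W:
  assumes "W u g"
  shows "energy q u = (nrm g)\<^sup>2 / 2 - ip q u"
  using ip_grad[OF assms assms] by (simp add: energy_def ip_self)

lemma energy_cong_AE:
  assumes "W u g" "AE x in lebesgue. u x = v x"
  shows "energy q u = energy q v"
proof -
  have "W v g"
    by (rule W_cong_AE[OF assms]) auto
  moreover have "ip q u = ip q v"
    by (rule ip_cong_AE[OF _ assms(2)]) auto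
  ultimately show ?thesis
    using assms(1) by (simp add: energy_W)
qed

text \<open>At each point maximum and minimum carry the two values and gradients of \<open>u\<close>
  and \<open>v\<close> in some order, so every integrand is merely rearranged. Consequently
  \<open>energy q (max w y) \<le> energy q w\<close> is equivalent to
  \<open>energy q y \<le> energy q (min w y)\<close>.\<close>

lemma energy_lattice:
  assumes q: "L2 q" and u: "W u g" and v: "W v k"
  shows "energy q (\<lambda>x. max (u x) (v x)) + energy q (\<lambda>x. min (u x) (v x)) = energy q u + energy q v"
proof -
  define a b where "a x = (if v x > u x then k x else g x)" and "b x = (if v x > u x then g x else k x)" for x
  have Wa: "W (\<lambda>x. max (u x) (v x)) a" and Wb: "W (\<lambda>x. min (u x) (v x)) b"
    unfolding a_def b_def by (intro W_max W_min u v)+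
  have "(nrm a)\<^sup>2 + (nrm b)\<^sup>2 = (LINT x|lebesgue. (norm (a x))\<^sup>2 + (norm (b x))\<^sup>2)"
    using W_L2(2)[OF Wa] W_L2(2)[OF Wb] by (simp add: nrm_power2 L2_integrable)
  also have "\<dots> = (LINT x|lebesgue. (norm (g x))\<^sup>2 + (norm (k x))\<^sup>2)"
    by (intro Bochner_Integration.integral_cong) (auto simp: a_def b_def)
  also have "\<dots> = (nrm g)\<^sup>2 + (nrm k)\<^sup>2"
    using W_L2(2)[OF u] W_L2(2)[OF v] by (simp add: nrm_power2 L2_integrable)
  finally have 1: "(nrm a)\<^sup>2 + (nrm b)\<^sup>2 = (nrm g)\<^sup>2 + (nrm k)\<^sup>2" .
  have "ip q (\<lambda>x. max (u x) (v x)) + ip q (\<lambda>x. min (u x) (v x)) = ip q (\<lambda>x. max (u x) (v x) + min (u x) (v x))"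
    using q W_L2(1)[OF Wa] W_L2(1)[OF Wb] by (simp add: ip_add_right)
  also have "(\<lambda>x. max (u x) (v x) + min (u x) (v x)) = (\<lambda>x. u x + v x)"
    by (auto simp: max_def min_def)
  also have "ip q (\<lambda>x. u x + v x) = ip q u + ip q v"
    using q W_L2(1)[OF u] W_L2(1)[OF v] by (simp add: ip_add_right)
  finally have 2: "ip q (\<lambda>x. max (u x) (v x)) + ip q (\<lambda>x. min (u x) (v x)) = ip q u + ip q v" .
  show ?thesis
    using 1 2 by (simp add: energy_W[OF Wa] energy_W[OF Wb] energy_W[OF u] energy_W[OF v] field_simps)
qed

lemma energy_line:
  assumes q: "L2 q" and u: "W u g" and v: "W v k"
  shows "energy q (\<lambda>x. u x + t * v x) = energy q u + t * (ip g k - ip q v) + t\<^sup>2 * ((nrm k)\<^sup>2 / 2)"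
proof -
  have Wt: "W (\<lambda>x. u x + t * v x) (\<lambda>x. g x + t *\<^sub>R k x)"
    by (intro W_add W_scaleR u v)
  note L = W_L2[OF u] W_L2[OF v]
  have 1: "(nrm (\<lambda>x. g x + t *\<^sub>R k x))\<^sup>2 = (nrm g)\<^sup>2 + 2 * t * ip g k + t\<^sup>2 * (nrm k)\<^sup>2"
    unfolding ip_self[symmetric] using L
    by (simp add: ip_add_left ip_add_right L2_add L2_scaleR ip_scale_left ip_scale_right ip_commute[of k g])
      (simp add: power2_eq_square algebra_simps)
  have 2: "ip q (\<lambda>x. u x + t * v x) = ip q u + t * ip q v"
    using q L ip_scale_right[of q t v] by (simp add: ip_add_right L2_cmult)
  show ?thesis
    unfolding energy_W[OF Wt] energy_W[OF u] 1 2 by (simp add: algebra_simps add_divide_distrib)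
qed

text \<open>The expansion along \<open>v - u\<close> is exact; eliminating its linear term between
  the parameters 1/2 and 1 leaves the quadratic defect with factor 1/8.\<close>

lemma energy_midpoint:
  assumes q: "L2 q" and u: "W u g" and v: "W v k"
  shows "energy q (\<lambda>x. (u x + v x) / 2) = energy q u / 2 + energy q v / 2 - (nrm (\<lambda>x. g x - k x))\<^sup>2 / 8"
proof -
  have Wd: "W (\<lambda>x. v x - u x) (\<lambda>x. k x - g x)"
    by (intro W_diff u v)
  have "(\<lambda>x. (u x + v x) / 2) = (\<lambda>x. u x + (1/2) * (v x - u x))" "v = (\<lambda>x. u x + 1 * (v x - u x))"
    by (auto simp: field_simps)
  then have "energy q (\<lambda>x. (u x + v x) / 2) = energy q u + (1/2) * (ip g (\<lambda>x. k x - g x) - ip q (\<lambda>x. v x - u x))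
      + (nrm (\<lambda>x. k x - g x))\<^sup>2 / 8"
    "energy q v = energy q u + (ip g (\<lambda>x. k x - g x) - ip q (\<lambda>x. v x - u x)) + (nrm (\<lambda>x. k x - g x))\<^sup>2 / 2"
    using energy_line[OF q u Wd, of "1/2"] energy_line[OF q u Wd, of 1] by (simp_all add: power2_eq_square)
  then show ?thesis
    by (simp add: nrm_minus_commute[of g k] field_simps)
qed

lemma energy_tendsto:
  assumes q: "L2 q" and W: "\<And>n. W (u n) (g n)" "W v k"
    and conv: "L2_conv u v" "L2_conv g k"
  shows "(\<lambda>n. energy q (u n)) \<longlonglongrightarrow> energy q v"
proof -
  have L: "L2 (u n)" "L2 (g n)" for n
    using W(1) W_L2 by blast+
  note Lv = W_L2[OF W(2)]
  have "(\<lambda>n. (nrm (g n))\<^sup>2 / 2 - ip (u n) q) \<longlonglongrightarrow> (nrm k)\<^sup>2 / 2 - ip v q"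
    by (intro tendsto_intros nrm_tendsto[OF L(2) Lv(2) conv(2)] ip_tendsto[OF L(1) Lv(1) q conv(1)]) simp
  then show ?thesis
    by (simp add: energy_W[OF W(1)] energy_W[OF W(2)] ip_commute)
qed

lemma AE_nonneg_limit:
  assumes "\<And>n. L2 (u n)" "L2 v" "L2_conv u v" "\<And>n. AE x in lebesgue. 0 \<le> u n x"
  shows "AE x in lebesgue. (0::real) \<le> v x"
proof -
  obtain r where r: "AE x in lebesgue. (\<lambda>n. u (r n) x) \<longlonglongrightarrow> v x"
    using L2_conv_AE_subseq[OF assms(1-3)] by auto
  have "AE x in lebesgue. \<forall>n. 0 \<le> u n x"
    using assms(4) by (simp add: AE_all_countable)
  with r show ?thesis
  proof eventually_elim
    case (elim x)
    then show ?case
      by (intro LIMSEQ_le_const[OF elim(1)]) auto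
  qed
qed

lemma first_order_nonneg:
  fixes a b t0 :: real
  assumes "\<And>t. 0 < t \<Longrightarrow> t \<le> t0 \<Longrightarrow> 0 \<le> t * a + t\<^sup>2 * b" "t0 > 0"
  shows "0 \<le> a"
proof -
  have "\<forall>\<^sub>F t in at_right 0. 0 \<le> a + t * b"
    using eventually_at_right_real[OF assms(2)]
  proof eventually_elim
    case (elim t)
    then have "0 \<le> t * (a + t * b)"
      using assms(1)[of t] by (simp add: power2_eq_square algebra_simps)
    then show ?case
      using elim by (simp add: zero_le_mult_iff)
  qed
  moreover have "((\<lambda>t. a + t * b) \<longlongrightarrow> a + 0 * b) (at_right 0)"
    by (intro tendsto_intros)
  ultimately have "0 \<le> a + 0 * b"
    by (intro tendsto_lowerbound[OF _ _ trivial_limit_at_right_real])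
  then show ?thesis by simp
qed

subsection \<open>Subsolutions\<close>

text \<open>In the application \<open>q\<close> is \<open>- f\<close> on \<open>D\<close> and 0
  elsewhere; the ball provides the Poincare constant \<open>2 * R + 1\<close>.\<close>

locale bounded_domain =
  fixes D :: "'a::euclidean_space set" and R :: real and q :: "'a \<Rightarrow> real"
  assumes D: "open D" "D \<subseteq> ball 0 R" "R \<ge> 0" and q: "L2 q"
begin

lemma H10_Poincare:
  assumes "v \<in> H10 D" "W v k"
  shows "nrm v \<le> (2 * R + 1) * nrm k"
proof (rule Poincare[OF assms(2) _ D(3)])
  show "AE x in lebesgue. x \<notin> ball 0 R \<longrightarrow> v x = 0"
    using H10_AE_zero[OF assms(1)] by eventually_elim (use D(2) in auto)
qed

text \<open>By Cauchy-Schwarz and Poincare the linear term is at most a constant times the gradient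
  norm; completing the square gives the bound.\<close>

lemma energy_bounded_below: "v \<in> H10 D \<Longrightarrow> - ((nrm q * (2 * R + 1))\<^sup>2) / 2 \<le> energy q v"
proof -
  assume v: "v \<in> H10 D"
  have W: "W v (grad v)" by (rule H10_W[OF v])
  have "ip q v \<le> nrm q * nrm v"
    using ip_Cauchy_Schwarz[OF q H10_L2[OF v]] by simp
  also have "\<dots> \<le> nrm q * ((2 * R + 1) * nrm (grad v))"
    by (intro mult_left_mono H10_Poincare[OF v W]) simp
  finally have "energy q v \<ge> (nrm (grad v))\<^sup>2 / 2 - nrm q * (2 * R + 1) * nrm (grad v)"
    by (simp add: energy_def mult.assoc)
  moreover have "(nrm (grad v) - nrm q * (2 * R + 1))\<^sup>2
      = (nrm (grad v))\<^sup>2 - 2 * (nrm q * (2 * R + 1) * nrm (grad v)) + (nrm q * (2 * R + 1))\<^sup>2"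
    by (simp add: power2_diff)
  moreover have "0 \<le> (nrm (grad v) - nrm q * (2 * R + 1))\<^sup>2" by simp
  ultimately show ?thesis
    by linarith
qed

text \<open>By the parallelogram identity, minimizing sequences are Cauchy.\<close>

lemma energy_minimizer:
  assumes C: "C \<noteq> {}" "C \<subseteq> H10 D"
    and mid: "\<And>a b. a \<in> C \<Longrightarrow> b \<in> C \<Longrightarrow> \<exists>c\<in>C. energy q c \<le> energy q (\<lambda>x. (a x + b x) / 2)"
    and closed: "\<And>u g v k. (\<And>n::nat. u n \<in> C) \<Longrightarrow> (\<And>n. W (u n) (g n)) \<Longrightarrow> W v k \<Longrightarrow>
      L2_conv u v \<Longrightarrow> L2_conv g k \<Longrightarrow> v \<in> C"
  shows "\<exists>v\<in>C. \<forall>c\<in>C. energy q v \<le> energy q c"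
proof -
  define m where "m = Inf (energy q ` C)"
  have bdd: "bdd_below (energy q ` C)"
    using energy_bounded_below C(2) by (intro bdd_belowI[of _ "- ((nrm q * (2 * R + 1))\<^sup>2) / 2"]) auto
  have m: "m \<le> energy q c" if "c \<in> C" for c
    unfolding m_def using bdd that by (intro cInf_lower) auto
  have "\<exists>u\<in>C. energy q u < m + 1 / Suc n" for n
  proof -
    have "Inf (energy q ` C) < m + 1 / Suc n"
      by (simp add: m_def)
    then show ?thesis
      using cInf_lessD[of "energy q ` C"] C(1) by auto
  qed
  then obtain u where u: "\<And>n. u n \<in> C" "\<And>n. energy q (u n) < m + 1 / Suc n"
    by metis
  have uD: "u n \<in> H10 D" for n
    using u(1) C(2) by auto
  define g where "g n = grad (u n)" for n
  have W: "W (u n) (g n)" for n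
    unfolding g_def by (rule H10_W[OF uD])
  have L: "L2 (u n)" "L2 (g n)" for n
    using W_L2[OF W[of n]] by auto
  \<comment> \<open>The Poincare constant plus 1, so that the gradient norm alone controls the norm
    of the pair.\<close>
  define C' where "C' = 2 * R + 2"
  have "C' > 0" using D(3) by (simp add: C'_def)
  have diff: "(nrm (\<lambda>x. pr (u n) (g n) x - pr (u l) (g l) x))\<^sup>2 \<le> C'\<^sup>2 * (4 / Suc n + 4 / Suc l)" for n l
  proof -
    \<comment> \<open>The midpoint is not assumed to lie in \<open>C\<close>. For subsolutions,
      whose class is not shown to be convex, the maximum takes its place.\<close>
    obtain c where c: "c \<in> C" "energy q c \<le> energy q (\<lambda>x. (u n x + u l x) / 2)"
      using mid[OF u(1) u(1)] by blast
    then have "m \<le> energy q (\<lambda>x. (u n x + u l x) / 2)"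
      using m by force
    also have "\<dots> = energy q (u n) / 2 + energy q (u l) / 2 - (nrm (\<lambda>x. g n x - g l x))\<^sup>2 / 8"
      by (rule energy_midpoint[OF q W W])
    finally have 1: "(nrm (\<lambda>x. g n x - g l x))\<^sup>2 \<le> 4 / Suc n + 4 / Suc l"
      using u(2)[of n] u(2)[of l] by simp
    have "nrm (\<lambda>x. pr (u n) (g n) x - pr (u l) (g l) x) \<le> nrm (\<lambda>x. u n x - u l x) + nrm (\<lambda>x. g n x - g l x)"
      using nrm_Pair_le[OF L2_diff[OF L(1) L(1)] L2_diff[OF L(2) L(2)]] by simp
    also have "\<dots> \<le> C' * nrm (\<lambda>x. g n x - g l x)"
      using H10_Poincare[OF H10_diff[OF uD uD] W_diff[OF W W], of n l] by (simp add: C'_def algebra_simps)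
    finally have "(nrm (\<lambda>x. pr (u n) (g n) x - pr (u l) (g l) x))\<^sup>2 \<le> (C' * nrm (\<lambda>x. g n x - g l x))\<^sup>2"
      by (intro power_mono) auto
    also have "\<dots> \<le> C'\<^sup>2 * (4 / Suc n + 4 / Suc l)"
      unfolding power_mult_distrib using 1 by (intro mult_left_mono) auto
    finally show ?thesis .
  qed
  have "\<exists>N. \<forall>n\<ge>N. \<forall>l\<ge>N. nrm (\<lambda>x. pr (u n) (g n) x - pr (u l) (g l) x) < e" if e: "e > 0" for e
  proof -
    obtain N where N: "inverse (of_nat (Suc N)) < e\<^sup>2 / (8 * C'\<^sup>2)"
      using reals_Archimedean[of "e\<^sup>2 / (8 * C'\<^sup>2)"] e \<open>C' > 0\<close> by auto
    have "nrm (\<lambda>x. pr (u n) (g n) x - pr (u l) (g l) x) < e" if "n \<ge> N" "l \<ge> N" for n l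
    proof -
      have "4 / Suc n + 4 / Suc l \<le> 4 / Suc N + 4 / real (Suc N)"
        using that by (intro add_mono divide_left_mono) auto
      then have "C'\<^sup>2 * (4 / Suc n + 4 / Suc l) \<le> C'\<^sup>2 * (8 * inverse (real (Suc N)))"
        by (intro mult_left_mono) (auto simp: divide_inverse)
      also have "\<dots> < C'\<^sup>2 * (8 * (e\<^sup>2 / (8 * C'\<^sup>2)))"
        using N \<open>C' > 0\<close> by (intro mult_strict_left_mono) auto
      also have "\<dots> = e\<^sup>2"
        using \<open>C' > 0\<close> by simp
      finally have "(nrm (\<lambda>x. pr (u n) (g n) x - pr (u l) (g l) x))\<^sup>2 < e\<^sup>2"
        using diff[of n l] by linarith
      then show ?thesis
        using e by (simp add: power_less_imp_less_base)
    qed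
    then show ?thesis by blast
  qed
  from W_complete[OF W this] obtain v k where v: "W v k"
    "L2_conv u v" "L2_conv g k"
    by blast
  have "v \<in> C"
    by (rule closed[OF u(1) W v])
  moreover have "energy q v \<le> m"
  proof (rule LIMSEQ_le[OF energy_tendsto[OF q W v]])
    have "(\<lambda>n. m + inverse (real (Suc n))) \<longlonglongrightarrow> m + 0"
      by (intro tendsto_intros LIMSEQ_inverse_real_of_nat)
    then show "(\<lambda>n. m + 1 / real (Suc n)) \<longlonglongrightarrow> m"
      by (simp add: inverse_eq_divide)
  qed (use u(2) in \<open>auto intro: less_imp_le\<close>)
  ultimately show ?thesis
    using m by force
qed

text \<open>Energy form of the condition that \<open>- \<Delta> y \<le> q\<close> weakly on the set \<open>{y > 0}\<close>. It makes no
  reference to that set and is stable under maxima and under strong limits.\<close>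

definition subsol :: "('a \<Rightarrow> real) \<Rightarrow> bool" where
  "subsol y \<longleftrightarrow> y \<in> H10 D \<and> (AE x in lebesgue. 0 \<le> y x) \<and>
     (\<forall>w\<in>H10 D. (AE x in lebesgue. 0 \<le> w x) \<longrightarrow> energy q (\<lambda>x. max (w x) (y x)) \<le> energy q w)"

lemma subsolD:
  assumes "subsol y"
  shows "y \<in> H10 D" "AE x in lebesgue. 0 \<le> y x"
    "w \<in> H10 D \<Longrightarrow> AE x in lebesgue. 0 \<le> w x \<Longrightarrow> energy q (\<lambda>x. max (w x) (y x)) \<le> energy q w"
  using assms by (auto simp: subsol_def)

lemma subsol_zero: "subsol (\<lambda>x. 0)"
  unfolding subsol_def
proof (intro conjI ballI impI)
  fix w assume w: "w \<in> H10 D" "AE x in lebesgue. 0 \<le> w x"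
  have "AE x in lebesgue. w x = max (w x) 0"
    using w(2) by eventually_elim auto
  from energy_cong_AE[OF H10_W[OF w(1)] this, of q]
  show "energy q (\<lambda>x. max (w x) 0) \<le> energy q w" by simp
qed (auto intro: H10_zero)

text \<open>The condition is used twice: \<open>max w y\<close> is again an admissible comparison
  function, to which the condition for \<open>z\<close> applies.\<close>

lemma subsol_max:
  assumes "subsol y" "subsol z"
  shows "subsol (\<lambda>x. max (y x) (z x))"
  unfolding subsol_def
proof (intro conjI ballI impI)
  show "(\<lambda>x. max (y x) (z x)) \<in> H10 D"
    by (intro H10_max subsolD(1) assms)
  show "AE x in lebesgue. 0 \<le> max (y x) (z x)"
    using subsolD(2)[OF assms(1)] by eventually_elim auto
  fix w assume w: "w \<in> H10 D" "AE x in lebesgue. 0 \<le> w x"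
  have wy: "(\<lambda>x. max (w x) (y x)) \<in> H10 D"
    by (intro H10_max w subsolD(1) assms)
  have "AE x in lebesgue. 0 \<le> max (w x) (y x)"
    using w(2) by eventually_elim auto
  from subsolD(3)[OF assms(2) wy this] subsolD(3)[OF assms(1) w]
  show "energy q (\<lambda>x. max (w x) (max (y x) (z x))) \<le> energy q w"
    by (simp add: max.assoc)
qed

text \<open>The midpoint lies below the maximum, so comparing the subsolution \<open>max y z\<close>
  with the midpoint returns the maximum itself. This supplies the hypothesis \<open>mid\<close> of
  the minimization lemma.\<close>

lemma subsol_midpoint:
  assumes "subsol y" "subsol z"
  shows "energy q (\<lambda>x. max (y x) (z x)) \<le> energy q (\<lambda>x. (y x + z x) / 2)"
proof -
  have "(\<lambda>x. 1 / 2 * (y x + z x)) \<in> H10 D"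
    by (intro H10_cmult H10_add subsolD(1) assms)
  then have mid: "(\<lambda>x. (y x + z x) / 2) \<in> H10 D" by simp
  have "AE x in lebesgue. 0 \<le> (y x + z x) / 2"
    using subsolD(2)[OF assms(1)] subsolD(2)[OF assms(2)] by eventually_elim auto
  from subsolD(3)[OF subsol_max[OF assms] mid this]
  have "energy q (\<lambda>x. max ((y x + z x) / 2) (max (y x) (z x))) \<le> energy q (\<lambda>x. (y x + z x) / 2)" .
  moreover have "(\<lambda>x. max ((y x + z x) / 2) (max (y x) (z x))) = (\<lambda>x. max (y x) (z x))"
    by (auto simp: max_def)
  ultimately show ?thesis by simp
qed

text \<open>Writing the maximum of \<open>w\<close> and \<open>z\<close> as
  \<open>w + (z - w)^+\<close> reduces the passage to the limit to strong continuity of the positive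
  part, available along a subsequence.\<close>

lemma subsol_limit:
  assumes s: "\<And>n::nat. subsol (u n)" and W: "\<And>n. W (u n) (g n)" "W v k"
    and conv: "L2_conv u v" "L2_conv g k"
  shows "subsol v"
  unfolding subsol_def
proof (intro conjI ballI impI)
  show "v \<in> H10 D"
    by (rule H10_limit[OF subsolD(1)[OF s] W conv])
  show "AE x in lebesgue. 0 \<le> v x"
    by (rule AE_nonneg_limit[OF W_L2(1)[OF W(1)] W_L2(1)[OF W(2)] conv(1) subsolD(2)[OF s]])
  fix w assume w: "w \<in> H10 D" "AE x in lebesgue. 0 \<le> w x"
  define p where "p = grad w"
  have Ww: "W w p" unfolding p_def by (rule H10_W[OF w(1)])
  have "\<exists>r. strict_mono r \<and> (\<lambda>n. nrm (\<lambda>x. max (u (r n) x - w x) 0 - max (v x - w x) 0)) \<longlonglongrightarrow> 0 \<and>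
    (\<lambda>n. nrm (\<lambda>x. (if u (r n) x - w x > 0 then g (r n) x - p x else 0) - (if v x - w x > 0 then k x - p x else 0))) \<longlonglongrightarrow> 0"
    by (rule W_pos_part_tendsto) (use conv in \<open>simp_all add: W_diff[OF W(1) Ww] W_diff[OF W(2) Ww]\<close>)
  then obtain r where r:
    "(\<lambda>n. nrm (\<lambda>x. max (u (r n) x - w x) 0 - max (v x - w x) 0)) \<longlonglongrightarrow> 0"
    "(\<lambda>n. nrm (\<lambda>x. (if u (r n) x - w x > 0 then g (r n) x - p x else 0) - (if v x - w x > 0 then k x - p x else 0))) \<longlonglongrightarrow> 0"
    by blast
  have eq: "(\<lambda>x. w x + max (z x - w x) 0) = (\<lambda>x. max (w x) (z x))" for z :: "'a \<Rightarrow> real"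
    by (auto simp: max_def)
  have "(\<lambda>n. energy q (\<lambda>x. w x + max (u (r n) x - w x) 0)) \<longlonglongrightarrow> energy q (\<lambda>x. w x + max (v x - w x) 0)"
    by (rule energy_tendsto[OF q W_add[OF Ww W_pos_part[OF W_diff[OF W(1) Ww]]]
          W_add[OF Ww W_pos_part[OF W_diff[OF W(2) Ww]]]]) (use r in simp_all)
  then have lim: "(\<lambda>n. energy q (\<lambda>x. max (w x) (u (r n) x))) \<longlonglongrightarrow> energy q (\<lambda>x. max (w x) (v x))"
    unfolding eq .
  show "energy q (\<lambda>x. max (w x) (v x)) \<le> energy q w"
    by (rule LIMSEQ_le_const2[OF lim]) (use subsolD(3)[OF s w] in auto)
qed

section \<open>The largest subsolution, its positivity set and its equation\<close>

lemma subsol_minimizer: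
  obtains Y where "subsol Y" "\<forall>y. subsol y \<longrightarrow> energy q Y \<le> energy q y"
proof -
  have "\<exists>v\<in>{y. subsol y}. \<forall>c\<in>{y. subsol y}. energy q v \<le> energy q c"
  proof (rule energy_minimizer)
    show "{y. subsol y} \<noteq> {}"
      using subsol_zero by auto
    show "{y. subsol y} \<subseteq> H10 D"
      by (auto simp: subsol_def)
    show "\<exists>c\<in>{y. subsol y}. energy q c \<le> energy q (\<lambda>x. (a x + b x) / 2)"
      if "a \<in> {y. subsol y}" "b \<in> {y. subsol y}" for a b
      using that subsol_max subsol_midpoint by (intro bexI[of _ "\<lambda>x. max (a x) (b x)"]) auto
  qed (auto intro: subsol_limit)
  then show thesis
    using that by auto
qed

text \<open>The maximum \<open>c\<close> of \<open>Y\<close> and \<open>y\<close> has no more energy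
  than \<open>Y\<close>, while the midpoint of \<open>c\<close> and \<open>Y\<close> has no less.
  The midpoint identity then makes the gradients equal, and Poincare makes the functions
  equal.\<close>

lemma subsol_le_minimizer:
  assumes Y: "subsol Y" "\<forall>y. subsol y \<longrightarrow> energy q Y \<le> energy q y" and y: "subsol y"
  shows "AE x in lebesgue. y x \<le> Y x"
proof -
  define c where "c x = max (Y x) (y x)" for x
  have c: "subsol c"
    unfolding c_def by (rule subsol_max[OF Y(1) y])
  have WY: "W Y (grad Y)" and Wc: "W c (grad c)"
    using Y(1) c by (auto intro: H10_W subsolD(1))
  have "energy q c \<le> energy q Y"
    unfolding c_def by (rule subsolD(3)[OF y subsolD(1,2)[OF Y(1)]])
  moreover have "energy q Y \<le> energy q (\<lambda>x. (c x + Y x) / 2)"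
    using Y(2) subsol_max[OF c Y(1)] subsol_midpoint[OF c Y(1)] by force
  ultimately have "(nrm (\<lambda>x. grad c x - grad Y x))\<^sup>2 \<le> 0"
    using energy_midpoint[OF q Wc WY] by linarith
  then have "nrm (\<lambda>x. grad c x - grad Y x) = 0"
    by simp
  then have "nrm (\<lambda>x. c x - Y x) \<le> 0"
    using H10_Poincare[OF H10_diff[OF subsolD(1)[OF c] subsolD(1)[OF Y(1)]] W_diff[OF Wc WY]] by simp
  then have "nrm (\<lambda>x. c x - Y x) = 0"
    using nrm_nonneg[of "\<lambda>x. c x - Y x"] by linarith
  then have "AE x in lebesgue. c x - Y x = 0"
    using nrm_eq_0_iff[OF L2_diff[OF W_L2(1)[OF Wc] W_L2(1)[OF WY]]] by blast
  then show ?thesis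
    by eventually_elim (auto simp: c_def max_def split: if_splits)
qed

text \<open>The set is taken from a quasi-continuous representative, since the positivity set of a
  function known up to null sets need not be quasi-open. The last conclusion says that it is not
  larger than the positivity set of \<open>u\<close>, up to a null set.\<close>

lemma quasi_open_positivity_set:
  assumes u: "u \<in> H10 D" "AE x in lebesgue. 0 \<le> u x"
  obtains \<Omega> where "quasi_open \<Omega>" "\<Omega> \<subseteq> D" "u \<in> H10 \<Omega>" "AE x in lebesgue. u x = 0 \<longrightarrow> x \<notin> \<Omega>"
proof -
  obtain g w where w: "W u g" "quasi_continuous w" "AE x in lebesgue. w x = u x"
    "capacity {x \<in> - D. w x \<noteq> 0} = 0"
    by (rule H10E[OF u(1)])
  define \<Omega> where "\<Omega> = {x \<in> D. w x > 0}"
  have "quasi_open \<Omega>"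
    unfolding quasi_open_def
  proof (intro allI impI)
    fix e :: real assume "e > 0"
    then obtain G where G: "open G" "capacity G < ennreal e" "continuous_on (- G) w"
      using w(2) unfolding quasi_continuous_def by blast
    \<comment> \<open>Inside \<open>D\<close> the superlevel set is enlarged by \<open>G\<close>;
      adding all of \<open>G\<close> afterwards gives exactly
      \<open>\<Omega> \<union> G\<close>.\<close>
    have "open (D \<inter> ({x. w x > 0} \<union> G) \<union> G)"
      by (rule open_Un[OF open_Int[OF D(1) open_superlevel_Un[OF G(1,3)]] G(1)])
    also have "D \<inter> ({x. w x > 0} \<union> G) \<union> G = \<Omega> \<union> G"
      by (auto simp: \<Omega>_def)
    finally show "\<exists>G. open G \<and> capacity G < ennreal e \<and> open (\<Omega> \<union> G)"
      using G by blast
  qed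
  moreover have "u \<in> H10 \<Omega>"
  proof (rule H10I[OF w(1)])
    \<comment> \<open>The representative \<open>w\<close> may be negative on a null subset of
      \<open>D\<close>, which lies outside \<open>\<Omega>\<close>; its positive part vanishes
      there.\<close>
    show "quasi_continuous (\<lambda>x. max (w x) 0)"
      by (rule quasi_continuous_compose2[OF w(2,2), of "\<lambda>a b. max a 0"])
        (auto intro!: continuous_intros simp: split_beta)
    show "AE x in lebesgue. max (w x) 0 = u x"
      using w(3) u(2) by eventually_elim auto
    have "{x \<in> - \<Omega>. max (w x) 0 \<noteq> 0} \<subseteq> {x \<in> - D. w x \<noteq> 0}"
      by (auto simp: \<Omega>_def max_def split: if_splits)
    from capacity_mono[OF this] show "capacity {x \<in> - \<Omega>. max (w x) 0 \<noteq> 0} = 0"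
      unfolding w(4) by simp
  qed
  moreover have "AE x in lebesgue. u x = 0 \<longrightarrow> x \<notin> \<Omega>"
    using w(3) by eventually_elim (auto simp: \<Omega>_def)
  ultimately show thesis
    using that[of \<Omega>] by (auto simp: \<Omega>_def)
qed

text \<open>If \<open>z\<close> minimizes over the nonnegative functions of
  \<open>H10 \<Omega>\<close>, then for \<open>w \<ge> 0\<close> the function \<open>min w z\<close>
  is a competitor, and the lattice identity turns its inequality into the one defining a
  subsolution. So \<open>Y\<close> has no more energy than any such \<open>z\<close>.\<close>

lemma subsol_minimizer_optimal:
  assumes Y: "\<forall>y. subsol y \<longrightarrow> energy q Y \<le> energy q y" and \<Omega>: "\<Omega> \<subseteq> D"
    and v: "v \<in> H10 \<Omega>" "AE x in lebesgue. 0 \<le> v x"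
  shows "energy q Y \<le> energy q v"
proof -
  define K where "K = {v \<in> H10 \<Omega>. AE x in lebesgue. 0 \<le> v x}"
  have "\<exists>z\<in>K. \<forall>c\<in>K. energy q z \<le> energy q c"
  proof (rule energy_minimizer)
    show "K \<noteq> {}" "K \<subseteq> H10 D"
      using v H10_mono[OF \<Omega>] by (auto simp: K_def)
    fix a b assume ab: "a \<in> K" "b \<in> K"
    then have "(\<lambda>x. 1 / 2 * (a x + b x)) \<in> H10 \<Omega>"
      by (intro H10_cmult H10_add) (auto simp: K_def)
    moreover have "AE x in lebesgue. 0 \<le> (a x + b x) / 2"
    proof -
      have "AE x in lebesgue. 0 \<le> a x" "AE x in lebesgue. 0 \<le> b x"
        using ab by (auto simp: K_def)
      then show ?thesis by eventually_elim simp
    qed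
    ultimately show "\<exists>c\<in>K. energy q c \<le> energy q (\<lambda>x. (a x + b x) / 2)"
      by (intro bexI[of _ "\<lambda>x. (a x + b x) / 2"]) (auto simp: K_def)
  next
    fix u :: "nat \<Rightarrow> 'a \<Rightarrow> real" and g v k
    assume u: "\<And>n. u n \<in> K" and W: "\<And>n. W (u n) (g n)" "W v k"
      and conv: "L2_conv u v" "L2_conv g k"
    have "u n \<in> H10 \<Omega>" "AE x in lebesgue. 0 \<le> u n x" for n
      using u[of n] by (auto simp: K_def)
    then show "v \<in> K"
      using H10_limit[OF _ W conv] AE_nonneg_limit[OF W_L2(1)[OF W(1)] W_L2(1)[OF W(2)] conv(1)]
      by (auto simp: K_def)
  qed
  then obtain z where z: "z \<in> H10 \<Omega>" "AE x in lebesgue. 0 \<le> z x" "\<And>c. c \<in> K \<Longrightarrow> energy q z \<le> energy q c"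
    by (auto simp: K_def)
  have zD: "z \<in> H10 D"
    by (rule H10_mono[OF \<Omega> z(1)])
  have "subsol z"
    unfolding subsol_def
  proof (intro conjI ballI impI zD z(2))
    fix w assume w: "w \<in> H10 D" "AE x in lebesgue. 0 \<le> w x"
    have "(\<lambda>x. min (w x) (z x)) \<in> H10 \<Omega>"
      by (rule H10_min_nonneg[OF w z(1)])
    moreover have "AE x in lebesgue. 0 \<le> min (w x) (z x)"
      using w(2) z(2) by eventually_elim auto
    ultimately have "energy q z \<le> energy q (\<lambda>x. min (w x) (z x))"
      by (intro z(3)) (simp add: K_def)
    then show "energy q (\<lambda>x. max (w x) (z x)) \<le> energy q w"
      using energy_lattice[OF q H10_W[OF w(1)] H10_W[OF zD]] by linarith
  qed
  then have "energy q Y \<le> energy q z"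
    using Y by blast
  also have "\<dots> \<le> energy q v"
    using v by (intro z(3)) (simp add: K_def)
  finally show ?thesis .
qed

text \<open>Splitting a nonnegative test function \<open>v\<close> into \<open>min v (n * Y)\<close>, which is an admissible
  variation in both directions, and the remainder \<open>(v - n * Y)^+\<close>, whose contribution is negligible because
  the term \<open>- n * |grad Y|^2\<close> has a sign.\<close>

lemma minimizer_solves:
  assumes Y: "Y \<in> H10 \<Omega>" "AE x in lebesgue. 0 \<le> Y x" "AE x in lebesgue. Y x = 0 \<longrightarrow> x \<notin> \<Omega>"
    and opt: "\<And>v. v \<in> H10 \<Omega> \<Longrightarrow> AE x in lebesgue. 0 \<le> v x \<Longrightarrow> energy q Y \<le> energy q v"
    and v: "v \<in> H10 \<Omega>"
  shows "ip (grad Y) (grad v) = ip q v"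
proof -
  define g where "g = grad Y"
  have WY: "W Y g" unfolding g_def by (rule H10_W[OF Y(1)])
  note LY = W_L2[OF WY]
  \<comment> \<open>For nonnegative \<open>v\<close> only the variation \<open>Y + t * v\<close> is
    always admissible, which gives one inequality.\<close>
  have nonneg: "ip q v \<le> ip g (grad v)" if v: "v \<in> H10 \<Omega>" "AE x in lebesgue. 0 \<le> v x" for v
  proof -
    have "0 \<le> t * (ip g (grad v) - ip q v) + t\<^sup>2 * ((nrm (grad v))\<^sup>2 / 2)" if "0 < t" "t \<le> 1" for t
    proof -
      have "AE x in lebesgue. 0 \<le> Y x + t * v x"
        using Y(2) v(2) by eventually_elim (use that in auto)
      then have "energy q Y \<le> energy q (\<lambda>x. Y x + t * v x)"
        by (intro opt H10_add H10_cmult Y v)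
      then show ?thesis
        using energy_line[OF q WY H10_W[OF v(1)], of t] by simp
    qed
    then have "0 \<le> ip g (grad v) - ip q v"
      by (rule first_order_nonneg) auto
    then show ?thesis by simp
  qed
  \<comment> \<open>Below a multiple of \<open>Y\<close> the opposite variation
    \<open>Y - t * v\<close> stays nonnegative for \<open>t \<le> 1 / n\<close>.\<close>
  have nonpos: "ip g (grad v) \<le> ip q v" if v: "v \<in> H10 \<Omega>" and n: "n > 0" and vY: "AE x in lebesgue. v x \<le> n * Y x" for v n
  proof -
    have "0 \<le> t * (- (ip g (grad v) - ip q v)) + t\<^sup>2 * ((nrm (grad v))\<^sup>2 / 2)" if t: "0 < t" "t \<le> 1 / n" for t
    proof -
      have "AE x in lebesgue. 0 \<le> Y x + (- t) * v x"
        using Y(2) vY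
      proof eventually_elim
        case (elim x)
        have "t * v x \<le> t * (n * Y x)"
          using elim t by (intro mult_left_mono) auto
        also have "\<dots> = (t * n) * Y x" by simp
        also have "\<dots> \<le> 1 * Y x"
          using elim t n by (intro mult_right_mono) (auto simp: field_simps)
        finally show ?case by simp
      qed
      then have "energy q Y \<le> energy q (\<lambda>x. Y x + (- t) * v x)"
        by (intro opt H10_add H10_cmult Y v)
      then show ?thesis
        unfolding energy_line[OF q WY H10_W[OF v], of "- t"] by (simp add: algebra_simps)
    qed
    then have "0 \<le> - (ip g (grad v) - ip q v)"
      by (rule first_order_nonneg[of "1 / n"]) (use n in auto)
    then show ?thesis by simp
  qed
  have pos: "ip g (grad v) = ip q v" if v: "v \<in> H10 \<Omega>" "AE x in lebesgue. 0 \<le> v x" for v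
  proof -
    define k where "k = grad v"
    have Wv: "W v k" unfolding k_def by (rule H10_W[OF v(1)])
    note Lv = W_L2[OF Wv]
    have [measurable]: "Y \<in> borel_measurable lebesgue" "v \<in> borel_measurable lebesgue"
      "k \<in> borel_measurable lebesgue" "g \<in> borel_measurable lebesgue"
      using LY Lv by auto
    \<comment> \<open>Almost every point eventually leaves \<open>A n\<close>: where
      \<open>Y\<close> vanishes so does \<open>v\<close>, and elsewhere the multiples of
      \<open>Y\<close> outgrow \<open>v\<close>. The successor keeps the multiple positive.\<close>
    define A where "A n x \<longleftrightarrow> real (Suc n) * Y x < v x" for n x
    define kn where "kn n x = (if A n x then k x else 0)" for n x
    define vn where "vn n x = (if A n x then v x else 0)" for n x
    have evA: "AE x in lebesgue. \<forall>\<^sub>F n in sequentially. \<not> A n x"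
      using Y(2,3) H10_AE_zero[OF v(1)]
    proof eventually_elim
      case (elim x)
      show ?case
      proof (cases "Y x = 0")
        case True
        then show ?thesis using elim by (auto simp: A_def)
      next
        case False
        then have "Y x > 0" using elim by auto
        obtain N where N: "v x / Y x \<le> real N"
          using real_arch_simple by blast
        show ?thesis
        proof (rule eventually_sequentiallyI[of N])
          fix n assume "N \<le> n"
          then have "v x / Y x \<le> real (Suc n)" using N by simp
          then show "\<not> A n x"
            using \<open>Y x > 0\<close> by (simp add: A_def divide_le_eq not_less)
        qed
      qed
    qed
    have cut: "L2 (\<lambda>x. if A n x then h x else 0)"
      "(\<lambda>n. nrm (\<lambda>x. if A n x then h x else 0)) \<longlonglongrightarrow> 0" if "L2 h" for n and h :: "'a \<Rightarrow> 'b::euclidean_space"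
    proof -
      have [measurable]: "h \<in> borel_measurable lebesgue"
        using that by auto
      have m: "(\<lambda>x. if A n x then h x else 0) \<in> borel_measurable lebesgue" for n
        unfolding A_def by measurable
      then show "L2 (\<lambda>x. if A n x then h x else 0)"
        by (rule L2_dominated[OF that]) simp
      have "(\<lambda>n. nrm (\<lambda>x. (if A n x then h x else 0) - 0)) \<longlonglongrightarrow> 0"
      proof (rule L2_dominated_convergence(2)[OF _ m])
        show "L2 (\<lambda>x. norm (h x))"
          by (rule L2_dominated[OF that]) auto
        show "AE x in lebesgue. (\<lambda>n. if A n x then h x else 0) \<longlonglongrightarrow> 0"
          using evA
        proof eventually_elim
          case (elim x)
          then have "\<forall>\<^sub>F n in sequentially. (if A n x then h x else 0) = 0"
            by eventually_elim simp
          then show ?case by (rule tendsto_eventually)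
        qed
      qed auto
      then show "(\<lambda>n. nrm (\<lambda>x. if A n x then h x else 0)) \<longlonglongrightarrow> 0" by simp
    qed
    have k0: "(\<lambda>n. nrm (kn n)) \<longlonglongrightarrow> 0" and Lkn: "L2 (kn n)" for n
      unfolding kn_def[abs_def] by (rule cut[OF Lv(2)])+
    have v0: "(\<lambda>n. nrm (vn n)) \<longlonglongrightarrow> 0" and Lvn: "L2 (vn n)" for n
      unfolding vn_def[abs_def] by (rule cut[OF Lv(1)])+
    have bound: "ip g k - ip q v \<le> nrm g * nrm (kn n) + nrm q * nrm (vn n)" for n
    proof -
      define c where "c = real (Suc n)"
      have "c > 0" by (simp add: c_def)
      have Ac: "A n x \<longleftrightarrow> c * Y x < v x" for x
        by (simp add: A_def c_def)
      define r where "r x = max (v x - c * Y x) 0" for x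
      define \<rho> where "\<rho> x = (if v x - c * Y x > 0 then k x - c *\<^sub>R g x else 0)" for x
      define m where "m x = min (v x) (c * Y x)" for x
      have Wr: "W r \<rho>"
        unfolding r_def \<rho>_def by (intro W_pos_part W_diff W_scaleR Wv WY)
      have mH: "m \<in> H10 \<Omega>"
        unfolding m_def by (intro H10_min_nonneg[OF v] H10_cmult Y)
      have "ip g (grad m) \<le> ip q m"
        by (rule nonpos[OF mH \<open>c > 0\<close>]) (simp add: m_def)
      moreover have "v = (\<lambda>x. m x + r x)"
        by (auto simp: m_def r_def max_def min_def)
      then have "W (\<lambda>x. m x + r x) k" "ip q v = ip q m + ip q r"
        using Wv q H10_L2[OF mH] W_L2[OF Wr] by (simp_all add: ip_add_right[symmetric])
      moreover have "ip g k = ip g (grad m) + ip g \<rho>"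
      proof -
        have "ip g k = ip g (\<lambda>x. grad m x + \<rho> x)"
          by (rule ip_cong_AE[OF _ W_unique[OF \<open>W (\<lambda>x. m x + r x) k\<close> W_add[OF H10_W[OF mH] Wr]]]) simp
        then show ?thesis
          using LY W_L2[OF H10_W[OF mH]] W_L2[OF Wr] by (simp add: ip_add_right)
      qed
      moreover have "ip g \<rho> \<le> nrm g * nrm (kn n)"
      proof -
        have "ip g \<rho> \<le> ip g (kn n)"
          unfolding ip_def
        proof (rule integral_mono)
          show "integrable lebesgue (\<lambda>x. g x \<bullet> \<rho> x)" "integrable lebesgue (\<lambda>x. g x \<bullet> kn n x)"
            using LY W_L2[OF Wr] Lkn by (auto intro: L2_inner)
          show "g x \<bullet> \<rho> x \<le> g x \<bullet> kn n x" for x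
            using \<open>c > 0\<close> by (auto simp: \<rho>_def kn_def Ac inner_diff_right)
        qed
        also have "\<dots> \<le> nrm g * nrm (kn n)"
          using ip_Cauchy_Schwarz[OF LY(2) Lkn] by (simp add: abs_le_iff)
        finally show ?thesis .
      qed
      moreover have "- ip q r \<le> nrm q * nrm (vn n)"
      proof -
        \<comment> \<open>As \<open>Y\<close> is nonnegative, the remainder lies between 0 and
          \<open>v\<close>, and it vanishes off \<open>A n\<close>.\<close>
        have "AE x in lebesgue. norm (r x) \<le> norm (vn n x)"
          using Y(2) v(2)
        proof eventually_elim
          case (elim x)
          then have "0 \<le> c * Y x" using \<open>c > 0\<close> by simp
          then show ?case
            using elim by (auto simp: r_def vn_def Ac max_def)
        qed
        then have "nrm r \<le> nrm (vn n)"
          by (rule nrm_mono[OF Lvn W_L2(1)[OF Wr]])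
        then have "nrm q * nrm r \<le> nrm q * nrm (vn n)"
          by (intro mult_left_mono) auto
        then show ?thesis
          using ip_Cauchy_Schwarz[OF q W_L2(1)[OF Wr]] by linarith
      qed
      ultimately show ?thesis by linarith
    qed
    have "(\<lambda>n. nrm g * nrm (kn n) + nrm q * nrm (vn n)) \<longlonglongrightarrow> nrm g * 0 + nrm q * 0"
      by (intro tendsto_intros k0 v0)
    then have "ip g k - ip q v \<le> nrm g * 0 + nrm q * 0"
      by (rule LIMSEQ_le_const) (use bound in auto)
    then show ?thesis
      using nonneg[OF v] by (simp add: k_def)
  qed
  define v1 v2 where "v1 x = max (v x) 0" and "v2 x = max (-1 * v x) 0" for x
  have H: "v1 \<in> H10 \<Omega>" "v2 \<in> H10 \<Omega>"
    unfolding v1_def v2_def by (intro H10_pos_part H10_cmult v)+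
  have eq: "ip g (grad v1) = ip q v1" "ip g (grad v2) = ip q v2"
    by (rule pos; (intro H)?; simp add: v1_def v2_def)+
  have v12: "v = (\<lambda>x. v1 x - v2 x)"
    by (auto simp: v1_def v2_def max_def)
  then have W12: "W v (\<lambda>x. grad v1 x - grad v2 x)"
    using W_diff[OF H10_W[OF H(1)] H10_W[OF H(2)]] by simp
  have "ip g (grad v) = ip g (\<lambda>x. grad v1 x - grad v2 x)"
    by (rule ip_cong_AE[OF _ grad_AE[OF W12]]) simp
  also have "\<dots> = ip q v1 - ip q v2"
    using eq LY W_L2[OF H10_W[OF H(1)]] W_L2[OF H10_W[OF H(2)]] by (simp add: ip_diff_right)
  also have "\<dots> = ip q v"
    using q H10_L2[OF H(1)] H10_L2[OF H(2)] by (subst v12) (simp add: ip_diff_right)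
  finally show ?thesis
    by (simp add: g_def)
qed

text \<open>A solution minimizes the energy on \<open>H10 \<Omega>\<close> without a sign
  constraint, because the linear term of the expansion vanishes. The set contains
  \<open>min w a\<close> for every nonnegative \<open>w\<close> in \<open>H10 D\<close>, so the
  lattice identity applies to \<open>a\<close>; against such \<open>w\<close>, taking the maximum
  with \<open>a\<close> or with its positive part is the same.\<close>

lemma solution_pos_part_subsol:
  assumes \<Omega>: "\<Omega> \<subseteq> D" and a: "a \<in> H10 \<Omega>" and sol: "\<And>v. v \<in> H10 \<Omega> \<Longrightarrow> ip (grad a) (grad v) = ip q v"
  shows "subsol (\<lambda>x. max (a x) 0)"
  unfolding subsol_def
proof (intro conjI ballI impI)
  have aD: "a \<in> H10 D"
    by (rule H10_mono[OF \<Omega> a])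
  then show "(\<lambda>x. max (a x) 0) \<in> H10 D"
    by (rule H10_pos_part)
  fix w assume w: "w \<in> H10 D" "AE x in lebesgue. 0 \<le> w x"
  define b where "b x = min (w x) (a x)" for x
  have b: "b \<in> H10 \<Omega>"
    unfolding b_def by (rule H10_min_nonneg[OF w a])
  have d: "(\<lambda>x. b x - a x) \<in> H10 \<Omega>"
    by (rule H10_diff[OF b a])
  have "energy q (\<lambda>x. a x + 1 * (b x - a x)) = energy q a + (nrm (grad (\<lambda>x. b x - a x)))\<^sup>2 / 2"
    using energy_line[OF q H10_W[OF a] H10_W[OF d], of 1] sol[OF d] by simp
  then have "energy q a \<le> energy q b"
    by simp
  then have "energy q (\<lambda>x. max (w x) (a x)) \<le> energy q w"
    using energy_lattice[OF q H10_W[OF w(1)] H10_W[OF aD]] by (simp add: b_def[abs_def])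
  moreover have "energy q (\<lambda>x. max (w x) (a x)) = energy q (\<lambda>x. max (w x) (max (a x) 0))"
  proof (rule energy_cong_AE[OF H10_W[OF H10_max[OF w(1) aD]]])
    show "AE x in lebesgue. max (w x) (a x) = max (w x) (max (a x) 0)"
      using w(2) by eventually_elim auto
  qed
  ultimately show "energy q (\<lambda>x. max (w x) (max (a x) 0)) \<le> energy q w"
    by simp
qed auto

lemma H10_integrable:
  assumes "u \<in> H10 D"
  shows "integrable lebesgue u"
proof -
  have "integrable lebesgue (\<lambda>x. u x \<bullet> indicator (ball 0 R) x)"
    by (intro L2_inner H10_L2[OF assms] L2_indicator) auto
  moreover have "AE x in lebesgue. u x \<bullet> indicator (ball 0 R) x = u x"
    using H10_AE_zero[OF assms] by eventually_elim (use D(2) in \<open>auto simp: indicator_def\<close>)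
  ultimately show ?thesis
    using L2_measurable[OF H10_L2[OF assms]] by (subst integrable_cong_AE[symmetric]) auto
qed

end

section \<open>Passage from integrals over the whole space to the formal statement\<close>

lemma set_integral_H10:
  assumes "u \<in> H10 \<Omega>"
  shows "(LINT x:\<Omega>|lebesgue. u x) = (LINT x|lebesgue. u x)"
  unfolding set_lebesgue_integral_def
  by (rule integral_lebesgue_cong_AE) (use H10_AE_zero[OF assms] in eventually_elim, auto simp: indicator_def)

text \<open>Outside \<open>D\<close> the function \<open>v\<close> vanishes almost everywhere, and a
  weak gradient vanishes almost everywhere on the zero set of its function.\<close>

lemma set_integral_grad_H10:
  assumes "v \<in> H10 \<Omega>" "\<Omega> \<subseteq> D"
  shows "(LINT x:D|lebesgue. a x \<bullet> grad v x) = ip a (grad v)"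
  unfolding set_lebesgue_integral_def ip_def
proof (rule integral_lebesgue_cong_AE)
  show "AE x in lebesgue. indicat_real D x *\<^sub>R (a x \<bullet> grad v x) = a x \<bullet> grad v x"
    using H10_AE_zero[OF assms(1)] W_zero_set[OF H10_W[OF assms(1)]]
    by eventually_elim (use assms(2) in \<open>auto simp: indicator_def\<close>)
qed

lemma weak_solution_iff:
  assumes "\<Omega> \<subseteq> D"
  shows "weak_solution D f \<Omega> u \<longleftrightarrow>
    u \<in> H10 \<Omega> \<and> (\<forall>v\<in>H10 \<Omega>. ip (grad u) (grad v) = ip (\<lambda>x. indicator D x * f x) v)"
proof -
  have "(LINT x:D|lebesgue. f x * v x) = ip (\<lambda>x. indicator D x * f x) v" for v
    by (simp add: set_lebesgue_integral_def ip_def mult.assoc)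
  then show ?thesis
    using set_integral_grad_H10[OF _ assms] by (auto simp: weak_solution_def)
qed

theorem theorem2p1:
  fixes D :: "'a::euclidean_space set" and f :: "'a \<Rightarrow> real"
  assumes "bounded D" and "open D" and "f \<in> H1 D"
  shows "\<exists>\<Omega>' u'. quasi_open \<Omega>' \<and> \<Omega>' \<subseteq> D \<and> weak_solution D f \<Omega>' u' \<and>
    (\<forall>\<Omega> u. quasi_open \<Omega> \<and> \<Omega> \<subseteq> D \<and> weak_solution D f \<Omega> u \<longrightarrow>
       (LINT x:\<Omega>'|lebesgue. u' x) \<le> (LINT x:\<Omega>|lebesgue. u x))"
proof -
  obtain R where R: "R > 0" "D \<subseteq> ball 0 R"
    using bounded_subset_ballD[OF assms(1)] by blast
  define p where "p x = indicator D x * f x" for x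
  define q where "q x = -1 * p x" for x
  have Lp: "L2 p"
    using assms(3) by (simp add: H1_def L2_on_iff p_def[abs_def])
  have Lq: "L2 q"
    unfolding q_def by (rule L2_cmult[OF Lp])
  have ipq: "ip q v = - ip p v" for v
    using ip_scale_left[of "-1" p v] by (simp add: q_def[abs_def])
  interpret bounded_domain D R q
    by standard (use R assms(2) Lq in auto)
  have neg: "ip (grad (\<lambda>x. -1 * u x)) (grad v) = - ip (grad u) (grad v)" if "u \<in> H10 \<Omega>" "v \<in> H10 \<Omega>" for u v \<Omega>
  proof -
    have "ip (grad (\<lambda>x. -1 * u x)) (grad v) = ip (\<lambda>x. -1 *\<^sub>R grad u x) (grad v)"
      by (rule ip_grad[OF W_scaleR[OF H10_W[OF that(1)]] H10_W[OF that(2)]])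
    then show ?thesis
      using ip_scale_left[of "-1" "grad u" "grad v"] by simp
  qed
  obtain Y where Y: "subsol Y" "\<forall>y. subsol y \<longrightarrow> energy q Y \<le> energy q y"
    by (rule subsol_minimizer)
  obtain \<Omega>' where \<Omega>': "quasi_open \<Omega>'" "\<Omega>' \<subseteq> D" "Y \<in> H10 \<Omega>'" "AE x in lebesgue. Y x = 0 \<longrightarrow> x \<notin> \<Omega>'"
    by (rule quasi_open_positivity_set[OF subsolD(1,2)[OF Y(1)]])
  define u' where "u' x = -1 * Y x" for x
  have u': "u' \<in> H10 \<Omega>'"
    unfolding u'_def by (rule H10_cmult[OF \<Omega>'(3)])
  have "ip (grad u') (grad v) = ip p v" if "v \<in> H10 \<Omega>'" for v
    using neg[OF \<Omega>'(3) that] minimizer_solves[OF \<Omega>'(3) subsolD(2)[OF Y(1)] \<Omega>'(4) subsol_minimizer_optimal[OF Y(2) \<Omega>'(2)] that]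
    by (simp add: u'_def[abs_def] ipq)
  then have sol: "weak_solution D f \<Omega>' u'"
    using u' \<Omega>'(2) by (simp add: weak_solution_iff p_def[abs_def])
  have "(LINT x:\<Omega>'|lebesgue. u' x) \<le> (LINT x:\<Omega>|lebesgue. u x)"
    if \<Omega>: "\<Omega> \<subseteq> D" and u: "weak_solution D f \<Omega> u" for \<Omega> u
  proof -
    have uH: "u \<in> H10 \<Omega>" and us: "\<And>v. v \<in> H10 \<Omega> \<Longrightarrow> ip (grad u) (grad v) = ip p v"
      using u \<Omega> by (auto simp: weak_solution_iff p_def[abs_def])
    have "subsol (\<lambda>x. max (-1 * u x) 0)"
    proof (rule solution_pos_part_subsol[OF \<Omega> H10_cmult[OF uH]])
      fix v assume "v \<in> H10 \<Omega>"
      then show "ip (grad (\<lambda>x. -1 * u x)) (grad v) = ip q v"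
        using neg[OF uH] us by (simp add: ipq)
    qed
    from subsol_le_minimizer[OF Y this] have le: "AE x in lebesgue. u' x \<le> u x"
      by eventually_elim (auto simp: u'_def)
    \<comment> \<open>Each state vanishes almost everywhere off its own domain, so integrals over
      different domains can be compared as integrals over the whole space.\<close>
    have "integral\<^sup>L lebesgue u' \<le> integral\<^sup>L lebesgue u"
      using H10_mono[OF \<Omega>'(2) u'] H10_mono[OF \<Omega> uH] le by (intro integral_mono_AE H10_integrable)
    then show ?thesis
      by (simp add: set_integral_H10[OF u'] set_integral_H10[OF uH])
  qed
  with \<Omega>' sol show ?thesis by blast
qed

end
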